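(* Let $n\ge1$, let $\mathcal M$ be the $\sigma$-ideal of meager subsets of $\mathbb{R}^n$ and $\sigma\mathcal C_0$ the $\sigma$-ideal on $\mathbb{R}^n$ generated by tame Cantor sets. Then (1) $\mathrm{cov}(\sigma\mathcal C_0)=\mathrm{cov}(\mathcal M)$; (2) $\mathrm{non}(\sigma\mathcal C_0)=\mathrm{non}(\mathcal M)$; (3) $\mathrm{add}(\sigma\mathcal C_0)=\mathrm{add}(\sigma\mathcal C_0,\mathcal M)=\mathrm{add}(\mathcal M)$; (4) $\mathrm{cof}(\sigma\mathcal C_0)=\mathrm{cof}(\sigma\mathcal C_0,\mathcal M)=\mathrm{cof}(\mathcal M)$.
   Context: A tame Cantor set in $\mathbb{R}^n$ is a set $C$ such that $h(C)$ is a Cantor set (homeomorph of $\{0,1\}^\omega$) contained in $\mathbb{R}\times\{0\}^{n-1}$ for some homeomorphism $h$ of $\mathbb{R}^n$; $\sigma\mathcal C_0$ consists of all subsets of countable unions of tame Cantor sets. For an ideal $\mathcal I$ on $X=\bigcup\mathcal I$: $\mathrm{add}(\mathcal I)=\min\{|\mathcal A|:\mathcal A\subseteq\mathcal I,\bigcup\mathcal A\notin\mathcal I\}$, $\mathrm{non}(\mathcal I)=\min\{|A|:A\subseteq X, A\notin\mathcal I\}$, $\mathrm{cov}(\mathcal I)=\min\{|\mathcal A|:\mathcal A\subseteq\mathcal I,\bigcup\mathcal A=X\}$, $\mathrm{cof}(\mathcal I)=\min\{|\mathcal A|:\mathcal A\subseteq\mathcal I,\ \forall B\in\mathcal I\ \exists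 A\in\mathcal A\ (B\subseteq A)\}$. For ideals $\mathcal I\subseteq\mathcal J$: $\mathrm{add}(\mathcal I,\mathcal J)=\min\{|\mathcal A|:\mathcal A\subseteq\mathcal I,\bigcup\mathcal A\notin\mathcal J\}$ and $\mathrm{cof}(\mathcal I,\mathcal J)=\min\{|\mathcal A|:\mathcal A\subseteq\mathcal J,\ \forall B\in\mathcal I\ \exists A\in\mathcal A\ (B\subseteq A)\}$. *)

theory Defs
  imports "HOL-Analysis.Analysis"
begin

unbundle cardinal_syntax

text \<open>Cardinals are represented by cardinal orders up to \<open>=o\<close>, as in the library.
  The value of \<open>min_card\<close> at the empty family is unspecified.\<close>

definition min_card :: "'b set set \<Rightarrow> 'b rel" where
  "min_card S = (SOME r. r \<in> card_of ` S \<and> (\<forall>r' \<in> card_of ` S. r \<le>o r'))"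

lemma min_card:
  assumes "S \<noteq> {}"
  shows "min_card S \<in> card_of ` S" and "A \<in> S \<Longrightarrow> min_card S \<le>o |A|"
proof -
  have "\<exists>r. r \<in> card_of ` S \<and> (\<forall>r' \<in> card_of ` S. r \<le>o r')"
    using exists_minim_Card_order[of "card_of ` S"] assms card_of_Card_order by blast
  from someI_ex[OF this]
  have *: "min_card S \<in> card_of ` S \<and> (\<forall>r' \<in> card_of ` S. min_card S \<le>o r')"
    unfolding min_card_def .
  then show "min_card S \<in> card_of ` S" and "A \<in> S \<Longrightarrow> min_card S \<le>o |A|"
    by auto
qed

definition add_ideal :: "'a set set \<Rightarrow> 'a set rel" where
  "add_ideal I = min_card {\<A>. \<A> \<subseteq> I \<and> \<Union>\<A> \<notin> I}"

definition non_ideal :: "'a set set \<Rightarrow> 'a rel" where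
  "non_ideal I = min_card {A. A \<subseteq> \<Union>I \<and> A \<notin> I}"

definition cov_ideal :: "'a set set \<Rightarrow> 'a set rel" where
  "cov_ideal I = min_card {\<A>. \<A> \<subseteq> I \<and> \<Union>\<A> = \<Union>I}"

definition cof_ideal :: "'a set set \<Rightarrow> 'a set rel" where
  "cof_ideal I = min_card {\<A>. \<A> \<subseteq> I \<and> (\<forall>B\<in>I. \<exists>A\<in>\<A>. B \<subseteq> A)}"

definition add_ideals :: "'a set set \<Rightarrow> 'a set set \<Rightarrow> 'a set rel" where
  "add_ideals I J = min_card {\<A>. \<A> \<subseteq> I \<and> \<Union>\<A> \<notin> J}"

definition cof_ideals :: "'a set set \<Rightarrow> 'a set set \<Rightarrow> 'a set rel" where
  "cof_ideals I J = min_card {\<A>. \<A> \<subseteq> J \<and> (\<forall>B\<in>I. \<exists>A\<in>\<A>. B \<subseteq> A)}"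

definition nowhere_dense :: "'a::topological_space set \<Rightarrow> bool" where
  "nowhere_dense A \<longleftrightarrow> interior (closure A) = {}"

definition meager_ideal :: "'a::topological_space set set" where
  "meager_ideal = {A. \<exists>\<N>. countable \<N> \<and> (\<forall>N\<in>\<N>. nowhere_dense N) \<and> A = \<Union>\<N>}"

definition cantor_set :: "'a::topological_space set \<Rightarrow> bool" where
  "cantor_set C \<longleftrightarrow> C homeomorphic (UNIV :: (nat \<Rightarrow> bool) set)"

text \<open>The index type \<open>'n\<close> carries no order, so the coordinate \<open>k\<close> that plays the role of
  the first one is a parameter: \<open>coord_line k\<close> is the line
  \<open>\<real> \<times> {0}\<^sup>n\<^sup>-\<^sup>1\<close> of \<open>real ^ 'n\<close>.\<close>

definition coord_line :: "'n \<Rightarrow> (real ^ 'n) set" where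
  "coord_line k = {x. \<forall>i. i \<noteq> k \<longrightarrow> x $ i = 0}"

definition tame_cantor_set :: "'n::finite \<Rightarrow> (real ^ 'n) set \<Rightarrow> bool" where
  "tame_cantor_set k C \<longleftrightarrow>
     (\<exists>h h'. homeomorphism UNIV UNIV h h' \<and> cantor_set (h ` C) \<and> h ` C \<subseteq> coord_line k)"

definition sigma_C0 :: "'n::finite \<Rightarrow> (real ^ 'n) set set" where
  "sigma_C0 k = {A. \<exists>\<C>. countable \<C> \<and> (\<forall>C\<in>\<C>. tame_cantor_set k C) \<and> A \<subseteq> \<Union>\<C>}"

end

theory Submission
  imports Defs
begin

text \<open>Write \<open>M\<^sub>1\<close> and \<open>M\<^sub>n\<close> for the meager ideals of \<open>\<real>\<close> and \<open>\<real>\<^sup>n\<close>, and \<open>S\<close> for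
  \<open>\<sigma>C\<^sub>0 \<subseteq> M\<^sub>n\<close>. Everything is compared with \<open>M\<^sub>1\<close>. Coding points by sequences of natural numbers
  gives a bijection from \<open>\<real>\<^sup>n\<close> to \<open>\<real>\<close> that preserves meagerness in both directions, so \<open>M\<^sub>1\<close> and
  \<open>M\<^sub>n\<close> have the same invariants. If \<open>B\<close> is meager in \<open>\<real>\<close>, then \<open>B\<^sup>n\<close> is in \<open>S\<close>: for compact
  nowhere dense \<open>K\<close>, shears of \<open>\<real>\<^sup>n\<close> take \<open>K\<^sup>n\<close> into a Cantor set on a line. This bounds \<open>cov(S)\<close>
  and \<open>non(S)\<close>. With the Kuratowski--Ulam theorem it also gives \<open>add(S, M\<^sub>n) \<le> add(M\<^sub>1)\<close> and
  \<open>cof(M\<^sub>1) \<le> cof(S, M\<^sub>n)\<close>.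

  The remaining inequalities \<open>add(M\<^sub>1) \<le> add(S)\<close> and \<open>cof(S) \<le> cof(M\<^sub>1)\<close> use a family of
  homeomorphisms \<open>H\<^sub>x\<close> (\<open>x \<in> \<real>\<close>), infinite compositions of small moves drawn from a countable dense
  set, such that for each \<open>A \<in> S\<close> and all \<open>x\<close> outside a meager set, all coordinate projections
  of \<open>H\<^sub>x(A)\<close> are meager. Fewer than \<open>add(M\<^sub>1)\<close> sets \<open>A\<close> then admit a common \<open>x\<close> and a common meager
  set \<open>B\<close> containing all these projections, so their union lies in the preimage of \<open>B\<^sup>n\<close> under
  \<open>H\<^sub>x\<close>.\<close>

section \<open>Meager sets\<close>

text \<open>The obstacle to \<open>add(M1) \<le> add(S)\<close> is that every tame Cantor set comes
  with its own homeomorphism, so a large union of them offers no common change of coordinates; a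
  single \<open>H x\<close> provides one. Projections become small by moving a Cantor set off the
  hyperplanes \<open>v $ i = q\<close> with \<open>q\<close> rational, since a compact set of reals
  without rationals is nowhere dense. For a countable union of Cantor sets these are countably many
  conditions, each failing on a nowhere dense set of \<open>x\<close>. The parameters are reals
  rather than homeomorphisms so that the sets of bad parameters belong to \<open>M1\<close> and are
  governed by its invariants. The passage from \<open>M1\<close> to cubes has a defect of its own:
  the cube of a union exceeds the union of the cubes, because different coordinates of a point may
  lie in different members. Increasing exhaustions repair this for countable unions, and unions of
  at most n members for larger families.\<close>

lemma nowhere_dense_iff:
  "nowhere_dense A \<longleftrightarrow>
    (\<forall>U. open U \<and> U \<noteq> {} \<longrightarrow> (\<exists>V. open V \<and> V \<noteq> {} \<and> V \<subseteq> U \<and> V \<inter> A = {}))"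
proof
  assume A: "nowhere_dense A"
  show "\<forall>U. open U \<and> U \<noteq> {} \<longrightarrow> (\<exists>V. open V \<and> V \<noteq> {} \<and> V \<subseteq> U \<and> V \<inter> A = {})"
  proof (intro allI impI)
    fix U :: "'a set" assume U: "open U \<and> U \<noteq> {}"
    then have "\<not> U \<subseteq> closure A"
      using A U interior_maximal[of U "closure A"] unfolding nowhere_dense_def by auto
    then show "\<exists>V. open V \<and> V \<noteq> {} \<and> V \<subseteq> U \<and> V \<inter> A = {}"
      using U closure_subset[of A] by (intro exI[of _ "U - closure A"] conjI) auto
  qed
next
  assume R: "\<forall>U. open U \<and> U \<noteq> {} \<longrightarrow> (\<exists>V. open V \<and> V \<noteq> {} \<and> V \<subseteq> U \<and> V \<inter> A = {})"
  show "nowhere_dense A"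
  proof (rule ccontr)
    assume "\<not> nowhere_dense A"
    then have "interior (closure A) \<noteq> {}" by (simp add: nowhere_dense_def)
    then obtain V where V: "open V" "V \<noteq> {}" "V \<subseteq> interior (closure A)" "V \<inter> A = {}"
      using R[rule_format, of "interior (closure A)"] by auto
    then have "V \<inter> closure A = {}" by (simp add: open_Int_closure_eq_empty)
    moreover have "V \<subseteq> closure A" using V(3) interior_subset by (rule order_trans)
    ultimately show False using V(2) by blast
  qed
qed

lemma nowhere_dense_subset: "nowhere_dense B \<Longrightarrow> A \<subseteq> B \<Longrightarrow> nowhere_dense A"
  unfolding nowhere_dense_def using interior_mono[OF closure_mono, of A B] by simp

lemma nowhere_dense_closure: "nowhere_dense A \<Longrightarrow> nowhere_dense (closure A)"
  by (simp add: nowhere_dense_def)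

lemma nowhere_dense_Un: "nowhere_dense A \<Longrightarrow> nowhere_dense B \<Longrightarrow> nowhere_dense (A \<union> B)"
  unfolding nowhere_dense_def closure_Un
  using interior_closed_Un_empty_interior[OF closed_closure] by metis

lemma nowhere_dense_Union:
  "finite F \<Longrightarrow> (\<And>N. N \<in> F \<Longrightarrow> nowhere_dense N) \<Longrightarrow> nowhere_dense (\<Union>F)"
proof (induction F rule: finite_induct)
  case empty
  then show ?case by (simp add: nowhere_dense_def)
next
  case (insert N F)
  then show ?case by (simp add: nowhere_dense_Un)
qed

text \<open>\<open>meager_ideal\<close> asks for equality with a countable union; intersecting the
  members of a cover with \<open>A\<close> turns a cover into such a union.\<close>

lemma meager_alt: "A \<in> meager_ideal \<longleftrightarrow> (\<exists>\<N>. countable \<N> \<and> (\<forall>N\<in>\<N>. nowhere_dense N) \<and> A \<subseteq> \<Union>\<N>)"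
  (is "_ \<longleftrightarrow> ?R")
proof
  assume ?R
  then obtain \<N> where N: "countable \<N>" "\<forall>N\<in>\<N>. nowhere_dense N" "A \<subseteq> \<Union>\<N>" by blast
  then have "A = \<Union>((\<inter>) A ` \<N>)" by blast
  moreover have "nowhere_dense (A \<inter> N)" if "N \<in> \<N>" for N
    using N(2) that nowhere_dense_subset[of N "A \<inter> N"] by simp
  ultimately show "A \<in> meager_ideal"
    unfolding meager_ideal_def using N(1)
    by (intro CollectI exI[of _ "(\<inter>) A ` \<N>"] conjI) auto
next
  assume "A \<in> meager_ideal"
  then show ?R unfolding meager_ideal_def by fast
qed

lemma meager_subset: "B \<in> meager_ideal \<Longrightarrow> A \<subseteq> B \<Longrightarrow> A \<in> meager_ideal"
  unfolding meager_alt by (meson order_trans)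

lemma meager_UN:
  assumes "countable I" "\<And>i. i \<in> I \<Longrightarrow> A i \<in> meager_ideal"
  shows "(\<Union>i\<in>I. A i) \<in> meager_ideal"
proof -
  have "\<forall>i\<in>I. \<exists>\<N>. countable \<N> \<and> (\<forall>N\<in>\<N>. nowhere_dense N) \<and> A i \<subseteq> \<Union>\<N>"
    using assms(2) meager_alt by blast
  then obtain \<N> where "\<forall>i\<in>I. countable (\<N> i) \<and> (\<forall>N\<in>\<N> i. nowhere_dense N) \<and> A i \<subseteq> \<Union>(\<N> i)"
    by metis
  note N = this
  have "(\<Union>i\<in>I. A i) \<subseteq> \<Union>(\<Union>i\<in>I. \<N> i)"
  proof
    fix x assume "x \<in> (\<Union>i\<in>I. A i)"
    then obtain i where "i \<in> I" "x \<in> A i" by blast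
    with N have "x \<in> \<Union>(\<N> i)" by blast
    with \<open>i \<in> I\<close> show "x \<in> \<Union>(\<Union>i\<in>I. \<N> i)" by blast
  qed
  moreover have "countable (\<Union>i\<in>I. \<N> i)" using assms(1) N by simp
  moreover have "\<forall>N\<in>(\<Union>i\<in>I. \<N> i). nowhere_dense N" using N by simp
  ultimately show ?thesis
    unfolding meager_alt by (intro exI conjI)
qed

lemma meager_Union: "countable F \<Longrightarrow> F \<subseteq> meager_ideal \<Longrightarrow> \<Union>F \<in> meager_ideal"
  using meager_UN[of F "\<lambda>x. x"] by auto

lemma nowhere_dense_meager: "nowhere_dense A \<Longrightarrow> A \<in> meager_ideal"
  unfolding meager_alt by (intro exI[of _ "{A}"]) auto

lemma UNIV_not_meager: "(UNIV :: 'a::{real_normed_vector,heine_borel} set) \<notin> meager_ideal"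
proof
  assume "(UNIV :: 'a set) \<in> meager_ideal"
  then obtain \<N> :: "'a set set" where N: "countable \<N>" "\<forall>N\<in>\<N>. nowhere_dense N" "UNIV = \<Union>\<N>"
    by (auto simp: meager_ideal_def)
  define \<G> where "\<G> = (\<lambda>N. - closure N) ` \<N>"
  have "UNIV \<subseteq> closure (\<Inter>\<G>)"
  proof (rule Baire[OF closed_UNIV])
    show "countable \<G>" using N by (simp add: \<G>_def)
    fix T assume "T \<in> \<G>"
    then obtain N where "N \<in> \<N>" and T: "T = - closure N" by (auto simp: \<G>_def)
    then have "closure T = UNIV"
      using N(2) by (simp add: closure_complement nowhere_dense_def)
    then show "openin (top_of_set UNIV) T \<and> UNIV \<subseteq> closure T"
      using T by (simp add: open_Compl)
  qed
  moreover have "\<Inter>\<G> = {}"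
  proof (rule equals0I)
    fix x assume x: "x \<in> \<Inter>\<G>"
    have "x \<in> \<Union>\<N>" unfolding N(3)[symmetric] by (rule UNIV_I)
    then obtain N where "N \<in> \<N>" "x \<in> N" by blast
    with x show False unfolding \<G>_def using closure_subset[of N] by auto
  qed
  ultimately show False by simp
qed

lemma Union_meager: "\<Union>(meager_ideal :: 'a::{perfect_space,t1_space} set set) = UNIV"
proof -
  have "nowhere_dense {x::'a}" for x
    by (simp add: nowhere_dense_def interior_singleton)
  then have "{x} \<in> meager_ideal" for x :: 'a by (rule nowhere_dense_meager)
  then show ?thesis by (metis UNIV_eq_I UnionI singletonI)
qed

section \<open>A category-preserving bijection between Euclidean spaces\<close>

text \<open>No continuity of \<open>s\<close> is involved. The sets \<open>P i\<close> and their
  preimages have nonempty interior, and every nonempty open set contains one of them, so nowhere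
  density can be tested on them; since \<open>s\<close> is onto, inclusions between them are the
  same on both sides.\<close>

lemma nowhere_dense_image_vimage:
  fixes s :: "'a::topological_space \<Rightarrow> 'b::topological_space" and P :: "'i \<Rightarrow> 'b set"
  assumes "surj s"
    and int: "\<And>i. interior (P i) \<noteq> {}" and int': "\<And>i. interior (s -` P i) \<noteq> {}"
    and base: "\<And>U. open U \<Longrightarrow> U \<noteq> {} \<Longrightarrow> \<exists>i. P i \<subseteq> U"
    and base': "\<And>U. open U \<Longrightarrow> U \<noteq> {} \<Longrightarrow> \<exists>i. s -` P i \<subseteq> U"
  shows "nowhere_dense A \<Longrightarrow> nowhere_dense (s ` A)"
    and "nowhere_dense B \<Longrightarrow> nowhere_dense (s -` B)"
proof -
  assume A: "nowhere_dense A"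
  show "nowhere_dense (s ` A)"
    unfolding nowhere_dense_iff
  proof (intro allI impI)
    fix U :: "'b set" assume U: "open U \<and> U \<noteq> {}"
    obtain i where i: "P i \<subseteq> U" using base U by meson
    obtain V where V: "open V" "V \<noteq> {}" "V \<subseteq> interior (s -` P i)" "V \<inter> A = {}"
      using A int'[of i] unfolding nowhere_dense_iff by (meson open_interior)
    obtain i' where i': "s -` P i' \<subseteq> V" using base'[OF V(1,2)] by (rule exE)
    have "s -` P i' \<subseteq> s -` P i"
      using order_trans[OF i' order_trans[OF V(3) interior_subset]] .
    then have "P i' \<subseteq> P i" using \<open>surj s\<close> by (metis image_mono surj_image_vimage_eq)
    then have "interior (P i') \<subseteq> U"
      using order_trans[OF interior_subset order_trans[OF _ i]] by simp
    moreover have "x \<notin> interior (P i')" if "x \<in> s ` A" for x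
      using that i' V(4) interior_subset[of "P i'"] by auto
    then have "interior (P i') \<inter> s ` A = {}" by auto
    ultimately show "\<exists>V. open V \<and> V \<noteq> {} \<and> V \<subseteq> U \<and> V \<inter> s ` A = {}"
      using int[of i'] by (intro exI[of _ "interior (P i')"]) simp
  qed
next
  assume B: "nowhere_dense B"
  show "nowhere_dense (s -` B)"
    unfolding nowhere_dense_iff
  proof (intro allI impI)
    fix U :: "'a set" assume U: "open U \<and> U \<noteq> {}"
    obtain i where i: "s -` P i \<subseteq> U" using base' U by meson
    obtain V where V: "open V" "V \<noteq> {}" "V \<subseteq> interior (P i)" "V \<inter> B = {}"
      using B int[of i] unfolding nowhere_dense_iff by (meson open_interior)
    obtain i' where i': "P i' \<subseteq> V" using base[OF V(1,2)] by (rule exE)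
    have "P i' \<subseteq> P i" using order_trans[OF i' order_trans[OF V(3) interior_subset]] .
    then have "s -` P i' \<subseteq> U" using i by (metis vimage_mono order_trans)
    moreover have "s -` P i' \<inter> s -` B = {}" using i' V(4) by auto
    ultimately show "\<exists>V. open V \<and> V \<noteq> {} \<and> V \<subseteq> U \<and> V \<inter> s -` B = {}"
      using int'[of i'] interior_subset[of "s -` P i'"]
      by (intro exI[of _ "interior (s -` P i')"]) auto
  qed
qed

section \<open>Coding points of [0, 1) by sequences of natural numbers\<close>

definition branch :: "nat \<Rightarrow> real \<Rightarrow> real" where
  "branch m v = 1 - (1/2) ^ m + (1/2) ^ Suc m * v"

definition unit_digit :: "real \<Rightarrow> nat" where
  "unit_digit u = (LEAST m. u < 1 - (1/2) ^ Suc m)"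

definition unit_shift :: "real \<Rightarrow> real" where
  "unit_shift u = (u - (1 - (1/2) ^ unit_digit u)) * 2 ^ Suc (unit_digit u)"

text \<open>The itinerary of \<open>u\<close> under the piecewise affine map
  \<open>unit_shift\<close>. The map \<open>branch m\<close> carries [0, 1) onto [1 - 2^-m, 1 -
  2^-(m+1)), and these intervals partition [0, 1). With infinitely many half-open branches every
  sequence of naturals is the itinerary of exactly one point; binary digits would miss the sequences
  ending in ones.\<close>

definition unit_address :: "real \<Rightarrow> nat \<Rightarrow> nat" where
  "unit_address u j = unit_digit ((unit_shift ^^ j) u)"

lemma branch_in_unit:
  assumes "0 \<le> v" "v < 1"
  shows "0 \<le> branch m v" "branch m v < 1"
proof -
  have "0 < (1/2::real) ^ Suc m" "(1/2::real) ^ m \<le> 1" "(1/2::real) ^ m = 2 * (1/2) ^ Suc m"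
    by (auto simp: power_le_one)
  moreover have "(1/2::real) ^ Suc m * v < (1/2) ^ Suc m * 1"
    using assms by (intro mult_strict_left_mono) auto
  moreover have "0 \<le> (1/2::real) ^ Suc m * v" using assms by simp
  ultimately show "0 \<le> branch m v" "branch m v < 1"
    unfolding branch_def by linarith+
qed

lemma unit_digit_branch:
  assumes "0 \<le> v" "v < 1"
  shows "unit_digit (branch m v) = m"
  unfolding unit_digit_def
proof (rule Least_equality)
  have "(1/2::real) ^ Suc m * v < (1/2) ^ Suc m * 1"
    using assms by (intro mult_strict_left_mono) auto
  moreover have "(1/2::real) ^ m = 2 * (1/2) ^ Suc m" by simp
  ultimately show "branch m v < 1 - (1/2) ^ Suc m" unfolding branch_def by linarith
next
  fix m' assume m': "branch m v < 1 - (1/2) ^ Suc m'"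
  show "m \<le> m'"
  proof (rule ccontr)
    assume "\<not> m \<le> m'"
    then have "(1/2::real) ^ m \<le> (1/2) ^ Suc m'" by (intro power_decreasing) auto
    moreover have "0 \<le> (1/2::real) ^ Suc m * v" using assms by simp
    ultimately show False using m' unfolding branch_def by linarith
  qed
qed

lemma unit_shift_branch:
  assumes "0 \<le> v" "v < 1"
  shows "unit_shift (branch m v) = v"
proof -
  have one: "(1/2::real) ^ Suc m * 2 ^ Suc m = 1"
    by (metis power_one_over divide_self_if mult.commute nonzero_eq_divide_eq power_not_zero zero_neq_numeral)
  have "unit_shift (branch m v) = ((1/2) ^ Suc m * v) * 2 ^ Suc m"
    unfolding unit_shift_def unit_digit_branch[OF assms] unfolding branch_def by simp
  also have "\<dots> = ((1/2) ^ Suc m * 2 ^ Suc m) * v" by (simp only: mult_ac)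
  finally show ?thesis unfolding one by simp
qed

lemma unit_shift_in_unit:
  assumes "0 \<le> u" "u < 1"
  shows "0 \<le> unit_shift u" "unit_shift u < 1" "branch (unit_digit u) (unit_shift u) = u"
proof -
  define m where "m = unit_digit u"
  obtain m0 where "(1/2::real) ^ m0 < 1 - u" using real_arch_pow_inv[of "1 - u" "1/2"] assms by auto
  moreover have "(1/2::real) ^ Suc m0 \<le> (1/2) ^ m0" by (intro power_decreasing) auto
  ultimately have "u < 1 - (1/2) ^ Suc m0" by linarith
  then have 1: "u < 1 - (1/2) ^ Suc m" unfolding m_def unit_digit_def by (rule LeastI)
  have 2: "1 - (1/2) ^ m \<le> u"
  proof (cases m)
    case (Suc m')
    then have "\<not> u < 1 - (1/2) ^ Suc m'"
      using not_less_Least[of m' "\<lambda>m. u < 1 - (1/2) ^ Suc m"] unfolding m_def unit_digit_def by simp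
    then show ?thesis using Suc by simp
  qed (use assms in simp)
  have eq: "unit_shift u = (u - (1 - (1/2) ^ m)) * 2 ^ Suc m"
    by (simp add: unit_shift_def m_def)
  show "0 \<le> unit_shift u" using 2 unfolding eq by (intro mult_nonneg_nonneg) auto
  have half: "(1/2::real) ^ m = 2 * (1/2) ^ Suc m" by simp
  have one: "(1/2::real) ^ Suc m * 2 ^ Suc m = 1"
    by (metis power_one_over divide_self_if mult.commute nonzero_eq_divide_eq power_not_zero zero_neq_numeral)
  have "(u - (1 - (1/2) ^ m)) * 2 ^ Suc m < (1/2) ^ Suc m * 2 ^ Suc m"
  proof (rule mult_strict_right_mono)
    show "u - (1 - (1/2) ^ m) < (1/2) ^ Suc m" using 1 half by linarith
  qed simp
  then show "unit_shift u < 1" unfolding eq one .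
  show "branch (unit_digit u) (unit_shift u) = u"
  proof -
    have "(1/2) ^ Suc m * unit_shift u = ((1/2) ^ Suc m * 2 ^ Suc m) * (u - (1 - (1/2) ^ m))"
      unfolding eq by (simp only: mult_ac)
    then have "(1/2) ^ Suc m * unit_shift u = u - (1 - (1/2) ^ m)" unfolding one by (simp only: mult_1)
    then show ?thesis unfolding m_def[symmetric] branch_def by linarith
  qed
qed

lemma unit_address_0: "unit_address u 0 = unit_digit u"
  and unit_address_Suc: "unit_address u (Suc j) = unit_address (unit_shift u) j"
  by (simp_all add: unit_address_def funpow_swap1)

text \<open>Prepending a digit applies one branch, an affine contraction with ratio at most 1/2, so
  cylinders remain half-open intervals and their lengths at least halve.\<close>

lemma unit_cylinder:
  "\<exists>l c. 0 < c \<and> c \<le> (1/2) ^ j \<and>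
    {u. 0 \<le> u \<and> u < 1 \<and> (\<forall>i<j. unit_address u i = p i)} = {l..<l + c}"
proof (induction j arbitrary: p)
  case 0
  show ?case by (rule exI[of _ 0], rule exI[of _ 1]) auto
next
  case (Suc j)
  define q where "q = (\<lambda>i. p (Suc i))"
  obtain l c where lc: "0 < c" "c \<le> (1/2) ^ j"
    "{u. 0 \<le> u \<and> u < 1 \<and> (\<forall>i<j. unit_address u i = q i)} = {l..<l + c}"
    using Suc[of q] by auto
  let ?L = "{u. 0 \<le> u \<and> u < 1 \<and> (\<forall>i<Suc j. unit_address u i = p i)}"
  have "?L = branch (p 0) ` {l..<l + c}"
  proof (intro set_eqI iffI)
    fix u assume u: "u \<in> ?L"
    then have "unit_digit u = p 0" "\<forall>i<j. unit_address (unit_shift u) i = q i"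
      unfolding q_def unit_address_0[symmetric] unit_address_Suc[symmetric] by auto
    then have "unit_shift u \<in> {l..<l + c}" "u = branch (p 0) (unit_shift u)"
      using u unit_shift_in_unit[of u] unfolding lc(3)[symmetric] by auto
    then show "u \<in> branch (p 0) ` {l..<l + c}" by blast
  next
    fix u assume "u \<in> branch (p 0) ` {l..<l + c}"
    then obtain v where v: "0 \<le> v" "v < 1" "\<forall>i<j. unit_address v i = q i" "u = branch (p 0) v"
      unfolding lc(3)[symmetric] by blast
    have "unit_address u i = p i" if "i < Suc j" for i
      using that v unit_digit_branch[of v "p 0"] unit_shift_branch[of v "p 0"]
      by (cases i) (auto simp: unit_address_0 unit_address_Suc q_def)
    then show "u \<in> ?L" using v branch_in_unit by auto
  qed
  also have "\<dots> = {branch (p 0) l..<branch (p 0) l + (1/2) ^ Suc (p 0) * c}"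
  proof -
    define d :: real where "d = (1/2) ^ Suc (p 0)"
    have d: "d > 0" by (simp add: d_def)
    have b: "branch (p 0) v = 1 - (1/2) ^ p 0 + d * v" for v by (simp add: branch_def d_def)
    show ?thesis
      unfolding d_def[symmetric]
    proof (intro set_eqI iffI)
      fix u assume "u \<in> {branch (p 0) l..<branch (p 0) l + d * c}"
      then have "(u - (1 - (1/2) ^ p 0)) / d \<in> {l..<l + c}"
        using d unfolding b by (auto simp: field_simps)
      moreover have "u = branch (p 0) ((u - (1 - (1/2) ^ p 0)) / d)"
        using d unfolding b by simp
      ultimately show "u \<in> branch (p 0) ` {l..<l + c}" by blast
    next
      fix u assume "u \<in> branch (p 0) ` {l..<l + c}"
      then show "u \<in> {branch (p 0) l..<branch (p 0) l + d * c}"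
        using d mult_strict_left_mono[OF _ d, of _ "l + c"] unfolding b
        by (auto simp: algebra_simps)
    qed
  qed
  finally have eq: "?L = {branch (p 0) l..<branch (p 0) l + (1/2) ^ Suc (p 0) * c}" .
  have "(1/2) ^ Suc (p 0) * c \<le> (1/2) ^ 1 * (1/2) ^ j"
    using lc by (intro mult_mono power_decreasing) auto
  with eq lc(1) show ?case
    by (intro exI[of _ "branch (p 0) l"] exI[of _ "(1/2) ^ Suc (p 0) * c"]) simp
qed

text \<open>The point with itinerary \<open>p\<close> is the value of the infinite composition of
  \<open>branch (p 0)\<close>, \<open>branch (p 1)\<close> and so on. Summing the offsets
  \<open>1 - (1/2) ^ p j\<close>, each scaled by the branches before it, gives a \<open>t\<close>
  with \<open>t p = branch (p 0) (t (\<lambda>i. p (Suc i)))\<close>, from which the digits can be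
  peeled off.\<close>

lemma unit_address_surj: "\<exists>u. 0 \<le> u \<and> u < 1 \<and> unit_address u = p"
proof -
  define s where "s p j = (1/2::real) ^ (j + (\<Sum>i<j. p i)) * (1 - (1/2) ^ p j)" for p :: "nat \<Rightarrow> nat" and j
  have s_nonneg: "0 \<le> s p j" for p j by (simp add: s_def power_le_one)
  have s_le: "s p j \<le> (1/2) ^ j" for p j
  proof -
    have "s p j \<le> (1/2) ^ (j + (\<Sum>i<j. p i)) * 1"
      unfolding s_def by (intro mult_left_mono) auto
    also have "\<dots> \<le> (1/2) ^ j" by (simp add: power_decreasing)
    finally show ?thesis .
  qed
  have summable: "summable (s p)" for p
    by (rule summable_comparison_test'[of "\<lambda>j. (1/2::real) ^ j"]) (use s_le s_nonneg in auto)
  define t where "t p = suminf (s p)" for p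
  have s_Suc: "s p (Suc j) = (1/2) ^ Suc (p 0) * s (\<lambda>i. p (Suc i)) j" for p j
    by (simp add: s_def sum.lessThan_Suc_shift power_add del: sum.lessThan_Suc)
  have t_branch: "t p = branch (p 0) (t (\<lambda>i. p (Suc i)))" for p
    using suminf_split_head[OF summable[of p]] suminf_mult[OF summable[of "\<lambda>i. p (Suc i)"], of "(1/2) ^ Suc (p 0)"]
    by (simp add: t_def s_Suc branch_def) (simp add: s_def)
  have part: "(\<Sum>j<N. s p j) \<le> 1" for N p
  proof (induction N arbitrary: p)
    case (Suc N)
    have "(\<Sum>j<Suc N. s p j) = s p 0 + (1/2) ^ Suc (p 0) * (\<Sum>j<N. s (\<lambda>i. p (Suc i)) j)"
      by (simp add: sum.lessThan_Suc_shift s_Suc sum_distrib_left del: sum.lessThan_Suc)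
    also have "\<dots> \<le> s p 0 + (1/2) ^ Suc (p 0) * 1"
      using Suc by (intro add_mono mult_left_mono) auto
    also have "\<dots> \<le> 1" by (simp add: s_def)
    finally show ?case .
  qed simp
  have t_le: "t p \<le> 1" for p
    unfolding t_def using part by (intro suminf_le_const summable) auto
  have t_nonneg: "0 \<le> t p" for p
    unfolding t_def by (intro suminf_nonneg summable s_nonneg)
  \<comment> \<open>The weak bound for the shifted sequence gives a strict one:
    \<open>branch (p 0)\<close> sends even the value 1 to
    \<open>1 - (1/2) ^ Suc (p 0)\<close>.\<close>
  have t_less: "t p < 1" for p
  proof -
    have "t p \<le> 1 - (1/2) ^ p 0 + (1/2) ^ Suc (p 0) * 1"
      unfolding t_branch[of p] branch_def using t_le by (intro add_mono mult_left_mono) auto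
    moreover have "(1/2::real) ^ p 0 = 2 * (1/2) ^ Suc (p 0)" "0 < (1/2::real) ^ Suc (p 0)" by auto
    ultimately show ?thesis by linarith
  qed
  have "unit_address (t p) j = p j" for j p
  proof (induction j arbitrary: p)
    case 0
    show ?case
      by (subst t_branch) (simp add: unit_address_0 unit_digit_branch t_nonneg t_less)
  next
    case (Suc j)
    show ?case
      by (subst t_branch) (simp add: unit_address_Suc unit_shift_branch t_nonneg t_less Suc)
  qed
  then show ?thesis using t_nonneg t_less by blast
qed

text \<open>A bijection between the line and all sequences of naturals. It is not a homeomorphism,
  as its cylinders are half-open intervals, but these have interior and become arbitrarily small,
  which is all that category sees. Entry 0 holds the integer part, so only cylinders of positive
  length are bounded.\<close>

definition address :: "real \<Rightarrow> nat \<Rightarrow> nat" where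
  "address x j = (case j of 0 \<Rightarrow> int_encode \<lfloor>x\<rfloor> | Suc i \<Rightarrow> unit_address (frac x) i)"

definition cylinder :: "(nat \<Rightarrow> nat) \<Rightarrow> nat \<Rightarrow> real set" where
  "cylinder p j = {x. \<forall>i<j. address x i = p i}"

lemma cylinder_antimono: "i \<le> j \<Longrightarrow> cylinder p j \<subseteq> cylinder p i"
  by (auto simp: cylinder_def)

lemma cylinder_Suc: "\<exists>l c. 0 < c \<and> c \<le> (1/2) ^ j \<and> cylinder p (Suc j) = {l..<l + c}"
proof -
  define q where "q = (\<lambda>i. p (Suc i))"
  define z where "z = int_decode (p 0)"
  obtain l c where lc: "0 < c" "c \<le> (1/2) ^ j"
    "{u. 0 \<le> u \<and> u < 1 \<and> (\<forall>i<j. unit_address u i = q i)} = {l..<l + c}"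
    using unit_cylinder[of j q] by auto
  have "x \<in> cylinder p (Suc j) \<longleftrightarrow> x \<in> {z + l..<(z + l) + c}" for x
  proof -
    have "x \<in> cylinder p (Suc j) \<longleftrightarrow> \<lfloor>x\<rfloor> = z \<and> (\<forall>i<j. unit_address (frac x) i = q i)"
    proof -
      have "x \<in> cylinder p (Suc j) \<longleftrightarrow> address x 0 = p 0 \<and> (\<forall>i<j. address x (Suc i) = p (Suc i))"
        unfolding cylinder_def by (auto simp: less_Suc_eq_0_disj)
      moreover have "address x 0 = p 0 \<longleftrightarrow> \<lfloor>x\<rfloor> = z"
        unfolding z_def address_def by (auto simp flip: int_encode_eq)
      ultimately show ?thesis by (simp add: address_def q_def)
    qed
    also have "\<dots> \<longleftrightarrow> \<lfloor>x\<rfloor> = z \<and> frac x \<in> {l..<l + c}"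
      unfolding lc(3)[symmetric] by (auto simp: frac_lt_1)
    also have "\<dots> \<longleftrightarrow> x - z \<in> {l..<l + c}"
    proof
      assume "x - z \<in> {l..<l + c}"
      then have "0 \<le> x - z" "x - z < 1" unfolding lc(3)[symmetric] by auto
      then have "\<lfloor>x\<rfloor> = z" by linarith
      then show "\<lfloor>x\<rfloor> = z \<and> frac x \<in> {l..<l + c}"
        using \<open>x - z \<in> _\<close> by (simp add: frac_def)
    qed (auto simp: frac_def)
    finally show ?thesis by auto
  qed
  then have "cylinder p (Suc j) = {z + l..<(z + l) + c}" by (rule set_eqI)
  with lc(1,2) show ?thesis by metis
qed

lemma interior_cylinder: "interior (cylinder p j) \<noteq> {}"
proof -
  obtain l c where lc: "0 < c" "cylinder p (Suc j) = {l..<l + c}" using cylinder_Suc by blast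
  have "{l<..<l + c} \<subseteq> cylinder p j" using lc(2) cylinder_antimono[of j "Suc j" p] by auto
  then have "{l<..<l + c} \<subseteq> interior (cylinder p j)" by (simp add: interior_maximal)
  with lc(1) show ?thesis by (metis greaterThanLessThan_empty_iff less_add_same_cancel1 not_le subset_empty)
qed

lemma cylinder_small:
  assumes "open U" "x \<in> U"
  shows "\<exists>j. cylinder (address x) j \<subseteq> U"
proof -
  obtain e where e: "0 < e" "ball x e \<subseteq> U" using assms open_contains_ball by blast
  obtain j where j: "(1/2::real) ^ j < e" using real_arch_pow_inv[of e "1/2"] e by auto
  obtain l c where lc: "c \<le> (1/2) ^ j" "cylinder (address x) (Suc j) = {l..<l + c}"
    using cylinder_Suc by blast
  have "x \<in> cylinder (address x) (Suc j)" by (simp add: cylinder_def)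
  then have "cylinder (address x) (Suc j) \<subseteq> ball x e"
    using lc j by (auto simp: dist_real_def)
  then show ?thesis using e by blast
qed

lemma bij_address: "bij address"
proof (rule bijI)
  show "inj address"
  proof (rule injI, rule ccontr)
    fix x y assume eq: "address x = address y" and "x \<noteq> y"
    then obtain j where "cylinder (address x) j \<subseteq> - {y}"
      using cylinder_small[of "- {y}" x] by auto
    moreover have "y \<in> cylinder (address x) j" using eq by (simp add: cylinder_def)
    ultimately show False by blast
  qed
  have "\<exists>x. address x = p" for p
  proof -
    obtain u where u: "0 \<le> u" "u < 1" "unit_address u = (\<lambda>i. p (Suc i))"
      using unit_address_surj by blast
    have "\<lfloor>int_decode (p 0) + u\<rfloor> = int_decode (p 0)" "frac (int_decode (p 0) + u) = u"
      using u by (auto simp: frac_def floor_unique)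
    then have "address (int_decode (p 0) + u) j = p j" for j
      using u(3) unfolding address_def by (auto split: nat.split)
    then show ?thesis by blast
  qed
  then show "surj address" by (metis surjI)
qed

text \<open>For each \<open>j\<close>, the \<open>j\<close>-th entries of the n coordinate addresses
  are packed into one number by the bijection \<open>e\<close>, and these numbers form the address
  of \<open>s v\<close>. The preimage of a cylinder is then a box of cylinders of the same length,
  so cylinders can serve as the sets \<open>P i\<close> of
  \<open>nowhere_dense_image_vimage\<close>.\<close>

lemma category_bijection:
  "\<exists>s :: real ^ 'n::finite \<Rightarrow> real. bij s \<and>
    (\<forall>A. nowhere_dense A \<longrightarrow> nowhere_dense (s ` A)) \<and> (\<forall>B. nowhere_dense B \<longrightarrow> nowhere_dense (s -` B))"
proof -
  have "infinite (UNIV :: ('n \<Rightarrow> nat) set)"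
    by (simp add: finite_UNIV_fun)
  then have e: "bij (from_nat_into (UNIV :: ('n \<Rightarrow> nat) set))"
    using bij_betw_from_nat_into[of "UNIV :: ('n \<Rightarrow> nat) set"] by simp
  define e where "e = from_nat_into (UNIV :: ('n \<Rightarrow> nat) set)"
  note e = e[folded e_def]
  define s where "s v = inv address (\<lambda>j. inv e (\<lambda>i. address (v $ i) j))" for v :: "real ^ 'n"
  have address_inv: "address (inv address p) = p" for p
    using bij_address by (simp add: bij_is_surj surj_f_inv_f)
  have e_inv: "inv e f = m \<longleftrightarrow> f = e m" for f m
    using e by (metis bij_inv_eq_iff)
  have address_s: "address (s v) j = m \<longleftrightarrow> (\<forall>i. address (v $ i) j = e m i)" for v j m
    unfolding s_def address_inv e_inv fun_eq_iff ..
  have vim: "s -` cylinder p j = {v. \<forall>i. v $ i \<in> cylinder (\<lambda>j. e (p j) i) j}" for p j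
    by (auto simp: cylinder_def address_s)
  have "bij s"
  proof (rule bijI)
    show "inj s"
    proof (rule injI)
      fix v w assume "s v = s w"
      then have "address (v $ i) j = address (w $ i) j" for i j
        using address_s[of v j "address (s v) j"] address_s[of w j "address (s w) j"] by simp
      then have "address (v $ i) = address (w $ i)" for i by (rule ext)
      then show "v = w" using bij_is_inj[OF bij_address] by (simp add: vec_eq_iff inj_eq)
    qed
    have "s (\<chi> i. inv address (\<lambda>j. e (address x j) i)) = x" for x
    proof -
      have "address (s (\<chi> i. inv address (\<lambda>j. e (address x j) i))) j = address x j" for j
        unfolding address_s by (simp add: address_inv)
      then have "address (s (\<chi> i. inv address (\<lambda>j. e (address x j) i))) = address x" by (rule ext)
      then show ?thesis by (rule injD[OF bij_is_inj[OF bij_address]])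
    qed
    then show "surj s" by (rule surjI)
  qed
  let ?P = "\<lambda>(p, j). cylinder p j"
  have b: "\<exists>i. ?P i \<subseteq> U" if "open U" "U \<noteq> {}" for U
  proof -
    obtain x where "x \<in> U" using \<open>U \<noteq> {}\<close> by auto
    then obtain j where "cylinder (address x) j \<subseteq> U" using cylinder_small \<open>open U\<close> by meson
    then show ?thesis by (intro exI[of _ "(address x, j)"]) simp
  qed
  have b': "\<exists>i. s -` ?P i \<subseteq> U" if U: "open U" "U \<noteq> {}" for U
  proof -
    obtain v where "v \<in> U" using U by blast
    then obtain A where A: "\<forall>i. open (A i) \<and> v $ i \<in> A i" "\<And>y. (\<forall>i. y $ i \<in> A i) \<Longrightarrow> y \<in> U"
      using \<open>open U\<close> unfolding open_vec_def by blast
    have "\<forall>i. \<exists>j. cylinder (address (v $ i)) j \<subseteq> A i" using A(1) cylinder_small by meson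
    then obtain J where J: "\<And>i. cylinder (address (v $ i)) (J i) \<subseteq> A i" by metis
    define j where "j = Max (range J)"
    have j: "J i \<le> j" for i by (simp add: j_def)
    define p where "p m = inv e (\<lambda>i. address (v $ i) m)" for m
    have ep: "e (p m) = (\<lambda>i. address (v $ i) m)" for m
      using e_inv p_def by metis
    have "s -` cylinder p j \<subseteq> U"
      unfolding vim ep
    proof clarify
      fix y assume "\<forall>i. y $ i \<in> cylinder (address (v $ i)) j"
      then have "y $ i \<in> A i" for i
        using J[of i] cylinder_antimono[OF j, of "address (v $ i)" i] by auto
      then show "y \<in> U" using A(2) by simp
    qed
    then show ?thesis by (intro exI[of _ "(p, j)"]) simp
  qed
  have i': "interior (s -` ?P i) \<noteq> {}" for i
  proof -
    obtain p j where i: "i = (p, j)" by fastforce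
    let ?I = "\<lambda>i. interior (cylinder (\<lambda>j. e (p j) i) j)"
    have "open {v. \<forall>i. v $ i \<in> ?I i}" by (intro open_vector_box) simp
    moreover have "{v. \<forall>i. v $ i \<in> ?I i} \<subseteq> s -` ?P i"
      unfolding i prod.case vim by (auto intro: interior_subset[THEN subsetD])
    moreover have "(\<chi> i. SOME x. x \<in> ?I i) \<in> {v. \<forall>i. v $ i \<in> ?I i}"
      using interior_cylinder by (simp add: some_in_eq)
    ultimately show ?thesis by (metis (no_types, lifting) interior_maximal empty_iff subsetD)
  qed
  have "interior (?P i) \<noteq> {}" for i using interior_cylinder by (cases i) simp
  from nowhere_dense_image_vimage[OF bij_is_surj[OF \<open>bij s\<close>], of ?P, OF this i' b b']
  show ?thesis using \<open>bij s\<close> by (intro exI[of _ s]) simp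
qed

lemma meager_bijection:
  "\<exists>s :: real ^ 'n::finite \<Rightarrow> real. bij s \<and>
    (\<forall>A \<in> meager_ideal. s ` A \<in> meager_ideal) \<and> (\<forall>B \<in> meager_ideal. s -` B \<in> meager_ideal)"
proof -
  obtain s :: "real ^ 'n \<Rightarrow> real" where s: "bij s"
    "\<And>A. nowhere_dense A \<Longrightarrow> nowhere_dense (s ` A)" "\<And>B. nowhere_dense B \<Longrightarrow> nowhere_dense (s -` B)"
    using category_bijection by metis
  have "s ` A \<in> meager_ideal" if A: "A \<in> meager_ideal" for A
  proof -
    obtain \<N> where N: "countable \<N>" "\<forall>N\<in>\<N>. nowhere_dense N" "A = \<Union>\<N>"
      using A unfolding meager_ideal_def by blast
    have "s ` A = (\<Union>N\<in>\<N>. s ` N)" unfolding N(3) by auto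
    then show ?thesis using N s(2) by (simp add: meager_UN nowhere_dense_meager)
  qed
  moreover have "s -` A \<in> meager_ideal" if A: "A \<in> meager_ideal" for A
  proof -
    obtain \<N> where N: "countable \<N>" "\<forall>N\<in>\<N>. nowhere_dense N" "A = \<Union>\<N>"
      using A unfolding meager_ideal_def by blast
    have "s -` A = (\<Union>N\<in>\<N>. s -` N)" unfolding N(3) by auto
    then show ?thesis using N s(3) by (simp add: meager_UN nowhere_dense_meager)
  qed
  ultimately show ?thesis using s(1) by (intro exI[of _ s]) simp
qed

section \<open>Sections of meager sets\<close>

text \<open>Sections are indexed by full vectors whose coordinate \<open>k\<close> is overwritten.
  This avoids splitting the space into a line and a complement, and makes sense for n = 1 as
  well.\<close>

definition vec_upd :: "'n \<Rightarrow> real ^ 'n \<Rightarrow> real \<Rightarrow> real ^ 'n" where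
  "vec_upd k v t = (\<chi> i. if i = k then t else v $ i)"

lemma vec_upd_nth [simp]: "vec_upd k v t $ i = (if i = k then t else v $ i)"
  by (simp add: vec_upd_def)

lemma vec_upd_vec_upd [simp]: "vec_upd k (vec_upd k v s) t = vec_upd k v t"
  by (simp add: vec_eq_iff)

lemma vec_upd_same [simp]: "vec_upd k v (v $ k) = v"
  by (simp add: vec_eq_iff)

lemma continuous_on_vec_upd:
  fixes k :: "'n::finite"
  shows "continuous_on A (\<lambda>v. vec_upd k v t)" "continuous_on T (\<lambda>t. vec_upd k v t)"
proof -
  have "continuous_on A (\<lambda>v :: real ^ 'n. if i = k then t else v $ i)"
    "continuous_on T (\<lambda>t. if i = k then t else v $ i)" for i
    by (cases "i = k"; simp add: continuous_intros)+
  then show "continuous_on A (\<lambda>v. vec_upd k v t)" "continuous_on T (\<lambda>t. vec_upd k v t)"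
    unfolding vec_upd_def by (auto intro: continuous_on_vec_lambda)
qed

text \<open>The closed case of Kuratowski--Ulam: a nonmeager section of a closed set contains an
  interval, hence one with rational ends, and for fixed ends the vectors with such a section form a
  closed set without interior.\<close>

lemma meager_section_closed:
  fixes N :: "(real ^ 'n::finite) set"
  assumes "nowhere_dense N" "closed N"
  shows "{v. {t. vec_upd k v t \<in> N} \<notin> meager_ideal} \<in> meager_ideal"
proof -
  define W where "W = (\<lambda>(q, r). {v. \<forall>t\<in>{q<..<r}. vec_upd k v t \<in> N})"
  define I where "I = {(q, r). q \<in> \<rat> \<and> r \<in> \<rat> \<and> q < (r::real)}"
  have "I \<subseteq> \<rat> \<times> \<rat>" by (auto simp: I_def)
  then have "countable I" by (rule countable_subset) (simp add: countable_rat)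
  moreover have "W p \<in> meager_ideal" if "p \<in> I" for p
  proof -
    obtain q r where p: "p = (q, r)" "q < r" using \<open>p \<in> I\<close> by (auto simp: I_def)
    have "closed ((\<lambda>v. vec_upd k v t) -` N)" for t
      using closed_vimage[OF \<open>closed N\<close> continuous_on_vec_upd(1)[of UNIV k t]] .
    moreover have "W p = (\<Inter>t\<in>{q<..<r}. (\<lambda>v. vec_upd k v t) -` N)"
      by (auto simp: W_def p)
    ultimately have "closed (W p)" by auto
    have "interior (W p) = {}"
    proof (rule equals0I)
      fix v assume v: "v \<in> interior (W p)"
      \<comment> \<open>If \<open>W p\<close> had interior, then on all lines in direction
        \<open>k\<close> near \<open>v\<close> the segment between \<open>q\<close> and
        \<open>r\<close> would lie in \<open>N\<close>; \<open>Z\<close> is the open set swept out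
        by these segments.\<close>
      define Z where "Z = (\<Union>s. (\<lambda>z. vec_upd k z s) -` interior (W p)) \<inter> {z. q < z $ k \<and> z $ k < r}"
      have "open ((\<lambda>z. vec_upd k z s) -` interior (W p))" for s
        using open_vimage[OF open_interior continuous_on_vec_upd(1)[of UNIV k s]] .
      moreover have "open {z :: real ^ 'n. q < z $ k \<and> z $ k < r}"
        by (intro open_Collect_conj open_Collect_less continuous_intros)
      ultimately have "open Z" unfolding Z_def by auto
      moreover have "Z \<subseteq> N"
      proof
        fix z assume "z \<in> Z"
        then obtain s where "vec_upd k z s \<in> interior (W p)" "q < z $ k" "z $ k < r"
          by (auto simp: Z_def)
        then have "vec_upd k z s \<in> W p" using interior_subset[of "W p"] by auto
        then have "\<forall>t\<in>{q<..<r}. vec_upd k z t \<in> N" unfolding W_def p(1) by simp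
        moreover have "z $ k \<in> {q<..<r}" using \<open>q < z $ k\<close> \<open>z $ k < r\<close> by simp
        ultimately have "vec_upd k z (z $ k) \<in> N" by (rule bspec)
        then show "z \<in> N" by (simp only: vec_upd_same)
      qed
      ultimately have "Z \<subseteq> interior N" by (simp add: interior_maximal)
      moreover have "interior N = {}" using assms by (simp add: nowhere_dense_def)
      moreover have "vec_upd k v ((q + r) / 2) \<in> Z"
        using v p(2) by (auto simp: Z_def intro!: exI[of _ "v $ k"])
      ultimately show False by auto
    qed
    then have "nowhere_dense (W p)" using \<open>closed (W p)\<close> by (simp add: nowhere_dense_def)
    then show ?thesis by (rule nowhere_dense_meager)
  qed
  ultimately have "(\<Union>p\<in>I. W p) \<in> meager_ideal" by (rule meager_UN)
  moreover have "{v. {t. vec_upd k v t \<in> N} \<notin> meager_ideal} \<subseteq> (\<Union>p\<in>I. W p)"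
  proof
    fix v assume "v \<in> {v. {t. vec_upd k v t \<in> N} \<notin> meager_ideal}"
    then have "\<not> nowhere_dense {t. vec_upd k v t \<in> N}" using nowhere_dense_meager by auto
    moreover have "{t. vec_upd k v t \<in> N} = (\<lambda>t. vec_upd k v t) -` N" by auto
    then have "closed {t. vec_upd k v t \<in> N}"
      using closed_vimage[OF \<open>closed N\<close> continuous_on_vec_upd(2)[of UNIV k v]] by simp
    ultimately obtain x where "x \<in> interior {t. vec_upd k v t \<in> N}"
      by (auto simp: nowhere_dense_def)
    then obtain e where e: "e > 0" "ball x e \<subseteq> {t. vec_upd k v t \<in> N}"
      by (auto simp: mem_interior)
    obtain q where q: "q \<in> \<rat>" "x - e < q" "q < x" using Rats_dense_in_real[of "x - e" x] e by auto
    obtain r where r: "r \<in> \<rat>" "x < r" "r < x + e" using Rats_dense_in_real[of x "x + e"] e by auto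
    have "{q<..<r} \<subseteq> ball x e" using q r by (auto simp: dist_real_def)
    then have "v \<in> W (q, r)" using e(2) by (auto simp: W_def)
    moreover have "(q, r) \<in> I" using q r by (simp add: I_def)
    ultimately show "v \<in> (\<Union>p\<in>I. W p)" by auto
  qed
  ultimately show ?thesis by (rule meager_subset)
qed

lemma meager_section:
  fixes B :: "(real ^ 'n::finite) set"
  assumes "B \<in> meager_ideal"
  shows "{v. {t. vec_upd k v t \<in> B} \<notin> meager_ideal} \<in> meager_ideal"
proof -
  obtain \<N> where N: "countable \<N>" "\<forall>N\<in>\<N>. nowhere_dense N" "B = \<Union>\<N>"
    using assms by (auto simp: meager_ideal_def)
  define bad where "bad N = {v. {t. vec_upd k v t \<in> closure N} \<notin> meager_ideal}" for N
  have "(\<Union>N\<in>\<N>. bad N) \<in> meager_ideal"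
    using N unfolding bad_def
    by (intro meager_UN meager_section_closed nowhere_dense_closure) auto
  moreover have "v \<in> (\<Union>N\<in>\<N>. bad N)" if "{t. vec_upd k v t \<in> B} \<notin> meager_ideal" for v
  proof (rule ccontr)
    assume "\<not> v \<in> (\<Union>N\<in>\<N>. bad N)"
    then have "(\<Union>N\<in>\<N>. {t. vec_upd k v t \<in> closure N}) \<in> meager_ideal"
      using N(1) by (intro meager_UN) (auto simp: bad_def)
    moreover have "{t. vec_upd k v t \<in> B} \<subseteq> (\<Union>N\<in>\<N>. {t. vec_upd k v t \<in> closure N})"
      unfolding N(3) using closure_subset by auto
    ultimately show False using that meager_subset by metis
  qed
  ultimately show ?thesis by (elim meager_subset) auto
qed

text \<open>Coordinates are freed one at a time. A vector whose coordinates outside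
  \<open>insert k S\<close> lie in \<open>X\<close> has a section in direction \<open>k\<close> that
  contains \<open>X\<close>, hence is nonmeager; by Kuratowski--Ulam the enlarged set stays meager,
  until it is the whole space.\<close>

lemma cube_not_meager:
  assumes X: "X \<notin> meager_ideal"
  shows "{v :: real ^ 'n::finite. \<forall>i. v $ i \<in> X} \<notin> meager_ideal"
proof
  assume cube: "{v :: real ^ 'n. \<forall>i. v $ i \<in> X} \<in> meager_ideal"
  have "{v :: real ^ 'n. \<forall>i. i \<notin> S \<longrightarrow> v $ i \<in> X} \<in> meager_ideal" if "finite S" for S
    using that
  proof (induction S rule: finite_induct)
    case empty
    show ?case using cube by simp
  next
    case (insert k S)
    let ?B = "{v :: real ^ 'n. \<forall>i. i \<notin> S \<longrightarrow> v $ i \<in> X}"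
    have "{v. {t. vec_upd k v t \<in> ?B} \<notin> meager_ideal} \<in> meager_ideal"
      by (rule meager_section) (rule insert.IH)
    moreover have "{v :: real ^ 'n. \<forall>i. i \<notin> insert k S \<longrightarrow> v $ i \<in> X}
        \<subseteq> {v. {t. vec_upd k v t \<in> ?B} \<notin> meager_ideal}"
    proof
      fix v :: "real ^ 'n" assume "v \<in> {v. \<forall>i. i \<notin> insert k S \<longrightarrow> v $ i \<in> X}"
      then have "X \<subseteq> {t. vec_upd k v t \<in> ?B}" by auto
      then have "{t. vec_upd k v t \<in> ?B} \<notin> meager_ideal"
        using X meager_subset by meson
      then show "v \<in> {v. {t. vec_upd k v t \<in> ?B} \<notin> meager_ideal}"
        by (rule CollectI)
    qed
    ultimately show ?case by (rule meager_subset)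
  qed
  from this[of UNIV] have "(UNIV :: (real ^ 'n) set) \<in> meager_ideal" by simp
  then show False using UNIV_not_meager by metis
qed

text \<open>Each freed coordinate leaves two cases. Either the sets of points with nonmeager
  sections still capture all cubes, now with one coordinate fewer restricted, or a single
  \<open>A0\<close> defeats them all, and then sections through points taken from the cube of
  \<open>A0\<close> form the desired family on the line. The first case cannot persist to the end,
  where a meager set would contain the whole space. Indexing by \<open>\<B>\<close> throughout keeps
  the cardinality down.\<close>

lemma cofinal_section:
  fixes \<B> :: "(real ^ 'n::finite) set set"
  assumes \<B>: "\<B> \<subseteq> meager_ideal"
    and cof: "\<And>A. A \<in> meager_ideal \<Longrightarrow> \<exists>B\<in>\<B>. {v. \<forall>i. v $ i \<in> A} \<subseteq> B"
  shows "\<exists>D :: (real ^ 'n) set \<Rightarrow> real set. D ` \<B> \<subseteq> meager_ideal \<and> (\<forall>A\<in>meager_ideal. \<exists>B\<in>\<B>. A \<subseteq> D B)"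
proof (rule ccontr)
  assume no: "\<not> ?thesis"
  have "\<exists>f. f ` \<B> \<subseteq> meager_ideal \<and>
      (\<forall>A\<in>meager_ideal. \<exists>B\<in>\<B>. {v :: real ^ 'n. \<forall>i. i \<notin> S \<longrightarrow> v $ i \<in> A} \<subseteq> f B)" if "finite S" for S
    using that
  proof (induction S rule: finite_induct)
    case empty
    show ?case using \<B> cof by (intro exI[of _ "\<lambda>B. B"]) auto
  next
    case (insert k S)
    then obtain f where f: "f ` \<B> \<subseteq> meager_ideal"
      and cof: "\<And>A. A \<in> meager_ideal \<Longrightarrow> \<exists>B\<in>\<B>. {v :: real ^ 'n. \<forall>i. i \<notin> S \<longrightarrow> v $ i \<in> A} \<subseteq> f B"
      by auto
    define g where "g B = {v. {t. vec_upd k v t \<in> f B} \<notin> meager_ideal}" for B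
    have g: "g ` \<B> \<subseteq> meager_ideal" using f meager_section unfolding g_def by auto
    show ?case
    proof (rule ccontr)
      assume neg: "\<not> ?case"
      have "\<not> (\<forall>A\<in>meager_ideal. \<exists>B\<in>\<B>. {v :: real ^ 'n. \<forall>i. i \<notin> insert k S \<longrightarrow> v $ i \<in> A} \<subseteq> g B)"
        using g by (rule contrapos_nn[OF neg, OF exI[of _ g], OF conjI])
      then obtain A0 where A0: "A0 \<in> meager_ideal"
        "\<forall>B\<in>\<B>. \<not> {v :: real ^ 'n. \<forall>i. i \<notin> insert k S \<longrightarrow> v $ i \<in> A0} \<subseteq> g B"
        by auto
      then have "\<forall>B\<in>\<B>. \<exists>v. (\<forall>i. i \<notin> insert k S \<longrightarrow> v $ i \<in> A0) \<and> v \<notin> g B" by auto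
      from bchoice[OF this] obtain y
        where y: "\<forall>B\<in>\<B>. (\<forall>i. i \<notin> insert k S \<longrightarrow> y B $ i \<in> A0) \<and> y B \<notin> g B" by (rule exE)
      define D where "D B = {t. vec_upd k (y B) t \<in> f B}" for B
      have "D ` \<B> \<subseteq> meager_ideal" using y by (auto simp: D_def g_def)
      moreover have "\<exists>B\<in>\<B>. A \<subseteq> D B" if "A \<in> meager_ideal" for A
      proof -
        \<comment> \<open>Enlarging \<open>A\<close> by \<open>A0\<close> makes the remaining
          restricted coordinates of \<open>y B\<close> admissible while coordinate \<open>k\<close>
          runs through \<open>A\<close>.\<close>
        have "A \<union> A0 \<in> meager_ideal" using meager_Union[of "{A, A0}"] that A0(1) by simp
        from cof[OF this] obtain B
          where B: "B \<in> \<B>" "{v :: real ^ 'n. \<forall>i. i \<notin> S \<longrightarrow> v $ i \<in> A \<union> A0} \<subseteq> f B"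
          by (rule bexE)
        have "t \<in> D B" if "t \<in> A" for t
        proof -
          have "vec_upd k (y B) t \<in> {v :: real ^ 'n. \<forall>i. i \<notin> S \<longrightarrow> v $ i \<in> A \<union> A0}"
            using bspec[OF y B(1)] that by simp
          then have "vec_upd k (y B) t \<in> f B" by (rule subsetD[OF B(2)])
          then show ?thesis by (simp add: D_def)
        qed
        then have "A \<subseteq> D B" by (rule subsetI)
        then show ?thesis using B(1) by (rule bexI)
      qed
      ultimately have "D ` \<B> \<subseteq> meager_ideal \<and> (\<forall>A\<in>meager_ideal. \<exists>B\<in>\<B>. A \<subseteq> D B)" by simp
      then have "\<exists>D :: (real ^ 'n) set \<Rightarrow> real set. D ` \<B> \<subseteq> meager_ideal \<and> (\<forall>A\<in>meager_ideal. \<exists>B\<in>\<B>. A \<subseteq> D B)" by (rule exI[of _ D])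
      with no show False by (rule notE)
    qed
  qed
  from this[of UNIV] obtain f where f: "f ` \<B> \<subseteq> meager_ideal"
    "\<forall>A\<in>(meager_ideal :: real set set). \<exists>B\<in>\<B>. (UNIV :: (real ^ 'n) set) \<subseteq> f B"
    by fastforce
  have "({} :: real set) \<in> meager_ideal" using meager_Union[of "{}"] by simp
  with f(2) obtain B where "B \<in> \<B>" "(UNIV :: (real ^ 'n) set) \<subseteq> f B" by meson
  then have "f B \<in> meager_ideal" "(UNIV :: (real ^ 'n) set) \<subseteq> f B" using f(1) by auto
  then have "(UNIV :: (real ^ 'n) set) \<in> meager_ideal" by (rule meager_subset)
  then show False using UNIV_not_meager by metis
qed

section \<open>Powers of nowhere dense sets are tame\<close>

text \<open>Ternary sums with digits 0 and 1: the middle-thirds Cantor set stretched by the factor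
  3/2.\<close>

definition cantor_sum :: "(nat \<Rightarrow> bool) \<Rightarrow> real" where
  "cantor_sum b = (\<Sum>m. (1/3) ^ m * of_bool (b m))"

lemma summable_weighted:
  assumes "\<And>m. \<bar>w m\<bar> \<le> (1::real)"
  shows "summable (\<lambda>m. (1/3) ^ m * w m)"
proof (rule summable_comparison_test'[of "\<lambda>m. (1/3::real) ^ m"])
  show "norm ((1/3) ^ m * w m) \<le> (1/3) ^ m" for m
    using mult_left_mono[OF assms[of m], of "(1/3) ^ m"] by (simp add: abs_mult)
qed simp

lemma weighted_bounds:
  assumes "\<And>m. 0 \<le> w m" "\<And>m. w m \<le> (1::real)"
  shows "0 \<le> (\<Sum>m. (1/3) ^ m * w m)" "(\<Sum>m. (1/3) ^ m * w m) \<le> 3/2"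
proof -
  have s: "summable (\<lambda>m. (1/3) ^ m * w m)" using assms by (intro summable_weighted) simp
  then show "0 \<le> (\<Sum>m. (1/3) ^ m * w m)" using assms by (intro suminf_nonneg) auto
  have "(\<Sum>m. (1/3) ^ m * w m) \<le> (\<Sum>m. (1/3::real) ^ m)"
    using assms by (intro suminf_le s) (auto simp: mult_left_le)
  also have "\<dots> = 3/2" using suminf_geometric[of "1/3::real"] by simp
  finally show "(\<Sum>m. (1/3) ^ m * w m) \<le> 3/2" .
qed

lemma continuous_on_weighted:
  fixes g :: "nat \<Rightarrow> 'a::topological_space \<Rightarrow> real"
  assumes "\<And>m. continuous_on A (g m)" "\<And>m x. \<bar>g m x\<bar> \<le> 1"
  shows "continuous_on A (\<lambda>x. \<Sum>m. (1/3) ^ m * g m x)"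
proof (rule uniform_limit_theorem)
  show "uniform_limit A (\<lambda>n x. \<Sum>m<n. (1/3) ^ m * g m x) (\<lambda>x. \<Sum>m. (1/3) ^ m * g m x) sequentially"
  proof (rule Weierstrass_m_test)
    show "norm ((1/3) ^ m * g m x) \<le> (1/3) ^ m" for m x
      using mult_left_mono[OF assms(2)[of m x], of "(1/3) ^ m"] by (simp add: abs_mult)
  qed simp
  show "\<forall>\<^sub>F n in sequentially. continuous_on A (\<lambda>x. \<Sum>m<n. (1/3) ^ m * g m x)"
    using assms(1) by (intro always_eventually allI continuous_intros)
qed simp

lemma cantor_sum_split: "cantor_sum b = of_bool (b 0) + (1/3) * cantor_sum (\<lambda>m. b (Suc m))"
proof -
  have "summable (\<lambda>m. (1/3::real) ^ m * of_bool (b m))" for b by (rule summable_weighted) simp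
  from suminf_split_head[OF this, of b] suminf_mult[OF this, of "1/3" "\<lambda>m. b (Suc m)"]
  show ?thesis by (simp add: cantor_sum_def mult.assoc)
qed

text \<open>The tail after the leading digit contributes between 0 and 1/2, so it cannot compensate
  a difference of 1 in that digit.\<close>

lemma inj_cantor_sum: "inj cantor_sum"
proof (rule injI, rule ext)
  have bounds: "0 \<le> cantor_sum b" "cantor_sum b \<le> 3/2" for b
    unfolding cantor_sum_def by (rule weighted_bounds; simp)+
  have step: "b 0 = c 0 \<and> cantor_sum (\<lambda>m. b (Suc m)) = cantor_sum (\<lambda>m. c (Suc m))"
    if "cantor_sum b = cantor_sum c" for b c
    using that bounds[of "\<lambda>m. b (Suc m)"] bounds[of "\<lambda>m. c (Suc m)"]
    unfolding cantor_sum_split[of b] cantor_sum_split[of c] by (cases "b 0"; cases "c 0") auto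
  show "b j = c j" if "cantor_sum b = cantor_sum c" for b c j
    using that
  proof (induction j arbitrary: b c)
    case 0
    then show ?case using step by blast
  next
    case (Suc j)
    then have "cantor_sum (\<lambda>m. b (Suc m)) = cantor_sum (\<lambda>m. c (Suc m))" using step by blast
    from Suc.IH[OF this] show ?case .
  qed
qed

lemma continuous_on_cantor_sum: "continuous_on UNIV cantor_sum"
proof -
  have "continuous_on UNIV (\<lambda>b :: nat \<Rightarrow> bool. of_bool (b m) :: real)" for m
    by (rule continuous_on_compose2[of UNIV of_bool UNIV "\<lambda>b. b m"]) auto
  then show ?thesis unfolding cantor_sum_def by (rule continuous_on_weighted) simp
qed

lemma compact_UNIV_bool_seq: "compact (UNIV :: (nat \<Rightarrow> bool) set)"
proof -
  have "compact_space (euclidean :: bool topology)"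
    by (simp add: compact_space_def finite_imp_compact)
  then have "compact_space (product_topology (\<lambda>i::nat. euclidean :: bool topology) UNIV)"
    by (simp add: compact_space_product_topology)
  then show ?thesis by (simp add: euclidean_product_topology compact_space_def)
qed

lemma cantor_set_axis: "cantor_set (range (\<lambda>b. axis k (cantor_sum b)))"
proof -
  have "continuous_on UNIV (\<lambda>b. if i = k then cantor_sum b else 0)" for i
    using continuous_on_cantor_sum by (cases "i = k") auto
  then have "continuous_on UNIV (\<lambda>b. axis k (cantor_sum b))"
    unfolding axis_def by (intro continuous_on_vec_lambda)
  moreover have "inj (\<lambda>b. axis k (cantor_sum b))"
  proof (rule injI)
    fix b c :: "nat \<Rightarrow> bool" assume "axis k (cantor_sum b) = axis k (cantor_sum c)"
    then have "cantor_sum b = cantor_sum c" by (metis axis_nth)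
    then show "b = c" by (rule injD[OF inj_cantor_sum])
  qed
  ultimately have "(UNIV :: (nat \<Rightarrow> bool) set) homeomorphic range (\<lambda>b. axis k (cantor_sum b))"
    using homeomorphism_compact[OF compact_UNIV_bool_seq] unfolding homeomorphic_def by blast
  then show ?thesis unfolding cantor_set_def by (rule homeomorphic_sym[THEN iffD1])
qed

text \<open>The rationals outside \<open>K\<close> serve, because every interval contains an open
  subinterval disjoint from \<open>K\<close>.\<close>

lemma nowhere_dense_gap_points:
  fixes K :: "real set"
  assumes "nowhere_dense K"
  obtains d :: "nat \<Rightarrow> real" where "range d \<subseteq> - K" "\<And>s t. s < t \<Longrightarrow> \<exists>j. s < d j \<and> d j < t"
proof -
  have gap: "\<exists>q\<in>\<rat> - K. s < q \<and> q < t" if "s < t" for s t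
  proof -
    have "\<exists>V. open V \<and> V \<noteq> {} \<and> V \<subseteq> {s<..<t} \<and> V \<inter> K = {}"
      using assms that unfolding nowhere_dense_iff by simp
    then obtain V where V: "open V" "V \<noteq> {}" "V \<subseteq> {s<..<t}" "V \<inter> K = {}"
      by (elim exE conjE)
    obtain x where "x \<in> V" using V by auto
    then obtain e where e: "e > 0" "ball x e \<subseteq> V" using V(1) open_contains_ball by metis
    obtain q where q: "q \<in> \<rat>" "x < q" "q < x + e" using Rats_dense_in_real[of x "x + e"] e by auto
    then have "q \<in> V" using e by (auto simp: dist_real_def)
    then have "q \<notin> K" "s < q" "q < t" using V(3,4) by auto
    then show ?thesis using q(1) by (intro bexI[of _ q]) auto
  qed
  have "countable (\<rat> - K)" by (intro countable_Diff countable_rat)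
  moreover have "\<rat> - K \<noteq> {}" using gap[of 0 1] by auto
  ultimately have "range (from_nat_into (\<rat> - K)) = \<rat> - K" by (rule range_from_nat_into[rotated])
  moreover from this have "\<exists>j. s < from_nat_into (\<rat> - K) j \<and> from_nat_into (\<rat> - K) j < t" if "s < t" for s t
    using gap[OF that] by (metis rangeE)
  ultimately show thesis by (intro that[of "from_nat_into (\<rat> - K)"]) auto
qed

text \<open>A continuous substitute for the indicator of \<open>c < t\<close>: it agrees with the
  indicator at distance at least \<open>r\<close> from \<open>c\<close> and still increases strictly
  across \<open>c\<close>.\<close>

definition ramp :: "real \<Rightarrow> real \<Rightarrow> real \<Rightarrow> real" where
  "ramp c r t = min 1 (max 0 ((t - c) / (2 * r) + 1/2))"

lemma ramp_bounds: "0 \<le> ramp c r t" "ramp c r t \<le> 1"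
  by (auto simp: ramp_def)

lemma ramp_mono: "0 < r \<Longrightarrow> s \<le> t \<Longrightarrow> ramp c r s \<le> ramp c r t"
  unfolding ramp_def by (intro min.mono max.mono order_refl add_right_mono divide_right_mono) auto

lemma ramp_strict:
  assumes "0 < r" "s < c" "c < t"
  shows "ramp c r s < ramp c r t"
proof -
  have "(s - c) / (2 * r) < 0" "0 < (t - c) / (2 * r)"
    using assms by (auto simp: divide_neg_pos)
  then show ?thesis unfolding ramp_def by auto
qed

lemma ramp_off:
  assumes "0 < r" "r \<le> \<bar>t - c\<bar>"
  shows "ramp c r t = of_bool (c < t)"
  using assms unfolding ramp_def by (auto simp: field_simps abs_if split: if_splits)

lemma continuous_on_ramp: "0 < r \<Longrightarrow> continuous_on A (ramp c r)"
  unfolding ramp_def by (intro continuous_intros) auto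

text \<open>The sum \<open>F\<close> below reads off, for a point of \<open>K\<^sup>n\<close>, on which side of each of the
  countably many gap points \<open>d j\<close> its coordinates lie. These bits determine the point, and they
  are the ternary digits of the value of \<open>F\<close>.\<close>

lemma cube_in_tame_cantor_set:
  fixes k :: "'n::finite" and K :: "real set"
  assumes K: "compact K" "nowhere_dense K"
  shows "\<exists>C. tame_cantor_set k C \<and> {v. \<forall>i. v $ i \<in> K} \<subseteq> C"
proof -
  obtain d :: "nat \<Rightarrow> real" where d: "range d \<subseteq> - K" "\<And>s t. s < t \<Longrightarrow> \<exists>j. s < d j \<and> d j < t"
    using nowhere_dense_gap_points[OF K(2)] by metis
  have "\<exists>r>0. ball (d j) r \<subseteq> - K" for j
  proof -
    have "open (- K)" using compact_imp_closed[OF K(1)] by (simp add: open_Compl)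
    moreover have "d j \<in> - K" using d(1) by auto
    ultimately show ?thesis unfolding open_contains_ball by (rule bspec)
  qed
  then obtain r where r: "\<And>j. 0 < r j" "\<And>j. ball (d j) (r j) \<subseteq> - K" by metis
  obtain \<beta> where \<beta>: "0 < \<beta>" "\<And>t. t \<in> K \<Longrightarrow> \<bar>t\<bar> \<le> \<beta>"
    using compact_imp_bounded[OF K(1)] unfolding bounded_pos by auto
  \<comment> \<open>Zero on \<open>[-\<beta>, \<beta>]\<close>, so the digits read off on
    \<open>K\<close> are undisturbed, but unbounded in both directions, so that \<open>F\<close> is
    onto along every line in direction \<open>k\<close>.\<close>
  define E where "E t = max 0 (t - \<beta>) + min 0 (t + \<beta>)" for t :: real
  define J where "J m = fst (from_nat m :: nat \<times> 'n)" for m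
  define I where "I m = snd (from_nat m :: nat \<times> 'n)" for m
  have IJ: "\<exists>m. J m = j \<and> I m = i" for i j
    by (rule exI[of _ "to_nat (j, i)"]) (simp add: I_def J_def)
  define G where "G m v = ramp (d (J m)) (r (J m)) (v $ I m)" for m and v :: "real ^ 'n"
  define \<Phi> where "\<Phi> v = (\<Sum>m. (1/3) ^ m * G m v)" for v
  define F where "F v = \<Phi> v + E (v $ k)" for v
  have G_bounds: "0 \<le> G m v" "G m v \<le> 1" for m v by (simp_all add: G_def ramp_bounds)
  have \<Phi>_bounds: "0 \<le> \<Phi> v" "\<Phi> v \<le> 3/2" for v
    unfolding \<Phi>_def using G_bounds by (rule weighted_bounds)+
  have G_abs: "\<bar>G m v\<bar> \<le> 1" for m v using G_bounds[of m v] by simp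
  have G_cont: "continuous_on A (G m)" for A m
    unfolding G_def
    by (rule continuous_on_compose2[OF continuous_on_ramp[OF r(1), of UNIV]]) (auto intro!: continuous_intros)
  have F_cont: "continuous_on A F" for A
  proof -
    have "continuous_on A \<Phi>" unfolding \<Phi>_def by (rule continuous_on_weighted[OF G_cont G_abs])
    then show ?thesis unfolding F_def E_def by (intro continuous_intros)
  qed
  have E_mono: "E s \<le> E t" if "s \<le> t" for s t using that unfolding E_def by auto
  have F_strict: "F (vec_upd k v s) < F (vec_upd k v t)" if st: "s < t" for v s t
  proof -
    let ?w = "\<lambda>m. (1/3) ^ m * G m (vec_upd k v t) - (1/3) ^ m * G m (vec_upd k v s)"
    have le: "G m (vec_upd k v s) \<le> G m (vec_upd k v t)" for m
      unfolding G_def using st r(1) by (auto intro: ramp_mono)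
    \<comment> \<open>Gap points are dense in the whole line, so some ramp in coordinate
      \<open>k\<close> increases strictly between \<open>s\<close> and \<open>t\<close>, and no
      other ramp decreases.\<close>
    obtain j where j: "s < d j" "d j < t" using d(2)[OF st] by auto
    obtain m where m: "J m = j" "I m = k" using IJ by auto
    have "G m (vec_upd k v s) < G m (vec_upd k v t)"
      unfolding G_def m using j r(1) by (simp add: ramp_strict)
    then have pos: "0 < ?w m" by simp
    have sm: "summable (\<lambda>m. (1/3) ^ m * G m v)" for v by (rule summable_weighted[OF G_abs])
    have "summable ?w" by (intro summable_diff sm)
    moreover have "0 \<le> ?w m" for m using le[of m] by simp
    ultimately have "0 < suminf ?w" using pos by (rule suminf_pos2)
    then have "\<Phi> (vec_upd k v s) < \<Phi> (vec_upd k v t)"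
      unfolding \<Phi>_def using suminf_diff[OF sm sm, of "vec_upd k v t" "vec_upd k v s"] by simp
    then show ?thesis using E_mono[of s t] st unfolding F_def by simp
  qed
  have F_onto: "\<exists>t. F (vec_upd k v t) = w" for v w
  proof -
    \<comment> \<open>At the two ends \<open>E\<close> takes the values
      \<open>- (\<bar>w\<bar> + 2)\<close> and \<open>\<bar>w\<bar> + 2\<close>; the summand 2
      outweighs the bound 3/2 on \<open>\<Phi>\<close>.\<close>
    let ?T = "\<beta> + \<bar>w\<bar> + 2"
    have "F (vec_upd k v (- ?T)) \<le> w" "w \<le> F (vec_upd k v ?T)"
      using \<Phi>_bounds[of "vec_upd k v (- ?T)"] \<Phi>_bounds[of "vec_upd k v ?T"] \<beta>(1)
      unfolding F_def E_def by (auto simp: abs_if)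
    moreover have "continuous_on {- ?T..?T} (\<lambda>t. F (vec_upd k v t))"
      by (rule continuous_on_compose2[OF F_cont continuous_on_vec_upd(2)]) auto
    moreover have "- ?T \<le> ?T" using \<beta>(1) by simp
    ultimately show ?thesis using IVT'[of "\<lambda>t. F (vec_upd k v t)" "- ?T" w ?T] by auto
  qed
  define Q where "Q = {v :: real ^ 'n. \<forall>i. v $ i \<in> K}"
  define bit where "bit v m \<longleftrightarrow> d (J m) < v $ I m" for v :: "real ^ 'n" and m
  have F_bit: "F v = cantor_sum (bit v)" if "v \<in> Q" for v
  proof -
    have vK: "v $ i \<in> K" for i using that by (simp add: Q_def)
    have "G m v = of_bool (bit v m)" for m
    proof -
      have "v $ I m \<notin> ball (d (J m)) (r (J m))" using r(2) vK by blast
      then show ?thesis unfolding G_def bit_def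
        by (intro ramp_off r(1)) (simp add: dist_real_def abs_minus_commute)
    qed
    moreover have "E (v $ k) = 0" using \<beta>(2)[OF vK[of k]] unfolding E_def by auto
    ultimately show ?thesis by (simp add: F_def \<Phi>_def cantor_sum_def)
  qed
  have F_inj: "inj_on F Q"
  proof (rule inj_onI)
    fix v w assume vw: "v \<in> Q" "w \<in> Q" "F v = F w"
    then have "bit v = bit w" using F_bit injD[OF inj_cantor_sum] by simp
    then have side: "d j < v $ i \<longleftrightarrow> d j < w $ i" for i j
      using IJ[of j i] unfolding bit_def fun_eq_iff by auto
    have "v $ i = w $ i" for i
    proof (rule ccontr)
      assume "v $ i \<noteq> w $ i"
      then consider "v $ i < w $ i" | "w $ i < v $ i" by linarith
      then show False
      proof cases
        case 1
        then obtain j where "v $ i < d j" "d j < w $ i" using d(2) by blast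
        then show False using side[of j i] by simp
      next
        case 2
        then obtain j where "w $ i < d j" "d j < v $ i" using d(2) by blast
        then show False using side[of j i] by simp
      qed
    qed
    then show "v = w" by (simp add: vec_eq_iff)
  qed
  have "compact Q"
  proof -
    have "closed Q"
    proof -
      have "Q = (\<Inter>i. (\<lambda>v. v $ i) -` K)" by (auto simp: Q_def)
      moreover have "closed ((\<lambda>v :: real ^ 'n. v $ i) -` K)" for i
        by (intro closed_vimage compact_imp_closed K continuous_intros)
      ultimately show ?thesis by auto
    qed
    moreover have "bounded Q"
      unfolding bounded_iff
    proof (intro exI ballI)
      fix v assume "v \<in> Q"
      have "norm v \<le> (\<Sum>i\<in>UNIV. \<bar>v $ i\<bar>)" by (rule norm_le_l1_cart)
      also have "\<dots> \<le> (\<Sum>i\<in>(UNIV :: 'n set). \<beta>)"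
        using \<beta>(2) \<open>v \<in> Q\<close> by (intro sum_mono) (simp add: Q_def)
      finally show "norm v \<le> (\<Sum>i\<in>(UNIV :: 'n set). \<beta>)" .
    qed
    ultimately show ?thesis by (simp add: compact_eq_bounded_closed)
  qed
  from homeomorphism_compact[OF this F_cont refl F_inj]
  obtain g where g: "homeomorphism Q (F ` Q) F g" by auto
  have FQ: "compact (F ` Q)" using \<open>compact Q\<close> F_cont by (intro compact_continuous_image)
  \<comment> \<open>\<open>g\<close> inverts \<open>F\<close> on the compact set \<open>Q\<close>;
    Tietze's theorem extends it to all reals, so that it can define a shear of the whole
    space.\<close>
  obtain \<Psi> where \<Psi>: "continuous_on UNIV \<Psi>" "\<And>x. x \<in> F ` Q \<Longrightarrow> \<Psi> x = g x"
  proof -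
    obtain B where "0 < B" "\<And>x. x \<in> Q \<Longrightarrow> norm x \<le> B"
      using compact_imp_bounded[OF \<open>compact Q\<close>] unfolding bounded_pos by auto
    then have "norm (g x) \<le> B" if "x \<in> F ` Q" for x
      using that g by (auto simp: homeomorphism_def)
    moreover have "closedin (top_of_set UNIV) (F ` Q)" using FQ by (simp add: compact_imp_closed)
    moreover have "continuous_on (F ` Q) g" using g by (simp add: homeomorphism_def)
    ultimately show thesis using Tietze[of "F ` Q" g UNIV B] that \<open>0 < B\<close>
      by (metis less_imp_le)
  qed
  have \<Psi>F: "\<Psi> (F v) = v" if "v \<in> Q" for v
    using \<Psi>(2) g that by (auto simp: homeomorphism_def)
  \<comment> \<open>Coordinate \<open>k\<close> is replaced by \<open>F v\<close>, and the other
    coordinates are displaced by an amount that depends on \<open>F v\<close> only. As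
    \<open>F\<close> is bijective along lines in direction \<open>k\<close>, so is the whole map; on
    \<open>Q\<close> the displacement is the point itself, so \<open>Q\<close> lands on the
    coordinate line.\<close>
  define h where "h v = (\<chi> i. if i = k then F v else v $ i - \<Psi> (F v) $ i)" for v
  have h_cont: "continuous_on UNIV h"
  proof -
    have "continuous_on UNIV (\<lambda>v. \<Psi> (F v))"
      by (rule continuous_on_compose2[OF \<Psi>(1) F_cont]) auto
    then have "continuous_on UNIV (\<lambda>v. if i = k then F v else v $ i - \<Psi> (F v) $ i)" for i
      using F_cont by (cases "i = k") (auto intro!: continuous_intros)
    then show ?thesis unfolding h_def by (intro continuous_on_vec_lambda)
  qed
  have h_inj: "inj h"
  proof (rule injI)
    fix v w assume eq: "h v = h w"
    have Fe: "F v = F w" using arg_cong[OF eq, of "\<lambda>x. x $ k"] by (simp add: h_def)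
    have "v $ i = w $ i" if "i \<noteq> k" for i
      using arg_cong[OF eq, of "\<lambda>x. x $ i"] that Fe by (simp add: h_def)
    then have wv: "vec_upd k v (w $ k) = w" by (simp add: vec_eq_iff)
    have "v $ k = w $ k"
    proof (rule ccontr)
      assume "v $ k \<noteq> w $ k"
      then have "F (vec_upd k v (v $ k)) \<noteq> F (vec_upd k v (w $ k))"
        using F_strict[of "v $ k" "w $ k" v] F_strict[of "w $ k" "v $ k" v] by linarith
      then show False using Fe wv by simp
    qed
    then show "v = w" using wv by (metis vec_upd_same)
  qed
  have h_surj: "\<exists>v. h v = w" for w
  proof -
    define v where "v = (\<chi> i. w $ i + \<Psi> (w $ k) $ i)"
    obtain t where t: "F (vec_upd k v t) = w $ k" using F_onto by auto
    have "h (vec_upd k v t) = w"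
      unfolding h_def vec_eq_iff t by (auto simp: v_def)
    then show ?thesis by auto
  qed
  obtain h' where h': "homeomorphism UNIV UNIV h h'"
    using invariance_of_domain_homeomorphism[OF open_UNIV h_cont _ h_inj] h_surj
    by (metis order_refl surj_def)
  \<comment> \<open>The image of \<open>Q\<close> under \<open>h\<close> may be finite or empty, so
    the tame set is obtained from the Cantor set of all digit sequences.\<close>
  let ?A = "range (\<lambda>b. axis k (cantor_sum b)) :: (real ^ 'n) set"
  have "h ` h' ` ?A = ?A"
    using h' by (simp add: homeomorphism_def image_image)
  moreover have "?A \<subseteq> coord_line k" by (auto simp: coord_line_def axis_def)
  ultimately have "tame_cantor_set k (h' ` ?A)"
    unfolding tame_cantor_set_def using h' cantor_set_axis[of k] by metis
  moreover have "v \<in> h' ` ?A" if v: "v \<in> Q" for v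
  proof -
    have "h v = axis k (cantor_sum (bit v))"
      unfolding h_def vec_eq_iff \<Psi>F[OF v] by (simp add: axis_def F_bit[OF v])
    moreover have "h' (h v) = v" using h' by (simp add: homeomorphism_def)
    ultimately show ?thesis by (metis imageI rangeI)
  qed
  ultimately show ?thesis unfolding Q_def by blast
qed

section \<open>The ideal generated by tame Cantor sets\<close>

lemma nowhere_dense_empty: "nowhere_dense {}"
  by (simp add: nowhere_dense_def)

text \<open>The compact nowhere dense sets \<open>K m\<close> increase and cover \<open>B\<close>,
  so the finitely many coordinates of a point of the cube all lie in one \<open>K m\<close>. For a
  cover that does not increase they could need different members.\<close>

lemma cube_in_sigma_C0:
  fixes k :: "'n::finite"
  assumes "B \<in> meager_ideal"
  shows "{v. \<forall>i. v $ i \<in> B} \<in> sigma_C0 k"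
proof -
  obtain \<N> where N: "countable \<N>" "\<forall>N\<in>\<N>. nowhere_dense N" "B = \<Union>\<N>"
    using assms by (auto simp: meager_ideal_def)
  define f where "f = from_nat_into (insert {} \<N>)"
  have f: "range f = insert {} \<N>"
    unfolding f_def using N(1) by (intro range_from_nat_into) auto
  have f_nd: "nowhere_dense (f j)" for j
    using rangeI[of f j] N(2) nowhere_dense_empty unfolding f by auto
  define K where "K m = cball 0 (real m) \<inter> (\<Union>j\<le>m. closure (f j))" for m
  have "compact (K m)" for m
    unfolding K_def by (intro compact_Int_closed compact_cball closed_UN) auto
  moreover have "nowhere_dense (K m)" for m
  proof (rule nowhere_dense_subset)
    show "nowhere_dense (\<Union>((\<lambda>j. closure (f j)) ` {..m}))"
      by (intro nowhere_dense_Union) (auto intro: nowhere_dense_closure f_nd)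
  qed (auto simp: K_def)
  ultimately have "\<forall>m. \<exists>C. tame_cantor_set k C \<and> {v. \<forall>i. v $ i \<in> K m} \<subseteq> C"
    by (intro allI cube_in_tame_cantor_set)
  from choice[OF this] obtain C where C: "\<forall>m. tame_cantor_set k (C m) \<and> {v. \<forall>i. v $ i \<in> K m} \<subseteq> C m"
    by (rule exE)
  have K_mono: "K m \<subseteq> K m'" if "m \<le> m'" for m m'
  proof -
    have "{..m} \<subseteq> {..m'}" "cball 0 (real m) \<subseteq> cball 0 (real m')" using that by auto
    then show ?thesis unfolding K_def by (intro Int_mono UN_mono) auto
  qed
  have "v \<in> \<Union>(range C)" if v: "\<forall>i. v $ i \<in> B" for v
  proof -
    have "\<exists>m. v $ i \<in> K m" for i
    proof -
      have "v $ i \<in> \<Union>\<N>" using v N(3) by simp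
      then obtain N where "N \<in> range f" "v $ i \<in> N" unfolding f by auto
      then obtain j where j: "v $ i \<in> f j" by auto
      obtain m where m: "\<bar>v $ i\<bar> \<le> real m" using real_arch_simple by auto
      have "v $ i \<in> closure (f j)" using j closure_subset by auto
      then have "v $ i \<in> K (max j m)" using m by (auto simp: K_def)
      then show ?thesis by (rule exI)
    qed
    then have "\<forall>i. \<exists>m. v $ i \<in> K m" by (rule allI)
    from choice[OF this] obtain m where m: "\<forall>i. v $ i \<in> K (m i)" by (rule exE)
    have "v $ i \<in> K (Max (range m))" for i
      using K_mono[of "m i" "Max (range m)"] m by auto
    then have "v \<in> C (Max (range m))" using C by auto
    then show ?thesis by (rule UnionI[OF rangeI])
  qed
  then have "{v. \<forall>i. v $ i \<in> B} \<subseteq> \<Union>(range C)" by auto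
  moreover have "countable (range C)" "\<forall>A\<in>range C. tame_cantor_set k A" using C by auto
  ultimately show ?thesis unfolding sigma_C0_def by (intro CollectI exI conjI)
qed

lemma sigma_C0_subset: "B \<in> sigma_C0 k \<Longrightarrow> A \<subseteq> B \<Longrightarrow> A \<in> sigma_C0 k"
  unfolding sigma_C0_def mem_Collect_eq by (meson order_trans)

lemma tame_cantor_set_image:
  assumes "tame_cantor_set k C" and f: "homeomorphism UNIV UNIV f f'"
  shows "tame_cantor_set k (f ` C)"
proof -
  obtain h h' where h: "homeomorphism UNIV UNIV h h'" "cantor_set (h ` C)" "h ` C \<subseteq> coord_line k"
    using assms(1) by (auto simp: tame_cantor_set_def)
  have "homeomorphism UNIV UNIV f' f" using f by (simp add: homeomorphism_symD)
  then have "homeomorphism UNIV UNIV (h \<circ> f') (f \<circ> h')" using h(1) by (rule homeomorphism_compose)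
  moreover have "(h \<circ> f') ` (f ` C) = h ` C"
    using f by (auto simp: homeomorphism_def image_image)
  ultimately show ?thesis using h unfolding tame_cantor_set_def by metis
qed

lemma sigma_C0_image:
  assumes "A \<in> sigma_C0 k" and f: "homeomorphism UNIV UNIV f f'"
  shows "f ` A \<in> sigma_C0 k"
proof -
  obtain \<C> where C: "countable \<C>" "\<forall>C\<in>\<C>. tame_cantor_set k C" "A \<subseteq> \<Union>\<C>"
    using assms(1) by (auto simp: sigma_C0_def)
  have "f ` A \<subseteq> \<Union>((`) f ` \<C>)" using C(3) by auto
  moreover have "\<forall>C\<in>(`) f ` \<C>. tame_cantor_set k C"
    using C(2) tame_cantor_set_image[OF _ f] by auto
  moreover have "countable ((`) f ` \<C>)" using C(1) by simp
  ultimately show ?thesis unfolding sigma_C0_def by (intro CollectI exI conjI)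
qed

text \<open>The coordinates of the space of 0-1 sequences are continuous with two values, hence
  constant on connected sets.\<close>

lemma cantor_set_connected:
  assumes "cantor_set X" "connected T" "T \<subseteq> X" "x \<in> T" "y \<in> T"
  shows "x = y"
proof -
  obtain f g where fg: "homeomorphism X (UNIV :: (nat \<Rightarrow> bool) set) f g"
    using assms(1) by (auto simp: cantor_set_def homeomorphic_def)
  have "f x i = f y i" for i
  proof -
    define b where "b t = (of_bool (f t i) :: real)" for t
    have cont_f: "continuous_on T f" using fg assms(3) by (meson continuous_on_subset homeomorphism_cont1)
    have "continuous_on UNIV (\<lambda>b :: nat \<Rightarrow> bool. of_bool (b i) :: real)"
      by (rule continuous_on_compose2[of UNIV of_bool UNIV "\<lambda>b. b i"]) auto
    then have "continuous_on T b"
      unfolding b_def by (rule continuous_on_compose2[OF _ cont_f]) auto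
    moreover have "finite (b ` T)" by (rule finite_subset[of _ "{0, 1}"]) (auto simp: b_def)
    ultimately have "b constant_on T" using assms(2) by (intro continuous_finite_range_constant)
    then have "b x = b y" using assms(4,5) by (auto simp: constant_on_def)
    then show ?thesis by (cases "f x i"; cases "f y i") (simp_all add: b_def)
  qed
  then have "f x = f y" by (rule ext)
  moreover have "g (f x) = x" "g (f y) = y" using fg assms(3-5) by (auto simp: homeomorphism_def)
  ultimately show ?thesis by metis
qed

lemma tame_cantor_set_is_cantor_set:
  fixes C :: "(real ^ 'n::finite) set"
  assumes "tame_cantor_set k C"
  shows "cantor_set C"
proof -
  obtain h h' :: "real ^ 'n \<Rightarrow> real ^ 'n" where h: "homeomorphism UNIV UNIV h h'" "cantor_set (h ` C)"
    using assms by (auto simp: tame_cantor_set_def)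
  have "homeomorphism C (h ` C) h h'"
    using h(1) by (rule homeomorphism_of_subsets) auto
  then have "C homeomorphic h ` C" by (auto simp: homeomorphic_def)
  then show ?thesis using h(2) unfolding cantor_set_def by (rule homeomorphic_trans)
qed

lemma compact_cantor_set:
  fixes X :: "'a::t2_space set"
  assumes "cantor_set X"
  shows "compact X"
  using assms compact_UNIV_bool_seq homeomorphic_compactness unfolding cantor_set_def by metis

lemma nowhere_dense_cantor_set:
  fixes X :: "'a::euclidean_space set"
  assumes "cantor_set X"
  shows "nowhere_dense X"
proof -
  have "interior X = {}"
  proof (rule equals0I)
    fix x assume "x \<in> interior X"
    then obtain e where e: "0 < e" "ball x e \<subseteq> X" by (auto simp: mem_interior)
    obtain u :: 'a where u: "u \<in> Basis" using nonempty_Basis[where 'a='a] by (metis ex_in_conv)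
    have "x + (e / 2) *\<^sub>R u \<in> ball x e" using e(1) u by (simp add: dist_norm)
    then have "x = x + (e / 2) *\<^sub>R u"
      using e by (intro cantor_set_connected[OF assms connected_ball]) auto
    then show False using e(1) u by auto
  qed
  then show ?thesis
    using compact_imp_closed[OF compact_cantor_set[OF assms]] by (simp add: nowhere_dense_def)
qed

lemma sigma_C0_meager: "sigma_C0 k \<subseteq> meager_ideal"
proof
  fix A assume "A \<in> sigma_C0 k"
  then obtain \<C> where "countable \<C>" "\<forall>C\<in>\<C>. tame_cantor_set k C" "A \<subseteq> \<Union>\<C>"
    by (auto simp: sigma_C0_def)
  then show "A \<in> meager_ideal"
    unfolding meager_alt using nowhere_dense_cantor_set tame_cantor_set_is_cantor_set by metis
qed

section \<open>Pushing a tame Cantor set off a nowhere dense set\<close>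

text \<open>Every ray from \<open>c\<close> is rescaled by \<open>\<lambda>t. s t * t\<close>, which
  increases strictly because the factor \<open>s\<close> is positive and nondecreasing. Continuity
  of the inverse comes from invariance of domain.\<close>

lemma radial_shrink:
  fixes c :: "'a::euclidean_space"
  assumes "0 \<le> a" "a < r" "0 < \<epsilon>"
  shows "\<exists>f f'. homeomorphism UNIV UNIV f f' \<and> (\<forall>x. x \<notin> ball c r \<longrightarrow> f x = x) \<and>
    f ` ball c r \<subseteq> ball c r \<and> f ` cball c a \<subseteq> ball c \<epsilon>"
proof -
  \<comment> \<open>The second term keeps \<open>\<beta> * a\<close> below
    \<open>\<epsilon>\<close>, with \<open>a + 1\<close> in the denominator because \<open>a\<close>
    may be 0; the first keeps \<open>\<beta>\<close> below 1.\<close>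
  define \<beta> where "\<beta> = min (1/2) (\<epsilon> / (2 * (a + 1)))"
  have \<beta>: "0 < \<beta>" "\<beta> < 1" using assms by (auto simp: \<beta>_def)
  have "\<beta> * a \<le> \<epsilon> / (2 * (a + 1)) * a" using assms(1) by (intro mult_right_mono) (auto simp: \<beta>_def)
  also have "\<dots> < \<epsilon>"
  proof -
    have "\<epsilon> * a < \<epsilon> * (2 * (a + 1))" using assms by (intro mult_strict_left_mono) auto
    then show ?thesis using assms(1) by (simp add: divide_less_eq)
  qed
  finally have \<beta>a: "\<beta> * a < \<epsilon>" .
  define s where "s t = \<beta> + (1 - \<beta>) * min 1 (max 0 ((t - a) / (r - a)))" for t
  have clamp: "0 \<le> min 1 (max 0 ((t - a) / (r - a)))" "min 1 (max 0 ((t - a) / (r - a))) \<le> 1" for t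
    by auto
  have s_ge: "\<beta> \<le> s t" for t using \<beta>(2) clamp(1)[of t] unfolding s_def by simp
  have s_le: "s t \<le> 1" for t
  proof -
    have "(1 - \<beta>) * min 1 (max 0 ((t - a) / (r - a))) \<le> (1 - \<beta>) * 1"
      using \<beta>(2) by (intro mult_left_mono clamp(2)) simp
    from order_trans[OF add_left_mono[OF this, of \<beta>], of 1]
    show ?thesis unfolding s_def by simp
  qed
  have s_pos: "0 < s t" for t using s_ge[of t] \<beta>(1) by simp
  have s_mono: "s t \<le> s t'" if "t \<le> t'" for t t'
  proof -
    have "(t - a) / (r - a) \<le> (t' - a) / (r - a)" using that assms(2) by (intro divide_right_mono) auto
    then show ?thesis unfolding s_def using \<beta>(2)
      by (intro add_left_mono mult_left_mono min.mono max.mono) auto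
  qed
  have s_out: "s t = 1" if "r \<le> t" for t
  proof -
    have "1 \<le> (t - a) / (r - a)" using that assms(2) by simp
    then show ?thesis by (simp add: s_def)
  qed
  have s_in: "s t = \<beta>" if "t \<le> a" for t
  proof -
    have "(t - a) / (r - a) \<le> 0" using that assms(2) by (simp add: divide_nonpos_pos)
    then show ?thesis by (simp add: s_def)
  qed
  have s_cont: "continuous_on A s" for A
    unfolding s_def using assms(2) by (intro continuous_intros) auto
  have strict: "s t * t < s t' * t'" if "0 \<le> t" "t < t'" for t t'
  proof -
    have "s t * t \<le> s t' * t" using s_mono[of t t'] that by (intro mult_right_mono) auto
    also have "\<dots> < s t' * t'" using that s_pos by simp
    finally show ?thesis .
  qed
  define f where "f x = c + s (norm (x - c)) *\<^sub>R (x - c)" for x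
  have norm_f: "norm (f x - c) = s (norm (x - c)) * norm (x - c)" for x
    using s_pos[of "norm (x - c)"] by (simp add: f_def)
  have f_cont: "continuous_on UNIV f"
    unfolding f_def by (intro continuous_intros continuous_on_compose2[OF s_cont[of UNIV]]) auto
  have f_inj: "inj f"
  proof (rule injI)
    fix x y assume eq: "f x = f y"
    then have "s (norm (x - c)) * norm (x - c) = s (norm (y - c)) * norm (y - c)"
      using norm_f by metis
    then have "norm (x - c) = norm (y - c)"
      using strict[of "norm (x - c)" "norm (y - c)"] strict[of "norm (y - c)" "norm (x - c)"]
      by (cases "norm (x - c)" "norm (y - c)" rule: linorder_cases) auto
    then show "x = y" using eq s_pos[of "norm (y - c)"] by (simp add: f_def)
  qed
  have f_surj: "\<exists>x. f x = y" for y
  proof (cases "y = c")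
    case True
    then show ?thesis by (intro exI[of _ c]) (simp add: f_def)
  next
    case False
    define n where "n = norm (y - c)"
    have n: "0 < n" using False by (simp add: n_def)
    define T where "T = max r n"
    have T: "0 \<le> T" "n \<le> s T * T" using n s_out[of T] by (auto simp: T_def)
    have "continuous_on {0..T} (\<lambda>t. s t * t)" by (intro continuous_intros s_cont)
    then obtain t where t: "0 \<le> t" "s t * t = n"
      using IVT'[of "\<lambda>t. s t * t" 0 n T] T n by auto
    have "f (c + (t / n) *\<^sub>R (y - c)) = c + (s t * (t / n)) *\<^sub>R (y - c)"
      using t(1) n by (simp add: f_def n_def[symmetric])
    also have "s t * (t / n) = 1" using t(2) n by simp
    finally have "f (c + (t / n) *\<^sub>R (y - c)) = y" by simp
    then show ?thesis by (rule exI)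
  qed
  then have "f ` UNIV = UNIV" by (metis surj_def)
  moreover obtain f' where "homeomorphism UNIV (f ` UNIV) f f'"
    using invariance_of_domain_homeomorphism[OF open_UNIV f_cont order_refl f_inj] by metis
  ultimately have "homeomorphism UNIV UNIV f f'" by simp
  moreover have "f x = x" if "x \<notin> ball c r" for x
    using that s_out[of "norm (x - c)"] by (simp add: f_def dist_norm norm_minus_commute)
  moreover have "f ` ball c r \<subseteq> ball c r"
  proof clarify
    fix x assume x: "x \<in> ball c r"
    have "norm (f x - c) \<le> 1 * norm (x - c)"
      unfolding norm_f using s_le by (intro mult_right_mono) auto
    then show "f x \<in> ball c r" using x by (simp add: dist_norm norm_minus_commute)
  qed
  moreover have "f ` cball c a \<subseteq> ball c \<epsilon>"
  proof clarify
    fix x assume x: "x \<in> cball c a"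
    then have n: "norm (x - c) \<le> a" by (simp add: dist_norm norm_minus_commute)
    have "norm (f x - c) = \<beta> * norm (x - c)" unfolding norm_f s_in[OF n] ..
    also have "\<dots> \<le> \<beta> * a" using n \<beta>(1) by simp
    finally show "f x \<in> ball c \<epsilon>" using \<beta>a by (simp add: dist_norm norm_minus_commute)
  qed
  ultimately show ?thesis by (intro exI[of _ f] exI[of _ f'] conjI allI impI)
qed

text \<open>Radial shrinkings in disjoint balls do not interfere and can be composed one ball at a
  time. A centre outside the closed set \<open>P\<close> has a neighbourhood missing
  \<open>P\<close>, into which its inner ball is shrunk.\<close>

lemma shrink_balls:
  fixes c :: "'j \<Rightarrow> 'a::euclidean_space"
  assumes "finite J" "closed P"
    and "\<And>j. j \<in> J \<Longrightarrow> 0 \<le> a j \<and> a j < r j \<and> c j \<notin> P"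
    and "\<And>i j. i \<in> J \<Longrightarrow> j \<in> J \<Longrightarrow> i \<noteq> j \<Longrightarrow> ball (c i) (r i) \<inter> ball (c j) (r j) = {}"
  shows "\<exists>f f'. homeomorphism UNIV UNIV f f' \<and> (\<forall>x. (\<forall>j\<in>J. x \<notin> ball (c j) (r j)) \<longrightarrow> f x = x) \<and>
    (\<forall>j\<in>J. f ` ball (c j) (r j) \<subseteq> ball (c j) (r j) \<and> f ` cball (c j) (a j) \<inter> P = {})"
  using assms(1,3,4)
proof (induction J rule: finite_induct)
  case empty
  show ?case by (intro exI[of _ "\<lambda>x. x"]) (auto simp: homeomorphism_def)
next
  case (insert j J)
  have "\<exists>f f'. homeomorphism UNIV UNIV f f' \<and> (\<forall>x. (\<forall>j\<in>J. x \<notin> ball (c j) (r j)) \<longrightarrow> f x = x) \<and>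
    (\<forall>j\<in>J. f ` ball (c j) (r j) \<subseteq> ball (c j) (r j) \<and> f ` cball (c j) (a j) \<inter> P = {})"
    using insert.prems by (intro insert.IH) simp_all
  then obtain f f' where f: "homeomorphism UNIV UNIV f f'"
    "\<And>x. (\<forall>j\<in>J. x \<notin> ball (c j) (r j)) \<Longrightarrow> f x = x"
    "\<And>i. i \<in> J \<Longrightarrow> f ` ball (c i) (r i) \<subseteq> ball (c i) (r i)"
    "\<And>i. i \<in> J \<Longrightarrow> f ` cball (c i) (a i) \<inter> P = {}"
    by auto
  have j: "0 \<le> a j" "a j < r j" "c j \<notin> P" using insert.prems(1)[of j] by auto
  have "open (- P)" using assms(2) by (simp add: open_Compl)
  then obtain \<epsilon> where \<epsilon>: "0 < \<epsilon>" "ball (c j) \<epsilon> \<subseteq> - P"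
    using j(3) by (auto elim: openE)
  obtain g g' where g: "homeomorphism UNIV UNIV g g'" "\<And>x. x \<notin> ball (c j) (r j) \<Longrightarrow> g x = x"
    "g ` ball (c j) (r j) \<subseteq> ball (c j) (r j)" "g ` cball (c j) (a j) \<subseteq> ball (c j) \<epsilon>"
    using radial_shrink[OF j(1,2) \<epsilon>(1), of "c j"] by auto
  have disj: "x \<notin> ball (c i) (r i)" if "x \<in> ball (c j) (r j)" "i \<in> J" for x i
  proof -
    have "ball (c i) (r i) \<inter> ball (c j) (r j) = {}"
      using that(2) insert.hyps(2) by (intro insert.prems(2)) auto
    then show ?thesis using that(1) unfolding disjoint_iff by meson
  qed
  have on_j: "f (g x) = g x" if "x \<in> ball (c j) (r j)" for x
    using f(2) disj g(3) that by (meson image_subset_iff)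
  have on_J: "g x = x" if "x \<in> ball (c i) (r i)" "i \<in> J" for x i
    using g(2) disj that by metis
  have hom: "homeomorphism UNIV UNIV (f \<circ> g) (g' \<circ> f')"
    using g(1) f(1) by (rule homeomorphism_compose)
  have out: "(f \<circ> g) x = x" if "\<forall>i\<in>insert j J. x \<notin> ball (c i) (r i)" for x
    using that g(2)[of x] f(2)[of x] by simp
  have inn: "(f \<circ> g) ` ball (c i) (r i) \<subseteq> ball (c i) (r i) \<and> (f \<circ> g) ` cball (c i) (a i) \<inter> P = {}"
    if i: "i \<in> insert j J" for i
  proof (cases "i = j")
    case True
    have "cball (c j) (a j) \<subseteq> ball (c j) (r j)" using j(2) by auto
    then have "(f \<circ> g) ` cball (c j) (a j) = g ` cball (c j) (a j)"
      using on_j by (intro image_cong) auto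
    moreover have "g ` cball (c j) (a j) \<inter> P = {}" using g(4) \<epsilon>(2) by auto
    moreover have "(f \<circ> g) ` ball (c j) (r j) = g ` ball (c j) (r j)"
      using on_j by (intro image_cong) auto
    ultimately show ?thesis using g(3) True by simp
  next
    case False
    then have i: "i \<in> J" using i by simp
    then have "a i < r i" using insert.prems(1)[of i] by simp
    then have "cball (c i) (a i) \<subseteq> ball (c i) (r i)" by auto
    then have "(f \<circ> g) ` cball (c i) (a i) = f ` cball (c i) (a i)"
      using on_J i by (intro image_cong) auto
    moreover have "(f \<circ> g) ` ball (c i) (r i) = f ` ball (c i) (r i)"
      using on_J i by (intro image_cong) auto
    ultimately show ?thesis using f(3,4)[OF i] by simp
  qed
  show ?case
  proof (rule exI[of _ "f \<circ> g"], rule exI[of _ "g' \<circ> f'"], intro conjI allI impI ballI)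
    show "homeomorphism UNIV UNIV (f \<circ> g) (g' \<circ> f')" by (rule hom)
    show "(f \<circ> g) x = x" if "\<forall>i\<in>insert j J. x \<notin> ball (c i) (r i)" for x
      using that by (rule out)
    show "(f \<circ> g) ` ball (c i) (r i) \<subseteq> ball (c i) (r i)" if "i \<in> insert j J" for i
      using inn[OF that] by (rule conjunct1)
    show "(f \<circ> g) ` cball (c i) (a i) \<inter> P = {}" if "i \<in> insert j J" for i
      using inn[OF that] by (rule conjunct2)
  qed
qed

lemma compact_subset_ball:
  fixes T :: "'a::metric_space set"
  assumes "compact T" "T \<subseteq> ball c r" "0 < r"
  obtains a where "0 \<le> a" "a < r" "T \<subseteq> cball c a"
proof (cases "T = {}")
  case True
  then show thesis using that[of 0] assms(3) by simp
next
  case False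
  obtain x where x: "x \<in> T" "\<forall>y\<in>T. dist c y \<le> dist c x"
    using distance_attains_sup[OF assms(1) False, of c] by auto
  show thesis
  proof (rule that)
    show "dist c x < r" using x(1) assms(2) by auto
    show "T \<subseteq> cball c (dist c x)" using x(2) by auto
  qed simp
qed

lemma axis_diff: "axis k x - axis k y = axis k (x - y :: real)"
  by (simp add: vec_eq_iff axis_def)

lemma norm_axis: "norm (axis k x) = \<bar>x :: real\<bar>"
proof -
  have "axis k x = x *\<^sub>R axis k 1" by (simp add: vec_eq_iff axis_def)
  then show ?thesis by (simp add: norm_axis_1)
qed

lemma dist_axis: "dist (axis k x) (axis k y) = \<bar>x - y\<bar>" for x y :: real
  by (simp add: dist_norm axis_diff norm_axis)

text \<open>In coordinates in which \<open>C\<close> lies on a line, cut \<open>C\<close> into finitely many pieces contained in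
  small disjoint balls centred off the image of \<open>P\<close>, and shrink each piece towards the centre of its
  ball.\<close>

lemma push_tame_cantor_set_off:
  fixes C P :: "(real ^ 'n::finite) set"
  assumes tame: "tame_cantor_set k C" and P: "closed P" "nowhere_dense P" and "0 < \<epsilon>"
  shows "\<exists>f f'. homeomorphism UNIV UNIV f f' \<and> bounded {x. f x \<noteq> x} \<and>
    (\<forall>x. dist (f x) x < \<epsilon>) \<and> f ` C \<inter> P = {}"
proof -
  obtain g g' where g: "homeomorphism UNIV UNIV g g'" "cantor_set (g ` C)" "g ` C \<subseteq> coord_line k"
    using tame by (auto simp: tame_cantor_set_def)
  have gg': "g (g' y) = y" "g' (g x) = x" for x y using g(1) by (auto simp: homeomorphism_def)
  have g_cont: "continuous_on A g" and g'_cont: "continuous_on A g'" for A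
    using g(1) by (auto simp: homeomorphism_def intro: continuous_on_subset)
  have D_compact: "compact (g ` C)" by (rule compact_cantor_set[OF g(2)])
  obtain R where R: "0 < R" "\<And>x. x \<in> g ` C \<Longrightarrow> norm x \<le> R"
    using compact_imp_bounded[OF D_compact] unfolding bounded_pos by auto
  \<comment> \<open>Room for all balls used below: the midpoint of a piece meeting \<open>S\<close>
    has absolute value at most \<open>R + 1\<close>, and the ball of that piece stays within
    distance 1 of its midpoint.\<close>
  let ?B = "cball 0 (R + 2) :: (real ^ 'n) set"
  have "uniformly_continuous_on ?B g'"
    using g'_cont by (intro compact_uniformly_continuous) auto
  then obtain \<delta> where \<delta>: "0 < \<delta>" "\<And>u v. u \<in> ?B \<Longrightarrow> v \<in> ?B \<Longrightarrow> dist v u < \<delta> \<Longrightarrow> dist (g' v) (g' u) < \<epsilon>"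
    using \<open>0 < \<epsilon>\<close> unfolding uniformly_continuous_on_def by metis
  \<comment> \<open>Points are displaced only within balls, by less than \<open>2 * \<eta>\<close>
    and so by less than \<open>\<delta>\<close>, which \<open>g'\<close> turns into less than
    \<open>\<epsilon>\<close>.\<close>
  define \<eta> where "\<eta> = min 1 (\<delta> / 2)"
  have \<eta>: "0 < \<eta>" "\<eta> \<le> 1" "2 * \<eta> \<le> \<delta>" using \<delta>(1) by (auto simp: \<eta>_def)
  define S where "S = (\<lambda>x. x $ k) ` g ` C"
  have S_compact: "compact S"
    unfolding S_def by (intro compact_continuous_image D_compact continuous_intros)
  have axis_S: "g x = axis k (g x $ k)" if "x \<in> C" for x
    using g(3) that by (auto simp: coord_line_def vec_eq_iff axis_def)
  have S_axis: "axis k s \<in> g ` C" if s: "s \<in> S" for s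
  proof -
    obtain x where "x \<in> C" "s = g x $ k" using s by (auto simp: S_def)
    then show ?thesis using axis_S[of x] by (metis imageI)
  qed
  have S_bound: "\<bar>s\<bar> \<le> R" if s: "s \<in> S" for s
    using R(2)[OF S_axis[OF s]] by (simp add: norm_axis)
  \<comment> \<open>Cut points exist because \<open>S\<close> contains no interval: its copy on the
    axis is a Cantor set, which has no connected subset with two points.\<close>
  have "\<exists>t. of_int z * \<eta> < t \<and> t < of_int (z + 1) * \<eta> \<and> t \<notin> S" for z :: int
  proof (rule ccontr)
    assume no: "\<not> ?thesis"
    define T where "T = {of_int z * \<eta> <..< of_int (z + 1) * \<eta>}"
    have "continuous_on T (\<lambda>t. axis k t)"
    proof -
      have "continuous_on T (\<lambda>t. if i = k then t else 0)" for i
        by (cases "i = k") auto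
      then show ?thesis unfolding axis_def by (intro continuous_on_vec_lambda)
    qed
    then have "connected (axis k ` T)" by (rule connected_continuous_image) (simp add: T_def)
    moreover have "axis k ` T \<subseteq> g ` C" using no S_axis by (auto simp: T_def)
    moreover have "of_int z * \<eta> + \<eta> / 3 \<in> T" "of_int z * \<eta> + \<eta> / 2 \<in> T"
      using \<eta>(1) by (auto simp: T_def algebra_simps)
    ultimately have "axis k (of_int z * \<eta> + \<eta> / 3) = axis k (of_int z * \<eta> + \<eta> / 2)"
      using cantor_set_connected[OF g(2), of "axis k ` T"] by simp
    then have "of_int z * \<eta> + \<eta> / 3 = of_int z * \<eta> + \<eta> / 2" by (metis axis_nth)
    then show False using \<eta>(1) by simp
  qed
  then have "\<forall>z :: int. \<exists>t. of_int z * \<eta> < t \<and> t < of_int (z + 1) * \<eta> \<and> t \<notin> S" by (rule allI)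
  from choice[OF this] obtain t :: "int \<Rightarrow> real"
    where t': "\<forall>z. of_int z * \<eta> < t z \<and> t z < of_int (z + 1) * \<eta> \<and> t z \<notin> S" by (rule exE)
  have t: "of_int z * \<eta> < t z" "t z < of_int z * \<eta> + \<eta>" "t z \<notin> S" for z
    using t'[rule_format, of z] by (auto simp: algebra_simps)
  have t_Suc: "t z < t (z + 1)" "t (z + 1) < t z + 2 * \<eta>" for z
    using t(1,2)[of z] t(1,2)[of "z + 1"] by (auto simp: algebra_simps)
  have t_mono: "t (z + 1) \<le> t z'" if "z < z'" for z z'
  proof (cases "z' = z + 1")
    case False
    then have "real_of_int (z + 2) * \<eta> \<le> of_int z' * \<eta>" using that \<eta>(1) by (intro mult_right_mono) auto
    then show ?thesis using t(2)[of "z + 1"] t(1)[of z'] by (simp add: algebra_simps)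
  qed simp
  define J where "J = {z. \<exists>s\<in>S. t z < s \<and> s < t (z + 1)}"
  have "J \<subseteq> {- \<lceil>R / \<eta>\<rceil> - 2..\<lceil>R / \<eta>\<rceil>}"
  proof
    fix z assume "z \<in> J"
    then obtain s where "s \<in> S" "t z < s" "s < t (z + 1)" by (auto simp: J_def)
    then have "of_int z * \<eta> < R" "- R < of_int (z + 2) * \<eta>"
      using S_bound[of s] t(1)[of z] t(2)[of "z + 1"] by (auto simp: algebra_simps)
    then have "of_int z < R / \<eta>" "- (R / \<eta>) < of_int (z + 2)"
      using \<eta>(1) by (auto simp: field_simps)
    then show "z \<in> {- \<lceil>R / \<eta>\<rceil> - 2..\<lceil>R / \<eta>\<rceil>}" by simp linarith
  qed
  then have "finite J" by (rule finite_subset) simp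
  define m where "m z = (t z + t (z + 1)) / 2" for z
  define \<rho> where "\<rho> z = (t (z + 1) - t z) / 2" for z
  have \<rho>: "0 < \<rho> z" "\<rho> z < \<eta>" for z using t_Suc[of z] by (auto simp: \<rho>_def)
  have ball_m: "\<bar>s - m z\<bar> < \<rho> z \<longleftrightarrow> t z < s \<and> s < t (z + 1)" for s z
    unfolding m_def \<rho>_def by (auto simp: abs_less_iff field_simps)
  \<comment> \<open>The cut points miss \<open>S\<close>, so the part of \<open>S\<close> between
    two consecutive ones is compact and stays strictly inside the piece.\<close>
  have "\<exists>a. 0 \<le> a \<and> a < \<rho> z \<and> (\<forall>s\<in>S. \<bar>s - m z\<bar> < \<rho> z \<longrightarrow> \<bar>s - m z\<bar> \<le> a)" for z
  proof -
    have "compact (S \<inter> {t z..t (z + 1)})" by (intro compact_Int S_compact) simp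
    moreover have "S \<inter> {t z..t (z + 1)} \<subseteq> ball (m z) (\<rho> z)"
    proof
      fix s assume s: "s \<in> S \<inter> {t z..t (z + 1)}"
      then have "s \<noteq> t z" "s \<noteq> t (z + 1)" using t(3) by auto
      then have "\<bar>s - m z\<bar> < \<rho> z" unfolding ball_m using s by auto
      then show "s \<in> ball (m z) (\<rho> z)" by (simp add: dist_real_def abs_minus_commute)
    qed
    ultimately obtain a where a: "0 \<le> a" "a < \<rho> z" "S \<inter> {t z..t (z + 1)} \<subseteq> cball (m z) a"
      using compact_subset_ball \<rho>(1) by metis
    have "\<bar>s - m z\<bar> \<le> a" if "s \<in> S" "\<bar>s - m z\<bar> < \<rho> z" for s
    proof -
      have "s \<in> S \<inter> {t z..t (z + 1)}" using that unfolding ball_m by auto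
      then have "s \<in> cball (m z) a" using a(3) by (rule subsetD[rotated])
      then show ?thesis by (simp add: dist_real_def abs_minus_commute)
    qed
    then show ?thesis using a(1,2) by (intro exI[of _ a]) simp
  qed
  then have "\<forall>z. \<exists>a. 0 \<le> a \<and> a < \<rho> z \<and> (\<forall>s\<in>S. \<bar>s - m z\<bar> < \<rho> z \<longrightarrow> \<bar>s - m z\<bar> \<le> a)" by (rule allI)
  from choice[OF this] obtain a
    where a: "\<forall>z. 0 \<le> a z \<and> a z < \<rho> z \<and> (\<forall>s\<in>S. \<bar>s - m z\<bar> < \<rho> z \<longrightarrow> \<bar>s - m z\<bar> \<le> a z)" by (rule exE)
  \<comment> \<open>A third of the slack between \<open>a z\<close> and \<open>\<rho> z\<close>. The
    centre moves off the image of \<open>P\<close> by less than \<open>\<theta> z\<close>; the inner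
    radius grows to \<open>a z + \<theta> z\<close> to keep the piece inside, and the outer one
    drops to \<open>\<rho> z - \<theta> z\<close> to keep the balls disjoint, still with a third
    between them.\<close>
  define \<theta> where "\<theta> z = (\<rho> z - a z) / 3" for z
  have \<theta>: "0 < \<theta> z" for z using a by (simp add: \<theta>_def)
  have "\<exists>c. dist (axis k (m z)) c < \<theta> z \<and> c \<notin> g ` P" for z
  proof -
    define U where "U = g -` ball (axis k (m z)) (\<theta> z)"
    have "open U" unfolding U_def using g_cont by (intro open_vimage) auto
    have "g' (axis k (m z)) \<in> U" using \<theta> by (simp add: U_def gg')
    moreover have "interior P = {}" using P by (simp add: nowhere_dense_def)
    ultimately have "\<not> U \<subseteq> P" using interior_maximal[OF _ \<open>open U\<close>, of P] by auto
    then obtain p where p: "p \<in> U" "p \<notin> P" by auto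
    then have "g p \<notin> g ` P" using gg'(2) by (metis imageE)
    then show ?thesis using p(1) by (intro exI[of _ "g p"]) (simp add: U_def)
  qed
  then have "\<forall>z. \<exists>c. dist (axis k (m z)) c < \<theta> z \<and> c \<notin> g ` P" by (rule allI)
  from choice[OF this] obtain c where c: "\<forall>z. dist (axis k (m z)) (c z) < \<theta> z \<and> c z \<notin> g ` P"
    by (rule exE)
  have ball_c: "dist (axis k (m z)) x < \<rho> z" if "x \<in> ball (c z) (\<rho> z - \<theta> z)" for x z
    using that c[rule_format, of z] dist_triangle[of "axis k (m z)" x "c z"] by simp
  have coord: "t z < x $ k" "x $ k < t (z + 1)" if "x \<in> ball (c z) (\<rho> z - \<theta> z)" for x z
  proof -
    have "\<bar>x $ k - m z\<bar> \<le> dist x (axis k (m z))"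
      using component_le_norm_cart[of "x - axis k (m z)" k] by (simp add: dist_norm)
    then have "\<bar>x $ k - m z\<bar> < \<rho> z" using ball_c[OF that] by (simp add: dist_commute)
    then show "t z < x $ k" "x $ k < t (z + 1)" unfolding ball_m by auto
  qed
  have "closed (g ` P)"
  proof -
    have "g ` P = g' -` P"
    proof (intro set_eqI iffI)
      fix y assume "y \<in> g' -` P"
      then show "y \<in> g ` P" using gg'(1)[of y] by (metis imageI vimageD)
    qed (auto simp: gg')
    then show ?thesis using closed_vimage[OF P(1) g'_cont] by simp
  qed
  have disj: "ball (c i) (\<rho> i - \<theta> i) \<inter> ball (c j) (\<rho> j - \<theta> j) = {}" if "i \<noteq> j" for i j
  proof (rule equals0I)
    fix x assume "x \<in> ball (c i) (\<rho> i - \<theta> i) \<inter> ball (c j) (\<rho> j - \<theta> j)"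
    then have "t i < x $ k" "x $ k < t (i + 1)" "t j < x $ k" "x $ k < t (j + 1)"
      using coord by auto
    then show False using t_mono[of i j] t_mono[of j i] that by linarith
  qed
  have "\<exists>f f'. homeomorphism UNIV UNIV f f' \<and>
    (\<forall>x. (\<forall>j\<in>J. x \<notin> ball (c j) (\<rho> j - \<theta> j)) \<longrightarrow> f x = x) \<and>
    (\<forall>j\<in>J. f ` ball (c j) (\<rho> j - \<theta> j) \<subseteq> ball (c j) (\<rho> j - \<theta> j) \<and>
      f ` cball (c j) (a j + \<theta> j) \<inter> g ` P = {})"
  proof (rule shrink_balls[OF \<open>finite J\<close> \<open>closed (g ` P)\<close> _ disj])
    fix z
    have "a z + \<theta> z < \<rho> z - \<theta> z" using a[rule_format, of z] by (simp add: \<theta>_def field_simps)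
    then show "0 \<le> a z + \<theta> z \<and> a z + \<theta> z < \<rho> z - \<theta> z \<and> c z \<notin> g ` P"
      using a[rule_format, of z] \<theta>[of z] c by simp
  qed
  then obtain f f' where f: "homeomorphism UNIV UNIV f f'"
    "\<And>x. (\<forall>j\<in>J. x \<notin> ball (c j) (\<rho> j - \<theta> j)) \<Longrightarrow> f x = x"
    "\<And>j. j \<in> J \<Longrightarrow> f ` ball (c j) (\<rho> j - \<theta> j) \<subseteq> ball (c j) (\<rho> j - \<theta> j)"
    "\<And>j. j \<in> J \<Longrightarrow> f ` cball (c j) (a j + \<theta> j) \<inter> g ` P = {}"
    by auto
  define F where "F = g' \<circ> (f \<circ> g)"
  have hom: "homeomorphism UNIV UNIV F ((g' \<circ> f') \<circ> g)"
    unfolding F_def using g(1) f(1) by (meson homeomorphism_compose homeomorphism_symD)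
  have moved: "g x \<in> ?B \<and> f (g x) \<in> ?B \<and> dist (f (g x)) (g x) < \<delta>" if ne: "f (g x) \<noteq> g x" for x
  proof -
    obtain z where z: "z \<in> J" "g x \<in> ball (c z) (\<rho> z - \<theta> z)" using f(2)[of "g x"] ne by auto
    have z': "f (g x) \<in> ball (c z) (\<rho> z - \<theta> z)" using f(3)[OF z(1)] z(2) by (meson image_subset_iff)
    obtain s where s: "s \<in> S" "\<bar>s - m z\<bar> < \<rho> z" using z(1) unfolding J_def ball_m by auto
    have "\<bar>m z\<bar> \<le> R + 1" using S_bound[OF s(1)] s(2) \<rho>(2)[of z] \<eta>(2) by simp
    then have in_B: "y \<in> ?B" if "y \<in> ball (c z) (\<rho> z - \<theta> z)" for y
      using ball_c[OF that] \<rho>(2)[of z] \<eta>(2) norm_triangle_sub[of y "axis k (m z)"]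
      by (simp add: dist_norm norm_axis norm_minus_commute)
    have "dist (f (g x)) (g x) < 2 * \<rho> z"
      using ball_c[OF z(2)] ball_c[OF z'] dist_triangle2[of "f (g x)" "g x" "axis k (m z)"]
      by (simp add: dist_commute)
    then show ?thesis using in_B[OF z(2)] in_B[OF z'] \<rho>(2)[of z] \<eta>(3) by simp
  qed
  have near: "dist (F x) x < \<epsilon>" for x
  proof (cases "f (g x) = g x")
    case True
    then show ?thesis using \<open>0 < \<epsilon>\<close> by (simp add: F_def gg')
  next
    case False
    then have "dist (g' (f (g x))) (g' (g x)) < \<epsilon>" using moved \<delta>(2) by metis
    then show ?thesis by (simp add: F_def gg')
  qed
  have bdd: "bounded {x. F x \<noteq> x}"
  proof (rule bounded_subset)
    show "bounded (g' ` ?B)"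
      using g'_cont by (intro compact_imp_bounded compact_continuous_image) auto
    show "{x. F x \<noteq> x} \<subseteq> g' ` ?B"
    proof clarify
      fix x assume "F x \<noteq> x"
      then have "f (g x) \<noteq> g x" by (auto simp: F_def gg')
      then have "g x \<in> ?B" using moved by metis
      then show "x \<in> g' ` ?B" using gg'(2)[of x] by (metis imageI)
    qed
  qed
  have off: "F ` C \<inter> P = {}"
  proof (rule equals0I)
    fix y assume "y \<in> F ` C \<inter> P"
    then obtain x where x: "x \<in> C" "F x \<in> P" by auto
    define s where "s = g x $ k"
    have s: "s \<in> S" "g x = axis k s" using x(1) axis_S by (auto simp: S_def s_def)
    have "\<exists>z. t z < s \<and> s < t (z + 1)"
    proof -
      define z where "z = \<lfloor>s / \<eta>\<rfloor>"
      have "of_int z \<le> s / \<eta>" "s / \<eta> < of_int z + 1" by (auto simp: z_def)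
      then have z: "of_int z * \<eta> \<le> s" "s < of_int z * \<eta> + \<eta>"
        using \<eta>(1) by (auto simp: field_simps)
      have "s \<noteq> t z" using s(1) t(3) by auto
      then consider "s < t z" | "t z < s" by linarith
      then show ?thesis
      proof cases
        case 1
        then show ?thesis using z(1) t(2)[of "z - 1"] by (intro exI[of _ "z - 1"]) (simp add: algebra_simps)
      next
        case 2
        then show ?thesis using z(2) t(1)[of "z + 1"] by (intro exI[of _ z]) (simp add: algebra_simps)
      qed
    qed
    then obtain z where z: "t z < s \<and> s < t (z + 1)" by (rule exE)
    then have "z \<in> J" using s(1) by (auto simp: J_def)
    have "\<bar>s - m z\<bar> \<le> a z" using a z s(1) unfolding ball_m[symmetric] by simp
    then have "dist (axis k (m z)) (g x) \<le> a z" unfolding s(2) dist_axis by simp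
    then have "g x \<in> cball (c z) (a z + \<theta> z)"
      using c[rule_format, of z] dist_triangle3[of "c z" "g x" "axis k (m z)"] by simp
    then have "f (g x) \<notin> g ` P" using f(4)[OF \<open>z \<in> J\<close>] by (meson disjoint_iff imageI)
    moreover have "f (g x) = g (F x)" by (simp add: F_def gg')
    ultimately show False using x(2) by simp
  qed
  show ?thesis
  proof (rule exI[of _ F], rule exI[of _ "(g' \<circ> f') \<circ> g"], intro conjI allI)
    show "dist (F x) x < \<epsilon>" for x by (rule near)
  qed (rule hom bdd off)+
qed

section \<open>Generic homeomorphisms\<close>

lemma bounded_moved_uniformly_continuous:
  fixes f :: "'a::euclidean_space \<Rightarrow> 'a"
  assumes "continuous_on UNIV f" "bounded {x. f x \<noteq> x}" "0 < \<epsilon>"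
  shows "\<exists>\<delta>>0. \<forall>x y. dist x y < \<delta> \<longrightarrow> dist (f x) (f y) < \<epsilon>"
proof -
  obtain R where R: "0 < R" "\<And>x. f x \<noteq> x \<Longrightarrow> norm x \<le> R"
    using assms(2) unfolding bounded_pos by auto
  have "uniformly_continuous_on (cball 0 (R + 1)) f"
    using assms(1) by (intro compact_uniformly_continuous continuous_on_subset[OF assms(1)]) auto
  then obtain \<delta> where \<delta>: "0 < \<delta>"
    "\<And>x y. x \<in> cball 0 (R + 1) \<Longrightarrow> y \<in> cball 0 (R + 1) \<Longrightarrow> dist y x < \<delta> \<Longrightarrow> dist (f y) (f x) < \<epsilon>"
    using assms(3) unfolding uniformly_continuous_on_def by metis
  have "dist (f x) (f y) < \<epsilon>" if d: "dist x y < min \<delta> (min 1 \<epsilon>)" for x y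
  proof (cases "norm x \<le> R + 1 \<and> norm y \<le> R + 1")
    case True
    then show ?thesis using \<delta>(2)[of y x] d by simp
  next
    case False
    have "norm y \<le> norm x + dist x y" "norm x \<le> norm y + dist x y"
      using norm_triangle_sub[of y x] norm_triangle_sub[of x y] by (auto simp: dist_norm norm_minus_commute)
    then have "\<not> norm x \<le> R" "\<not> norm y \<le> R" using False d by auto
    then have "f x = x" "f y = y" using R(2) by metis+
    then show ?thesis using d by simp
  qed
  then show ?thesis using \<delta>(1) assms(3) by (intro exI[of _ "min \<delta> (min 1 \<epsilon>)"]) simp
qed

text \<open>A function moving only a bounded set is determined up to \<open>4\<epsilon>\<close> by a bound on that set, a
  modulus of continuity, and approximate values on a finite net; there are countably many such
  data.\<close>

lemma countable_approximation_eps: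
  fixes E :: "('a::euclidean_space \<Rightarrow> 'a) set"
  assumes E: "\<And>f. f \<in> E \<Longrightarrow> continuous_on UNIV f \<and> bounded {x. f x \<noteq> x}" and "0 < \<epsilon>"
  shows "\<exists>D. countable D \<and> D \<subseteq> E \<and> (\<forall>f\<in>E. \<exists>g\<in>D. \<forall>x. dist (f x) (g x) < 4 * \<epsilon>)"
proof -
  have "\<exists>F. finite F \<and>
      cball (0::'a) (real (fst p)) \<subseteq> (\<Union>y\<in>F. ball y (1 / (real (snd p) + 1)))" for p :: "nat \<times> nat"
    using compact_cball[of "0::'a" "real (fst p)"] unfolding compact_eq_totally_bounded by simp
  then obtain net :: "nat \<times> nat \<Rightarrow> 'a set" where net: "\<And>p. finite (net p)"
    "\<And>p. cball 0 (real (fst p)) \<subseteq> (\<Union>y\<in>net p. ball y (1 / (real (snd p) + 1)))"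
    by metis
  obtain Q :: "'a set" where Q: "countable Q" "\<And>X. open X \<Longrightarrow> X \<noteq> {} \<Longrightarrow> \<exists>q\<in>Q. q \<in> X"
    by (rule countable_dense_setE) blast
  have "\<exists>q\<in>Q. dist (f y) q < \<epsilon>" for f :: "'a \<Rightarrow> 'a" and y
    using Q(2)[of "ball (f y) \<epsilon>"] \<open>0 < \<epsilon>\<close> by auto
  then have "\<forall>f :: 'a \<Rightarrow> 'a. \<forall>y. \<exists>q. q \<in> Q \<and> dist (f y) q < \<epsilon>" by blast
  then obtain rnd where rnd: "\<And>f y. rnd f y \<in> Q" "\<And>(f :: 'a \<Rightarrow> 'a) y. dist (f y) (rnd f y) < \<epsilon>" by metis
  have "\<exists>p :: nat \<times> nat. (\<forall>x. f x \<noteq> x \<longrightarrow> norm x \<le> real (fst p)) \<and>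
      (\<forall>x y. dist x y < 1 / (real (snd p) + 1) \<longrightarrow> dist (f x) (f y) < \<epsilon>)" if f: "f \<in> E" for f
  proof -
    obtain R where R: "\<forall>x. f x \<noteq> x \<longrightarrow> norm x \<le> R"
      using E[OF f] unfolding bounded_iff by auto
    obtain N where N: "R \<le> real N" using real_arch_simple by blast
    obtain \<delta> where \<delta>: "0 < \<delta>" "\<forall>x y. dist x y < \<delta> \<longrightarrow> dist (f x) (f y) < \<epsilon>"
      using bounded_moved_uniformly_continuous[of f \<epsilon>] E[OF f] \<open>0 < \<epsilon>\<close> by auto
    obtain j where j: "1 / (real j + 1) < \<delta>"
      using nat_approx_posE[OF \<delta>(1)] by (auto simp: add.commute)
    show ?thesis
    proof (intro exI[of _ "(N, j)"] conjI allI impI)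
      show "norm x \<le> real (fst (N, j))" if "f x \<noteq> x" for x
        using R that N by (metis fst_conv order_trans)
      show "dist (f x) (f y) < \<epsilon>" if "dist x y < 1 / (real (snd (N, j)) + 1)" for x y
        using \<delta>(2) j that by (metis snd_conv less_trans)
    qed
  qed
  then have "\<forall>f\<in>E. \<exists>p :: nat \<times> nat. (\<forall>x. f x \<noteq> x \<longrightarrow> norm x \<le> real (fst p)) \<and>
      (\<forall>x y. dist x y < 1 / (real (snd p) + 1) \<longrightarrow> dist (f x) (f y) < \<epsilon>)" by (rule ballI)
  from bchoice[OF this] obtain p :: "('a \<Rightarrow> 'a) \<Rightarrow> nat \<times> nat"
    where p: "\<forall>f\<in>E. (\<forall>x. f x \<noteq> x \<longrightarrow> norm x \<le> real (fst (p f))) \<and>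
      (\<forall>x y. dist x y < 1 / (real (snd (p f)) + 1) \<longrightarrow> dist (f x) (f y) < \<epsilon>)" by (rule exE)
  define code where "code f = (p f, restrict (rnd f) (net (p f)))" for f
  have "code ` E \<subseteq> Sigma UNIV (\<lambda>p. PiE (net p) (\<lambda>_. Q))"
    using rnd(1) by (auto simp: code_def)
  moreover have "countable (Sigma UNIV (\<lambda>p. PiE (net p) (\<lambda>_. Q)))"
    using net(1) Q(1) by (intro countable_SIGMA countable_PiE) auto
  ultimately have "countable (code ` E)" by (rule countable_subset)
  \<comment> \<open>The four errors occur on the way from \<open>f x\<close> to \<open>f y\<close>,
    to the common rounded value \<open>rnd f y\<close>, to \<open>g y\<close> and to
    \<open>g x\<close>.\<close>
  moreover have "dist (f x) (g x) < 4 * \<epsilon>" if fg: "f \<in> E" "g \<in> E" "code f = code g" for f g x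
  proof (cases "norm x \<le> real (fst (p f))")
    case False
    have "p f = p g" using fg(3) by (simp add: code_def)
    then have "f x = x" "g x = x" using p fg(1,2) False by metis+
    then show ?thesis using \<open>0 < \<epsilon>\<close> by simp
  next
    case True
    have pe: "p f = p g" using fg(3) by (simp add: code_def)
    obtain y where y: "y \<in> net (p f)" "dist y x < 1 / (real (snd (p f)) + 1)"
      using net(2)[of "p f"] True by fastforce
    have r: "rnd f y = rnd g y"
      using fg(3) y(1) pe unfolding code_def by (metis restrict_apply' snd_conv)
    have "dist (f y) (f x) < \<epsilon>" using p fg(1) y(2) by blast
    moreover have "dist (g y) (g x) < \<epsilon>" using p fg(2) y(2) pe by metis
    moreover have "dist (f y) (rnd f y) < \<epsilon>" "dist (g y) (rnd f y) < \<epsilon>"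
      using rnd(2)[of f y] rnd(2)[of g y] r by simp_all
    ultimately show ?thesis
      using dist_triangle3[of "f x" "g x" "f y"] dist_triangle[of "f y" "g x" "g y"]
        dist_triangle2[of "f y" "g y" "rnd f y"] by linarith
  qed
  \<comment> \<open>Choosing one member of \<open>E\<close> for each code, instead of building a
    function from the code, keeps the countable set inside \<open>E\<close>.\<close>
  moreover have "inv_into E code (code f) \<in> E" "code (inv_into E code (code f)) = code f" if "f \<in> E" for f
    using that by (simp_all add: inv_into_into f_inv_into_f)
  ultimately show ?thesis
    by (intro exI[of _ "inv_into E code ` code ` E"] conjI ballI) (auto, metis)
qed

lemma countable_approximation:
  fixes E :: "('a::euclidean_space \<Rightarrow> 'a) set"
  assumes E: "\<And>f. f \<in> E \<Longrightarrow> continuous_on UNIV f \<and> bounded {x. f x \<noteq> x}"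
  shows "\<exists>D. countable D \<and> D \<subseteq> E \<and> (\<forall>f\<in>E. \<forall>\<epsilon>>0. \<exists>g\<in>D. \<forall>x. dist (f x) (g x) < \<epsilon>)"
proof -
  have "\<exists>D. countable D \<and> D \<subseteq> E \<and> (\<forall>f\<in>E. \<exists>g\<in>D. \<forall>x. dist (f x) (g x) < 4 * (1 / real (Suc n)))" for n
    by (rule countable_approximation_eps[OF E]) simp_all
  then obtain D where D: "\<And>n. countable (D n)" "\<And>n. D n \<subseteq> E"
    "\<And>n. \<forall>f\<in>E. \<exists>g\<in>D n. \<forall>x. dist (f x) (g x) < 4 * (1 / real (Suc n))" by metis
  have "\<exists>g\<in>(\<Union>n. D n). \<forall>x. dist (f x) (g x) < \<epsilon>" if f: "f \<in> E" "0 < \<epsilon>" for f \<epsilon>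
  proof -
    obtain n where n: "1 / real (Suc n) < \<epsilon> / 4" using nat_approx_posE[of "\<epsilon> / 4"] f(2) by auto
    obtain g where g: "g \<in> D n" "\<forall>x. dist (f x) (g x) < 4 * (1 / real (Suc n))" using D(3) f(1) by metis
    have "dist (f x) (g x) < \<epsilon>" for x using g(2)[rule_format, of x] n by linarith
    then show ?thesis using g(1) by blast
  qed
  moreover have "countable (\<Union>n. D n)" "(\<Union>n. D n) \<subseteq> E" using D(1,2) by auto
  ultimately show ?thesis by (intro exI[of _ "\<Union>n. D n"]) simp
qed

section \<open>Infinite compositions of homeomorphisms\<close>

definition homeo :: "('a::topological_space \<Rightarrow> 'a) \<Rightarrow> bool" where
  "homeo f \<longleftrightarrow> homeomorphism UNIV UNIV f (inv f)"

lemma homeoI: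
  assumes "homeomorphism UNIV UNIV f f'"
  shows "homeo f"
proof -
  have "f (f' y) = y" "f' (f x) = x" for x y using assms by (auto simp: homeomorphism_def)
  then have "inv f = f'" by (metis inj_def inv_f_f surj_def ext inv_equality)
  then show ?thesis using assms by (simp add: homeo_def)
qed

lemma homeo_inv_f_f: "homeo f \<Longrightarrow> inv f (f x) = x"
  and homeo_f_inv_f: "homeo f \<Longrightarrow> f (inv f x) = x"
  and homeo_continuous: "homeo f \<Longrightarrow> continuous_on UNIV f"
  and homeo_continuous_inv: "homeo f \<Longrightarrow> continuous_on UNIV (inv f)"
  by (auto simp: homeo_def homeomorphism_def)

lemma homeo_bij:
  assumes "homeo f"
  shows "bij f"
proof (rule bijI)
  show "inj f" using homeo_inv_f_f[OF assms] by (rule inj_on_inverseI)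
  show "surj f" using homeo_f_inv_f[OF assms] by (rule surjI)
qed

lemma homeo_compose:
  assumes "homeo f" "homeo g"
  shows "homeo (f \<circ> g)" "inv (f \<circ> g) = inv g \<circ> inv f"
proof -
  show "homeo (f \<circ> g)"
    using homeomorphism_compose[of UNIV UNIV g "inv g" UNIV f "inv f"] assms homeoI
    unfolding homeo_def by metis
  show "inv (f \<circ> g) = inv g \<circ> inv f"
    using assms by (intro o_inv_distrib homeo_bij)
qed

lemma homeo_id: "homeo id"
  by (auto simp: homeo_def homeomorphism_def)

text \<open>The second condition compares the inverses of \<open>f \<circ> K\<close> and
  \<open>K\<close>. Small factors alone give uniform convergence, but the limit might fail to be
  injective.\<close>

definition accept :: "nat \<Rightarrow> ('a::metric_space \<Rightarrow> 'a) \<Rightarrow> ('a \<Rightarrow> 'a) \<Rightarrow> bool" where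
  "accept j K f \<longleftrightarrow> (\<forall>y. dist (f y) y < (1/2) ^ j) \<and> (\<forall>y. dist (inv K (inv f y)) (inv K y) < (1/2) ^ j)"

text \<open>An index whose map is not accepted is skipped. Thus every sequence of naturals yields a
  convergent composition, and the parameters range over the whole sequence space.\<close>

primrec approx :: "(nat \<Rightarrow> 'a::metric_space \<Rightarrow> 'a) \<Rightarrow> (nat \<Rightarrow> nat) \<Rightarrow> nat \<Rightarrow> 'a \<Rightarrow> 'a" where
  "approx h p 0 = id"
| "approx h p (Suc j) =
    (if accept j (approx h p j) (h (p j)) then h (p j) \<circ> approx h p j else approx h p j)"

lemma approx_cong: "(\<And>i. i < j \<Longrightarrow> p i = q i) \<Longrightarrow> approx h p j = approx h q j"
  by (induction j) auto

lemma homeo_approx: "(\<And>m. homeo (h m)) \<Longrightarrow> homeo (approx h p j)"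
  by (induction j) (simp_all add: homeo_id homeo_compose)

lemma approx_step:
  assumes "\<And>m. homeo (h m)"
  shows "dist (approx h p (Suc j) x) (approx h p j x) \<le> (1/2) ^ j"
    and "dist (inv (approx h p (Suc j)) x) (inv (approx h p j) x) \<le> (1/2) ^ j"
  by (auto simp: accept_def less_imp_le homeo_compose(2)[OF assms homeo_approx[OF assms]])

lemma uniform_limit_geometric:
  fixes u :: "nat \<Rightarrow> 'a::topological_space \<Rightarrow> 'b::{real_normed_vector,complete_space}"
  assumes step: "\<And>j x. dist (u (Suc j) x) (u j x) \<le> (1/2) ^ j"
    and cont: "\<And>j. continuous_on UNIV (u j)"
  shows "\<exists>v. continuous_on UNIV v \<and> (\<forall>j x. dist (u j x) (v x) \<le> 2 * (1/2) ^ j)"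
proof -
  \<comment> \<open>The subtracted term is the part of the geometric series not yet used up; it lets
    the induction close.\<close>
  have tail: "dist (u (j + m) x) (u j x) \<le> 2 * (1/2) ^ j - 2 * (1/2) ^ (j + m)" for j m x
  proof (induction m)
    case (Suc m)
    have "dist (u (j + Suc m) x) (u j x) \<le> dist (u (Suc (j + m)) x) (u (j + m) x) + dist (u (j + m) x) (u j x)"
      by (simp add: dist_triangle)
    also have "\<dots> \<le> (1/2) ^ (j + m) + (2 * (1/2) ^ j - 2 * (1/2) ^ (j + m))"
      by (intro add_mono step Suc)
    finally show ?case by simp
  qed simp
  have tail': "dist (u i x) (u j x) \<le> 2 * (1/2) ^ j" if "j \<le> i" for i j x
  proof -
    have "dist (u i x) (u j x) \<le> 2 * (1/2) ^ j - 2 * (1/2) ^ i"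
      using tail[of j "i - j" x] that by simp
    moreover have "0 \<le> (1/2::real) ^ i" by simp
    ultimately show ?thesis by linarith
  qed
  have small: "\<exists>M. \<forall>j\<ge>M. 2 * (1/2) ^ j < e" if "0 < e" for e :: real
  proof -
    have "\<exists>M. (1/2::real) ^ M < e / 2" using that by (intro real_arch_pow_inv) auto
    then obtain M where M: "(1/2::real) ^ M < e / 2" by (rule exE)
    show ?thesis
    proof (intro exI[of _ M] allI impI)
      fix j assume "M \<le> j"
      then have "(1/2::real) ^ j \<le> (1/2) ^ M" by (intro power_decreasing) auto
      then show "2 * (1/2) ^ j < e" using M by linarith
    qed
  qed
  have "Cauchy (\<lambda>j. u j x)" for x
  proof (rule metric_CauchyI)
    fix e :: real assume "0 < e"
    then obtain M where M: "\<forall>j\<ge>M. 2 * (1/2) ^ j < e / 2" using small[of "e / 2"] by auto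
    have "dist (u i x) (u j x) < e" if "M \<le> i" "M \<le> j" for i j
      using tail'[OF that(1), of x] tail'[OF that(2), of x] M[rule_format, of M]
        dist_triangle2[of "u i x" "u j x" "u M x"] by simp
    then show "\<exists>M. \<forall>i\<ge>M. \<forall>j\<ge>M. dist (u i x) (u j x) < e" by blast
  qed
  then have "\<forall>x. \<exists>l. (\<lambda>j. u j x) \<longlonglongrightarrow> l" using Cauchy_convergent convergent_def by metis
  from choice[OF this] obtain v where v: "\<forall>x. (\<lambda>j. u j x) \<longlonglongrightarrow> v x" by (rule exE)
  have close: "dist (u j x) (v x) \<le> 2 * (1/2) ^ j" for j x
  proof -
    have "(\<lambda>i. dist (u i x) (u j x)) \<longlonglongrightarrow> dist (v x) (u j x)"
      using v by (intro tendsto_intros) simp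
    then have "dist (v x) (u j x) \<le> 2 * (1/2) ^ j"
      by (rule Lim_bounded[of _ _ j]) (use tail' in simp)
    then show ?thesis by (simp add: dist_commute)
  qed
  have lim: "uniform_limit UNIV u v sequentially"
  proof (rule uniform_limitI)
    fix e :: real assume "0 < e"
    then obtain M where M: "\<forall>j\<ge>M. 2 * (1/2) ^ j < e" using small by auto
    then show "\<forall>\<^sub>F j in sequentially. \<forall>x\<in>UNIV. dist (u j x) (v x) < e"
      unfolding eventually_sequentially using close by (meson le_less_trans)
  qed
  have "continuous_on UNIV v"
  proof (rule uniform_limit_theorem[OF _ lim])
    show "\<forall>\<^sub>F j in sequentially. continuous_on UNIV (u j)" using cont by simp
  qed simp
  then show ?thesis using close by (intro exI[of _ v]) simp
qed

text \<open>The inverses converge uniformly as well, and their limit inverts the limit of the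
  maps.\<close>

lemma homeo_limit:
  fixes K :: "nat \<Rightarrow> 'a::{real_normed_vector,complete_space} \<Rightarrow> 'a"
  assumes K: "\<And>j. homeo (K j)"
    and step: "\<And>j x. dist (K (Suc j) x) (K j x) \<le> (1/2) ^ j"
    and step': "\<And>j x. dist (inv (K (Suc j)) x) (inv (K j) x) \<le> (1/2) ^ j"
  shows "\<exists>H. homeo H \<and> (\<forall>j x. dist (K j x) (H x) \<le> 2 * (1/2) ^ j)"
proof -
  obtain H where H: "continuous_on UNIV H" "\<And>j x. dist (K j x) (H x) \<le> 2 * (1/2) ^ j"
    using uniform_limit_geometric[of K, OF step homeo_continuous[OF K]] by metis
  obtain H' where H': "continuous_on UNIV H'" "\<And>j x. dist (inv (K j) x) (H' x) \<le> 2 * (1/2) ^ j"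
    using uniform_limit_geometric[of "\<lambda>j. inv (K j)", OF step' homeo_continuous_inv[OF K]] by metis
  have lim0: "(\<lambda>j. 2 * (1/2::real) ^ j) \<longlonglongrightarrow> 0"
    using tendsto_mult_right_zero[OF LIMSEQ_realpow_zero[of "1/2"]] by simp
  have tends: "(\<lambda>j. A j) \<longlonglongrightarrow> l" if "\<And>j. dist (A j) l \<le> 2 * (1/2) ^ j" for A and l :: 'a
    by (rule metric_tendsto_imp_tendsto[OF lim0]) (use that in \<open>auto intro!: always_eventually\<close>)
  have inverse: "B (A x) = x"
    if A: "\<And>j. dist (a j x) (A x) \<le> 2 * (1/2) ^ j" and B: "\<And>j y. dist (b j y) (B y) \<le> 2 * (1/2) ^ j"
      and cont: "continuous_on UNIV B" and ba: "\<And>j. b j (a j x) = x" for a b :: "nat \<Rightarrow> 'a \<Rightarrow> 'a" and A B x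
  proof -
    have "(\<lambda>j. B (a j x)) \<longlonglongrightarrow> B (A x)"
      using continuous_on_tendsto_compose[OF cont tends[OF A]] by simp
    moreover have "(\<lambda>j. B (a j x)) \<longlonglongrightarrow> x"
      by (rule tends) (metis B ba dist_commute)
    ultimately show ?thesis by (rule LIMSEQ_unique)
  qed
  have "H' (H x) = x" for x
    by (rule inverse[of K _ _ "\<lambda>j. inv (K j)"]) (use H H' homeo_inv_f_f[OF K] in auto)
  moreover have "H (H' x) = x" for x
    by (rule inverse[of "\<lambda>j. inv (K j)" _ _ K]) (use H H' homeo_f_inv_f[OF K] in auto)
  ultimately have "homeomorphism UNIV UNIV H H'"
    using H(1) H'(1) by (auto simp: homeomorphism_def) (metis rangeI)+
  then show ?thesis using homeoI H(2) by metis
qed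

lemma homeo_support:
  assumes "homeo f"
  shows "{x. inv f x \<noteq> x} = {x. f x \<noteq> x}"
  using homeo_inv_f_f[OF assms] homeo_f_inv_f[OF assms] by (metis (no_types, lifting))

lemma bounded_support_compose:
  "bounded {x. f x \<noteq> x} \<Longrightarrow> bounded {x. g x \<noteq> x} \<Longrightarrow> bounded {x. (f \<circ> g) x \<noteq> x}"
  by (rule bounded_subset[of "{x. f x \<noteq> x} \<union> {x. g x \<noteq> x}"]) auto

lemma bounded_support_approx:
  assumes "\<And>m. bounded {x. h m x \<noteq> x}"
  shows "bounded {x. approx h p j x \<noteq> x}"
proof (induction j)
  case (Suc j)
  then show ?case using bounded_support_compose[OF assms[of "p j"] Suc] by simp
qed simp

lemma tame_cantor_set_homeo: "tame_cantor_set k C \<Longrightarrow> homeo f \<Longrightarrow> tame_cantor_set k (f ` C)"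
  unfolding homeo_def by (rule tame_cantor_set_image)

text \<open>Whatever the first \<open>j\<close> factors are, the next one can be chosen to push the image of \<open>C\<close> off
  \<open>P\<close>; the later factors, if they are close enough to the identity, cannot undo this.\<close>

lemma nowhere_dense_bad_parameters:
  fixes h :: "nat \<Rightarrow> real ^ 'n::finite \<Rightarrow> real ^ 'n"
  assumes h: "\<And>m. homeo (h m)" "\<And>m. bounded {x. h m x \<noteq> x}"
    and dense: "\<And>f \<epsilon>. homeo f \<Longrightarrow> bounded {x. f x \<noteq> x} \<Longrightarrow> 0 < \<epsilon> \<Longrightarrow> \<exists>m. \<forall>x. dist (f x) (h m x) < \<epsilon>"
    and id: "h m0 = id"
    and H: "\<And>p j x. dist (approx h p j x) (H p x) \<le> 2 * (1/2) ^ j"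
    and C: "tame_cantor_set k C" and P: "closed P" "nowhere_dense P"
  shows "nowhere_dense {x. H (address x) ` C \<inter> P \<noteq> {}}"
  unfolding nowhere_dense_iff
proof (intro allI impI)
  fix U :: "real set" assume U: "open U \<and> U \<noteq> {}"
  then obtain x where "x \<in> U" by auto
  then obtain j where j: "cylinder (address x) j \<subseteq> U" using cylinder_small U by meson
  define p where "p = address x"
  define K where "K = approx h p j"
  have K: "homeo K" "bounded {x. inv K x \<noteq> x}"
    unfolding K_def using homeo_approx[of h, OF h(1)] bounded_support_approx[of h, OF h(2)]
    by (simp_all add: homeo_support)
  have KC: "tame_cantor_set k (K ` C)" using C K(1) by (rule tame_cantor_set_homeo)
  \<comment> \<open>A modulus of continuity for \<open>inv K\<close>: a factor that moves points by
    less than \<open>\<delta>\<close> meets the condition on inverses in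
    \<open>accept\<close>.\<close>
  obtain \<delta> where \<delta>: "0 < \<delta>" "\<And>y z. dist y z < \<delta> \<Longrightarrow> dist (inv K y) (inv K z) < (1/2) ^ j"
    using bounded_moved_uniformly_continuous[OF homeo_continuous_inv[OF K(1)] K(2), of "(1/2) ^ j"]
    by auto
  define \<epsilon> where "\<epsilon> = min \<delta> ((1/2) ^ j)"
  have \<epsilon>: "0 < \<epsilon>" "\<epsilon> \<le> \<delta>" "\<epsilon> \<le> (1/2) ^ j" using \<delta>(1) by (auto simp: \<epsilon>_def)
  obtain f f' where f: "homeomorphism UNIV UNIV f f'" "bounded {x. f x \<noteq> x}"
    "\<And>x. dist (f x) x < \<epsilon> / 2" "f ` K ` C \<inter> P = {}"
    using push_tame_cantor_set_off[OF KC P, of "\<epsilon> / 2"] \<epsilon>(1) by auto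
  have fh: "homeo f" using f(1) by (rule homeoI)
  have "compact (f ` K ` C)"
    using tame_cantor_set_homeo[OF KC fh] by (intro compact_cantor_set tame_cantor_set_is_cantor_set)
  then obtain d where d: "0 < d" "\<And>y z. y \<in> f ` K ` C \<Longrightarrow> z \<in> P \<Longrightarrow> d \<le> dist y z"
    using separate_compact_closed[OF _ P(1) f(4)] by auto
  \<comment> \<open>The bound \<open>\<epsilon> / 2\<close> makes \<open>h m\<close> small enough to
    be accepted; the bound \<open>d / 2\<close> leaves the image of \<open>C\<close> at distance
    more than \<open>d / 2\<close> from \<open>P\<close>.\<close>
  obtain m where m: "\<And>x. dist (f x) (h m x) < min (\<epsilon> / 2) (d / 2)"
    using dense[OF fh f(2), of "min (\<epsilon> / 2) (d / 2)"] \<epsilon>(1) d(1) by auto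
  have hm: "dist (h m y) y < \<epsilon>" for y
    using m[of y] f(3)[of y] dist_triangle3[of "h m y" y "f y"] by simp
  have "accept j K (h m)"
    unfolding accept_def
  proof (intro conjI allI)
    show "dist (h m y) y < (1/2) ^ j" for y using hm[of y] \<epsilon>(3) by simp
    show "dist (inv K (inv (h m) y)) (inv K y) < (1/2) ^ j" for y
    proof (rule \<delta>(2))
      show "dist (inv (h m) y) y < \<delta>"
        using hm[of "inv (h m) y"] \<epsilon>(2) by (simp add: homeo_f_inv_f[OF h(1)] dist_commute)
    qed
  qed
  \<comment> \<open>From position \<open>Suc j\<close> on, the index \<open>m0\<close> of the
    identity is repeated, which leaves the map unchanged whether it is accepted or not. The word can
    thus be prolonged until the error of the limit is below \<open>d / 2\<close>, and then every
    parameter in its cylinder is good.\<close>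
  define q where "q i = (if i < j then p i else if i = j then m else m0)" for i
  have qj: "approx h q j = K" unfolding K_def by (rule approx_cong) (simp add: q_def)
  have q: "approx h q (Suc j + i) = h m \<circ> K" for i
  proof (induction i)
    case 0
    have "q j = m" by (simp add: q_def)
    then show ?case using \<open>accept j K (h m)\<close> qj by simp
  next
    case (Suc i)
    have "q (Suc j + i) = m0" by (simp add: q_def)
    then show ?case using Suc id by simp
  qed
  obtain M where M: "(1/2::real) ^ M < d / 4" using real_arch_pow_inv[of "d / 4" "1/2"] d(1) by auto
  define i where "i = Suc j + M"
  have "(1/2::real) ^ i \<le> (1/2) ^ M" by (intro power_decreasing) (auto simp: i_def)
  then have i: "2 * (1/2::real) ^ i < d / 2" using M by linarith
  have "cylinder q i \<subseteq> cylinder q j" by (rule cylinder_antimono) (simp add: i_def)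
  also have "cylinder q j = cylinder (address x) j" by (auto simp: cylinder_def q_def p_def)
  also note j
  finally have "interior (cylinder q i) \<subseteq> U" using interior_subset by (rule order_trans[rotated])
  moreover have "interior (cylinder q i) \<inter> {x. H (address x) ` C \<inter> P \<noteq> {}} = {}"
  proof (rule equals0I)
    fix y assume y: "y \<in> interior (cylinder q i) \<inter> {x. H (address x) ` C \<inter> P \<noteq> {}}"
    then have "y \<in> cylinder q i" using interior_subset by auto
    then have "approx h (address y) i = approx h q i" by (intro approx_cong) (simp add: cylinder_def)
    then have app: "approx h (address y) i = h m \<circ> K" using q i_def by simp
    obtain v where v: "v \<in> C" "H (address y) v \<in> P" using y by auto
    have "dist (h m (K v)) (H (address y) v) < d / 2" using H[of "address y" i v] i app by simp
    moreover have "dist (f (K v)) (h m (K v)) < d / 2" using m[of "K v"] by simp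
    moreover have "d \<le> dist (f (K v)) (H (address y) v)" using v by (intro d(2)) auto
    ultimately show False
      using dist_triangle[of "f (K v)" "H (address y) v" "h m (K v)"] by linarith
  qed
  ultimately show "\<exists>V. open V \<and> V \<noteq> {} \<and> V \<subseteq> U \<and> V \<inter> {x. H (address x) ` C \<inter> P \<noteq> {}} = {}"
    using interior_cylinder by (intro exI[of _ "interior (cylinder q i)"]) simp
qed

lemma hyperplane:
  fixes q :: real and i :: "'n::finite"
  shows "closed {v :: real ^ 'n. v $ i = q}" "nowhere_dense {v :: real ^ 'n. v $ i = q}"
proof -
  show cl: "closed {v :: real ^ 'n. v $ i = q}" by (intro closed_Collect_eq continuous_intros)
  have "{v :: real ^ 'n. v $ i = q} = {v. axis i 1 \<bullet> v = q}" by (simp add: inner_axis' )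
  moreover have "axis i (1::real) \<noteq> (0 :: real ^ 'n)" by (simp add: axis_eq_0_iff)
  ultimately have "interior {v :: real ^ 'n. v $ i = q} = {}" by (simp add: interior_hyperplane)
  then show "nowhere_dense {v :: real ^ 'n. v $ i = q}" using cl by (simp add: nowhere_dense_def)
qed

lemma nowhere_dense_compact_no_rationals:
  fixes S :: "real set"
  assumes "compact S" "\<And>q. q \<in> \<rat> \<Longrightarrow> q \<notin> S"
  shows "nowhere_dense S"
proof -
  have "interior S = {}"
  proof (rule equals0I)
    fix x assume "x \<in> interior S"
    then obtain e where e: "0 < e" "ball x e \<subseteq> S" by (auto simp: mem_interior)
    obtain q where q: "q \<in> \<rat>" "x < q" "q < x + e" using Rats_dense_in_real[of x "x + e"] e by auto
    then have "q \<in> ball x e" by (simp add: dist_real_def)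
    then show False using e(2) assms(2)[OF q(1)] by auto
  qed
  then show ?thesis using compact_imp_closed[OF assms(1)] by (simp add: nowhere_dense_def)
qed

lemma generic_homeomorphisms:
  fixes k :: "'n::finite"
  shows "\<exists>H :: real \<Rightarrow> real ^ 'n \<Rightarrow> real ^ 'n. (\<forall>x. homeo (H x)) \<and>
    (\<forall>A \<in> sigma_C0 k. {x. \<exists>i. (\<lambda>v. v $ i) ` H x ` A \<notin> meager_ideal} \<in> meager_ideal)"
proof -
  define E where "E = {f :: real ^ 'n \<Rightarrow> real ^ 'n. homeo f \<and> bounded {x. f x \<noteq> x}}"
  obtain D where D: "countable D" "D \<subseteq> E" "\<forall>f\<in>E. \<forall>\<epsilon>>0. \<exists>g\<in>D. \<forall>x. dist (f x) (g x) < \<epsilon>"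
    using countable_approximation[of E] homeo_continuous unfolding E_def by fastforce
  \<comment> \<open>The identity joins the countable dense set so that a word can be prolonged
    without changing the map.\<close>
  define h where "h = from_nat_into (insert id D)"
  have range_h: "range h = insert id D"
    unfolding h_def using D(1) by (intro range_from_nat_into) auto
  have "id \<in> E" by (simp add: E_def homeo_id)
  then have hE: "h m \<in> E" for m using range_h D(2) rangeI[of h m] by auto
  then have h: "homeo (h m)" "bounded {x. h m x \<noteq> x}" for m by (auto simp: E_def)
  obtain m0 where m0: "h m0 = id" using range_h by (metis insertI1 rangeE)
  have dense: "\<exists>m. \<forall>x. dist (f x) (h m x) < \<epsilon>" if f: "homeo f" "bounded {x. f x \<noteq> x}" "0 < \<epsilon>" for f \<epsilon>
  proof -
    have "f \<in> E" using f by (simp add: E_def)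
    then obtain g where g: "g \<in> D" "\<forall>x. dist (f x) (g x) < \<epsilon>" using D(3) f(3) by meson
    obtain m where "g = h m" using range_h g(1) by (metis insertI2 rangeE)
    then show ?thesis using g(2) by auto
  qed
  have "\<exists>H. homeo H \<and> (\<forall>j x. dist (approx h p j x) (H x) \<le> 2 * (1/2) ^ j)" for p
    by (rule homeo_limit homeo_approx approx_step h)+
  then obtain H where H: "\<And>p. homeo (H p)" "\<And>p j x. dist (approx h p j x) (H p x) \<le> 2 * (1/2) ^ j"
    by metis
  have "{x. \<exists>i. (\<lambda>v. v $ i) ` H (address x) ` A \<notin> meager_ideal} \<in> meager_ideal"
    if A: "A \<in> sigma_C0 k" for A
  proof -
    obtain \<C> where \<C>: "countable \<C>" "\<forall>C\<in>\<C>. tame_cantor_set k C" "A \<subseteq> \<Union>\<C>"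
      using A by (auto simp: sigma_C0_def)
    define I where "I = \<C> \<times> (UNIV :: 'n set) \<times> (\<rat> :: real set)"
    define bad where "bad = (\<lambda>(C, i, q). {x. H (address x) ` C \<inter> {v. v $ i = q} \<noteq> {}})"
    have "countable I"
      unfolding I_def using \<C>(1) by (intro countable_SIGMA countable_rat) auto
    moreover have "bad c \<in> meager_ideal" if c: "c \<in> I" for c
    proof -
      obtain C i q where c': "c = (C, i, q)" "C \<in> \<C>" using c by (auto simp: I_def)
      have "nowhere_dense {x. H (address x) ` C \<inter> {v. v $ i = q} \<noteq> {}}"
        using \<C>(2) c'(2)
        by (intro nowhere_dense_bad_parameters[OF h dense m0 H(2) _ hyperplane]) auto
      then show ?thesis unfolding bad_def c' by (simp add: nowhere_dense_meager)
    qed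
    ultimately have bad: "(\<Union>c\<in>I. bad c) \<in> meager_ideal" by (rule meager_UN)
    have "x \<in> (\<Union>c\<in>I. bad c)" if x: "(\<lambda>v. v $ i) ` H (address x) ` A \<notin> meager_ideal" for x i
    proof (rule ccontr)
      assume good: "x \<notin> (\<Union>c\<in>I. bad c)"
      have "(\<lambda>v. v $ i) ` H (address x) ` C \<in> meager_ideal" if C: "C \<in> \<C>" for C
      proof (intro nowhere_dense_meager nowhere_dense_compact_no_rationals)
        have "compact C" using \<C>(2) C by (intro compact_cantor_set tame_cantor_set_is_cantor_set) auto
        then show "compact ((\<lambda>v. v $ i) ` H (address x) ` C)"
          by (intro compact_continuous_image continuous_intros
              continuous_on_subset[OF homeo_continuous[OF H(1)]]) auto
        show "q \<notin> (\<lambda>v. v $ i) ` H (address x) ` C" if "q \<in> \<rat>" for q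
        proof
          assume "q \<in> (\<lambda>v. v $ i) ` H (address x) ` C"
          then have "x \<in> bad (C, i, q)" by (auto simp: bad_def)
          moreover have "(C, i, q) \<in> I" using C that by (simp add: I_def)
          ultimately show False using good by auto
        qed
      qed
      then have "(\<Union>C\<in>\<C>. (\<lambda>v. v $ i) ` H (address x) ` C) \<in> meager_ideal"
        using \<C>(1) by (intro meager_UN)
      moreover have "(\<lambda>v. v $ i) ` H (address x) ` A \<subseteq> (\<Union>C\<in>\<C>. (\<lambda>v. v $ i) ` H (address x) ` C)"
      proof
        fix r assume "r \<in> (\<lambda>v. v $ i) ` H (address x) ` A"
        then obtain v where v: "v \<in> A" "r = H (address x) v $ i" by auto
        then obtain C where C: "C \<in> \<C>" "v \<in> C" using \<C>(3) by auto
        from C(2) have "r \<in> (\<lambda>v. v $ i) ` H (address x) ` C"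
          unfolding v(2) by (intro imageI)
        with C(1) show "r \<in> (\<Union>C\<in>\<C>. (\<lambda>v. v $ i) ` H (address x) ` C)" by (rule UN_I)
      qed
      ultimately show False using x meager_subset by metis
    qed
    then have "{x. \<exists>i. (\<lambda>v. v $ i) ` H (address x) ` A \<notin> meager_ideal} \<subseteq> (\<Union>c\<in>I. bad c)" by auto
    then show ?thesis by (rule meager_subset[OF bad])
  qed
  then show ?thesis using H(1) by (intro exI[of _ "\<lambda>x. H (address x)"]) simp
qed

section \<open>Cardinal invariants\<close>

text \<open>The value of \<open>min_card\<close> at the empty family is unspecified, hence the first
  premise; the second carries nonemptiness over to \<open>S\<close>.\<close>

lemma min_card_le:
  assumes "S' \<noteq> {}" "\<And>A. A \<in> S' \<Longrightarrow> \<exists>B\<in>S. |B| \<le>o |A|"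
  shows "min_card S \<le>o min_card S'"
proof -
  obtain A where A: "A \<in> S'" "min_card S' = |A|" using min_card(1)[OF assms(1)] by auto
  obtain B where B: "B \<in> S" "|B| \<le>o |A|" using assms(2)[OF A(1)] by auto
  then have "min_card S \<le>o |B|" by (intro min_card(2)) auto
  then show ?thesis unfolding A(2) using B(2) by (rule ordLeq_transitive)
qed

lemma infinite_if_Union_not_meager:
  "\<A> \<subseteq> meager_ideal \<Longrightarrow> \<Union>\<A> \<notin> meager_ideal \<Longrightarrow> infinite \<A>"
  using meager_Union countable_finite by metis

text \<open>An infinite family has the size of its square, so each further union costs no
  cardinality. The number \<open>n\<close> will be the dimension, since the coordinates of a point
  can lie in that many different members.\<close>

lemma family_absorbing_finite_unions:
  assumes "infinite \<A>" "\<A> \<subseteq> meager_ideal"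
  shows "\<exists>\<A>'\<subseteq>meager_ideal. |\<A>'| \<le>o |\<A>| \<and>
    (\<forall>F\<subseteq>\<A>. finite F \<longrightarrow> card F \<le> n \<longrightarrow> (\<exists>X\<in>\<A>'. \<Union>F \<subseteq> X))"
proof (induction n)
  case 0
  have "\<A> \<noteq> {}" using assms(1) by auto
  then show ?case using assms(2) by (intro exI[of _ \<A>]) (auto simp: card_of_refl ordIso_imp_ordLeq)
next
  case (Suc n)
  then obtain \<A>' where \<A>': "\<A>' \<subseteq> meager_ideal" "|\<A>'| \<le>o |\<A>|"
    "\<And>F. F \<subseteq> \<A> \<Longrightarrow> finite F \<Longrightarrow> card F \<le> n \<Longrightarrow> \<exists>X\<in>\<A>'. \<Union>F \<subseteq> X" by auto
  define \<B> where "\<B> = (\<lambda>(X, Y). X \<union> Y) ` (\<A>' \<times> \<A>)"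
  have "\<B> \<subseteq> meager_ideal"
  proof
    fix Z assume "Z \<in> \<B>"
    then obtain X Y where "X \<in> \<A>'" "Y \<in> \<A>" "Z = X \<union> Y" by (auto simp: \<B>_def)
    then show "Z \<in> meager_ideal" using meager_Union[of "{X, Y}"] assms(2) \<A>'(1) by auto
  qed
  moreover have "|\<B>| \<le>o |\<A>|"
  proof -
    have "|\<B>| \<le>o |\<A>' \<times> \<A>|" unfolding \<B>_def by (rule card_of_image)
    also have "|\<A>' \<times> \<A>| \<le>o |\<A> \<times> \<A>|" using \<A>'(2) by (rule card_of_Times_mono1)
    also have "|\<A> \<times> \<A>| \<le>o |\<A>|"
      using card_of_Times_same_infinite[OF assms(1)] by (rule ordIso_imp_ordLeq)
    finally show ?thesis .
  qed
  moreover have "\<exists>X\<in>\<B>. \<Union>F \<subseteq> X" if F: "F \<subseteq> \<A>" "finite F" "card F \<le> Suc n" for F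
  proof (cases "F = {}")
    case True
    have "\<A> \<noteq> {}" using assms(1) by auto
    moreover have "\<A>' \<noteq> {}" using \<A>'(3)[of "{}"] by auto
    ultimately have "\<B> \<noteq> {}" by (auto simp: \<B>_def)
    then show ?thesis using True by auto
  next
    case False
    then obtain Y where Y: "Y \<in> F" by auto
    have "F - {Y} \<subseteq> \<A>" "finite (F - {Y})" "card (F - {Y}) \<le> n" using F Y by auto
    from \<A>'(3)[OF this] obtain X where X: "X \<in> \<A>'" "\<Union>(F - {Y}) \<subseteq> X" by (rule bexE)
    have "(X, Y) \<in> \<A>' \<times> \<A>" using X(1) Y F(1) by auto
    then have "X \<union> Y \<in> \<B>" unfolding \<B>_def by (metis (mono_tags, lifting) image_eqI prod.case)
    moreover have "\<Union>F \<subseteq> X \<union> Y" using X(2) by auto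
    ultimately show ?thesis by (rule rev_bexI)
  qed
  ultimately show ?case by (intro exI[of _ \<B>]) simp
qed

definition cube :: "real set \<Rightarrow> (real ^ 'n) set" where
  "cube X = {v. \<forall>i. v $ i \<in> X}"

lemma cubes_of_family:
  assumes "infinite \<A>" "\<A> \<subseteq> meager_ideal"
  shows "\<exists>\<Q>\<subseteq>sigma_C0 (k :: 'n::finite). |\<Q>| \<le>o |\<A>| \<and> cube (\<Union>\<A>) \<subseteq> \<Union>\<Q>"
proof -
  obtain \<A>' where \<A>': "\<A>' \<subseteq> meager_ideal" "|\<A>'| \<le>o |\<A>|"
    "\<And>F. F \<subseteq> \<A> \<Longrightarrow> finite F \<Longrightarrow> card F \<le> CARD('n) \<Longrightarrow> \<exists>X\<in>\<A>'. \<Union>F \<subseteq> X"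
    using family_absorbing_finite_unions[OF assms, of "CARD('n)"] by auto
  have "cube ` \<A>' \<subseteq> sigma_C0 k" using \<A>'(1) cube_in_sigma_C0 by (auto simp: cube_def)
  moreover have "|cube ` \<A>' :: (real ^ 'n) set set| \<le>o |\<A>|"
    using card_of_image \<A>'(2) by (rule ordLeq_transitive)
  moreover have "v \<in> \<Union>(cube ` \<A>')" if v: "v \<in> cube (\<Union>\<A>)" for v :: "real ^ 'n"
  proof -
    have "\<forall>i. \<exists>A. A \<in> \<A> \<and> v $ i \<in> A" using v by (auto simp: cube_def)
    from choice[OF this] obtain f where f: "\<forall>i. f i \<in> \<A> \<and> v $ i \<in> f i" by (rule exE)
    obtain X where X: "X \<in> \<A>'" "\<Union>(range f) \<subseteq> X"
      using \<A>'(3)[of "range f"] f card_image_le[of UNIV f] by auto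
    have "v \<in> cube X" using f X(2) by (auto simp: cube_def)
    then show ?thesis using X(1) by auto
  qed
  ultimately show ?thesis by (intro exI[of _ "cube ` \<A>'"]) auto
qed

lemma homeomorphism_inv: "homeo f \<Longrightarrow> homeomorphism UNIV UNIV (inv f) f"
  unfolding homeo_def by (rule homeomorphism_symD)

lemma subset_cube: "\<Union>(range (\<lambda>i. (\<lambda>v. v $ i) ` A)) \<subseteq> B \<Longrightarrow> A \<subseteq> cube B"
  by (auto simp: cube_def)

lemma Union_sigma_C0: "\<Union>(sigma_C0 (k :: 'n::finite)) = UNIV"
proof -
  have "v \<in> \<Union>(sigma_C0 k)" for v :: "real ^ 'n"
  proof -
    have "(\<Union>i\<in>UNIV. {v $ i}) \<in> meager_ideal"
      by (intro meager_UN nowhere_dense_meager) (auto simp: countable_finite nowhere_dense_def)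
    then have "cube (\<Union>i\<in>UNIV. {v $ i}) \<in> sigma_C0 k" unfolding cube_def by (rule cube_in_sigma_C0)
    moreover have "v \<in> cube (\<Union>i\<in>UNIV. {v $ i})" by (auto simp: cube_def)
    ultimately show ?thesis by (rule UnionI)
  qed
  then show ?thesis by auto
qed

lemma Union_meager_vec: "\<Union>(meager_ideal :: (real ^ 'n::finite) set set) = UNIV"
  using Union_sigma_C0 sigma_C0_meager by (metis Union_mono top.extremum_uniqueI)

lemma UNIV_not_sigma_C0: "UNIV \<notin> sigma_C0 k"
  using UNIV_not_meager sigma_C0_meager by (metis subsetD)

context
  fixes k :: "'n::finite"
begin

abbreviation (input) M1 :: "real set set" where "M1 \<equiv> meager_ideal"
abbreviation (input) Mn :: "(real ^ 'n) set set" where "Mn \<equiv> meager_ideal"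

section \<open>Comparison of the meager ideals of the line and of the space\<close>

lemma cov_M1_le_cov_Mn: "cov_ideal M1 \<le>o cov_ideal Mn"
  unfolding cov_ideal_def
proof (rule min_card_le)
  fix \<A> assume A: "\<A> \<in> {\<A>. \<A> \<subseteq> Mn \<and> \<Union>\<A> = \<Union>Mn}"
  obtain s :: "real ^ 'n \<Rightarrow> real" where s: "bij s" "\<forall>A \<in> meager_ideal. s ` A \<in> meager_ideal"
    using meager_bijection by metis
  have "\<Union>((`) s ` \<A>) = s ` \<Union>\<A>" by auto
  also have "\<Union>\<A> = UNIV" using A Union_meager_vec by auto
  also have "s ` UNIV = \<Union>M1" using bij_is_surj[OF s(1)] Union_meager by metis
  finally have "\<Union>((`) s ` \<A>) = \<Union>M1" .
  moreover have "(`) s ` \<A> \<subseteq> M1" using A s(2) by auto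
  moreover have "|(`) s ` \<A>| \<le>o |\<A>|" by (rule card_of_image)
  ultimately show "\<exists>B\<in>{\<A>. \<A> \<subseteq> M1 \<and> \<Union>\<A> = \<Union>M1}. |B| \<le>o |\<A>|"
    by (intro bexI[of _ "(`) s ` \<A>"]) simp_all
qed auto

lemma non_Mn_le_non_M1: "non_ideal Mn \<le>o non_ideal M1"
  unfolding non_ideal_def
proof (rule min_card_le)
  show "{A. A \<subseteq> \<Union>M1 \<and> A \<notin> M1} \<noteq> {}" using UNIV_not_meager Union_meager by auto
  fix X assume X: "X \<in> {A. A \<subseteq> \<Union>M1 \<and> A \<notin> M1}"
  obtain s :: "real ^ 'n \<Rightarrow> real" where s: "bij s" "\<forall>A \<in> meager_ideal. s ` A \<in> meager_ideal"
    using meager_bijection by metis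
  have "s ` (s -` X) = X" using bij_is_surj[OF s(1)] by (rule surj_image_vimage_eq)
  then have "s -` X \<notin> Mn" using s(2) X by auto
  moreover have "|s -` X| \<le>o |X|"
    unfolding bij_vimage_eq_inv_image[OF s(1)] by (rule card_of_image)
  ultimately show "\<exists>B\<in>{A. A \<subseteq> \<Union>Mn \<and> A \<notin> Mn}. |B| \<le>o |X|"
    by (intro bexI[of _ "s -` X"]) (simp_all add: Union_meager_vec)
qed

lemma add_M1_le_add_Mn: "add_ideal M1 \<le>o add_ideal Mn"
  unfolding add_ideal_def
proof (rule min_card_le)
  show "{\<A>. \<A> \<subseteq> Mn \<and> \<Union>\<A> \<notin> Mn} \<noteq> {}"
    by (rule ex_in_conv[THEN iffD1, OF exI[of _ "Mn"]]) (simp add: UNIV_not_meager Union_meager_vec)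
  fix \<A> assume A: "\<A> \<in> {\<A>. \<A> \<subseteq> Mn \<and> \<Union>\<A> \<notin> Mn}"
  obtain s :: "real ^ 'n \<Rightarrow> real" where s: "bij s" "\<forall>A \<in> meager_ideal. s ` A \<in> meager_ideal"
    "\<forall>B \<in> meager_ideal. s -` B \<in> meager_ideal"
    using meager_bijection by metis
  have "s -` \<Union>((`) s ` \<A>) = \<Union>\<A>"
    using bij_is_inj[OF s(1)] by (metis image_Union inj_vimage_image_eq)
  then have "\<Union>((`) s ` \<A>) \<notin> M1" using s(3) A by auto
  moreover have "(`) s ` \<A> \<subseteq> M1" using A s(2) by auto
  ultimately show "\<exists>B\<in>{\<A>. \<A> \<subseteq> M1 \<and> \<Union>\<A> \<notin> M1}. |B| \<le>o |\<A>|"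
    by (intro bexI[of _ "(`) s ` \<A>"] card_of_image) simp_all
qed

lemma cof_Mn_le_cof_M1: "cof_ideal Mn \<le>o cof_ideal M1"
  unfolding cof_ideal_def
proof (rule min_card_le)
  show "{\<A>. \<A> \<subseteq> M1 \<and> (\<forall>B\<in>M1. \<exists>A\<in>\<A>. B \<subseteq> A)} \<noteq> {}" by auto
  fix \<B> assume B: "\<B> \<in> {\<A>. \<A> \<subseteq> M1 \<and> (\<forall>B\<in>M1. \<exists>A\<in>\<A>. B \<subseteq> A)}"
  obtain s :: "real ^ 'n \<Rightarrow> real" where s: "\<forall>A \<in> meager_ideal. s ` A \<in> meager_ideal"
    "\<forall>B \<in> meager_ideal. s -` B \<in> meager_ideal"
    using meager_bijection by metis
  have "\<exists>A\<in>(-`) s ` \<B>. X \<subseteq> A" if "X \<in> Mn" for X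
  proof -
    have "s ` X \<in> M1" using s(1) that by auto
    then have "\<exists>A\<in>\<B>. s ` X \<subseteq> A" using B by simp
    then obtain A where "A \<in> \<B>" "s ` X \<subseteq> A" by (rule bexE)
    then show ?thesis by (intro bexI[of _ "s -` A"]) auto
  qed
  moreover have "(-`) s ` \<B> \<subseteq> Mn" using B s(2) by auto
  ultimately show "\<exists>A\<in>{\<A>. \<A> \<subseteq> Mn \<and> (\<forall>B\<in>Mn. \<exists>A\<in>\<A>. B \<subseteq> A)}. |A| \<le>o |\<B>|"
    by (intro bexI[of _ "(-`) s ` \<B>"] card_of_image) simp_all
qed

section \<open>Covering number and uniformity\<close>

lemma cov_sigma_le_cov_M1: "cov_ideal (sigma_C0 k) \<le>o cov_ideal M1"
  unfolding cov_ideal_def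
proof (rule min_card_le)
  fix \<A> assume "\<A> \<in> {\<A>. \<A> \<subseteq> M1 \<and> \<Union>\<A> = \<Union>M1}"
  then have A: "\<A> \<subseteq> M1" "\<Union>\<A> = UNIV" using Union_meager by auto
  then have "infinite \<A>" using infinite_if_Union_not_meager UNIV_not_meager by metis
  then obtain \<Q> where Q: "\<Q> \<subseteq> sigma_C0 k" "|\<Q>| \<le>o |\<A>|" "cube (\<Union>\<A>) \<subseteq> \<Union>\<Q>"
    using cubes_of_family[OF _ A(1)] by metis
  have "\<Union>\<Q> = UNIV" using Q(3) unfolding A(2) cube_def by auto
  then show "\<exists>B\<in>{\<A>. \<A> \<subseteq> sigma_C0 k \<and> \<Union>\<A> = \<Union>(sigma_C0 k)}. |B| \<le>o |\<A>|"
    using Q by (intro bexI[of _ \<Q>]) (simp_all add: Union_sigma_C0)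
qed auto

lemma cov_Mn_le_cov_sigma: "cov_ideal Mn \<le>o cov_ideal (sigma_C0 k)"
  unfolding cov_ideal_def
proof (rule min_card_le)
  fix \<A> assume A: "\<A> \<in> {\<A>. \<A> \<subseteq> sigma_C0 k \<and> \<Union>\<A> = \<Union>(sigma_C0 k)}"
  then have "\<A> \<subseteq> Mn" using sigma_C0_meager by auto
  then show "\<exists>B\<in>{\<A>. \<A> \<subseteq> Mn \<and> \<Union>\<A> = \<Union>Mn}. |B| \<le>o |\<A>|"
    using A by (intro bexI[of _ \<A>]) (simp_all add: card_of_mono1 Union_meager_vec Union_sigma_C0)
qed auto

text \<open>A set with meager coordinate projections lies in the cube of their union, so a set
  outside \<open>sigma_C0 k\<close> has a nonmeager projection, which is no larger than the
  set.\<close>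

lemma non_M1_le_non_sigma: "non_ideal M1 \<le>o non_ideal (sigma_C0 k)"
  unfolding non_ideal_def
proof (rule min_card_le)
  show "{A. A \<subseteq> \<Union>(sigma_C0 k) \<and> A \<notin> sigma_C0 k} \<noteq> {}"
    by (rule ex_in_conv[THEN iffD1, OF exI[of _ "UNIV"]]) (simp add: UNIV_not_sigma_C0 Union_sigma_C0)
  fix A assume A: "A \<in> {A. A \<subseteq> \<Union>(sigma_C0 k) \<and> A \<notin> sigma_C0 k}"
  have "\<exists>i. (\<lambda>v. v $ i) ` A \<notin> M1"
  proof (rule ccontr)
    assume no: "\<not> ?thesis"
    then have "\<Union>(range (\<lambda>i. (\<lambda>v. v $ i) ` A)) \<in> M1"
      by (intro meager_UN) (auto simp: countable_finite)
    then have "cube (\<Union>(range (\<lambda>i. (\<lambda>v. v $ i) ` A))) \<in> sigma_C0 k"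
      unfolding cube_def by (rule cube_in_sigma_C0)
    then have "A \<in> sigma_C0 k" using subset_cube[OF order_refl] by (rule sigma_C0_subset)
    then show False using A by simp
  qed
  then obtain i where "(\<lambda>v. v $ i) ` A \<notin> M1" by (rule exE)
  then show "\<exists>B\<in>{A. A \<subseteq> \<Union>M1 \<and> A \<notin> M1}. |B| \<le>o |A|"
    by (intro bexI[of _ "(\<lambda>v. v $ i) ` A"] card_of_image) (simp add: Union_meager)
qed

lemma non_sigma_le_non_Mn: "non_ideal (sigma_C0 k) \<le>o non_ideal Mn"
  unfolding non_ideal_def
proof (rule min_card_le)
  show "{A. A \<subseteq> \<Union>Mn \<and> A \<notin> Mn} \<noteq> {}"
    by (rule ex_in_conv[THEN iffD1, OF exI[of _ "UNIV"]]) (simp add: UNIV_not_meager Union_meager_vec)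
  fix A assume A: "A \<in> {A. A \<subseteq> \<Union>Mn \<and> A \<notin> Mn}"
  then have "A \<notin> sigma_C0 k" using sigma_C0_meager by auto
  then show "\<exists>B\<in>{A. A \<subseteq> \<Union>(sigma_C0 k) \<and> A \<notin> sigma_C0 k}. |B| \<le>o |A|"
    by (intro bexI[of _ A]) (simp_all add: card_of_mono1 Union_sigma_C0)
qed

section \<open>Additivity\<close>

lemma add_M1_le_add_sigma: "add_ideal M1 \<le>o add_ideal (sigma_C0 k)"
  unfolding add_ideal_def
proof (rule min_card_le)
  show "{\<A>. \<A> \<subseteq> sigma_C0 k \<and> \<Union>\<A> \<notin> sigma_C0 k} \<noteq> {}"
    by (rule ex_in_conv[THEN iffD1, OF exI[of _ "sigma_C0 k"]]) (simp add: UNIV_not_sigma_C0 Union_sigma_C0)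
  fix \<A> assume "\<A> \<in> {\<A>. \<A> \<subseteq> sigma_C0 k \<and> \<Union>\<A> \<notin> sigma_C0 k}"
  then have A: "\<A> \<subseteq> sigma_C0 k" "\<Union>\<A> \<notin> sigma_C0 k" by auto
  obtain H :: "real \<Rightarrow> real ^ 'n \<Rightarrow> real ^ 'n" where H: "\<forall>x. homeo (H x)"
    "\<forall>A \<in> sigma_C0 k. {x. \<exists>i. (\<lambda>v. v $ i) ` H x ` A \<notin> meager_ideal} \<in> meager_ideal"
    using generic_homeomorphisms[of k] by (elim exE conjE)
  define bad where "bad A = {x. \<exists>i. (\<lambda>v. v $ i) ` H x ` A \<notin> M1}" for A
  \<comment> \<open>If the sets of bad parameters have a nonmeager union, they form the required
    family themselves. Otherwise one parameter \<open>x\<close> serves all members of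
    \<open>\<A>\<close>, and the projections taken at \<open>x\<close> form it.\<close>
  have "\<exists>\<B>. \<B> \<subseteq> M1 \<and> \<Union>\<B> \<notin> M1 \<and> |\<B>| \<le>o |\<A>|"
  proof (cases "\<Union>(bad ` \<A>) \<in> M1")
    case False
    moreover have "bad ` \<A> \<subseteq> M1" using A(1) H(2) unfolding bad_def by auto
    ultimately show ?thesis by (intro exI[of _ "bad ` \<A>"] conjI card_of_image)
  next
    case True
    then have "\<Union>(bad ` \<A>) \<noteq> UNIV" using UNIV_not_meager by metis
    then obtain x where x: "\<And>A. A \<in> \<A> \<Longrightarrow> x \<notin> bad A" by auto
    define proj where "proj A = \<Union>(range (\<lambda>i. (\<lambda>v. v $ i) ` H x ` A))" for A
    have "proj ` \<A> \<subseteq> M1"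
    proof clarify
      fix A assume "A \<in> \<A>"
      then show "proj A \<in> M1"
        unfolding proj_def using x by (intro meager_UN) (auto simp: bad_def countable_finite)
    qed
    moreover have "\<Union>(proj ` \<A>) \<notin> M1"
    proof
      assume "\<Union>(proj ` \<A>) \<in> M1"
      then have "cube (\<Union>(proj ` \<A>)) \<in> sigma_C0 k" unfolding cube_def by (rule cube_in_sigma_C0)
      moreover have "H x ` \<Union>\<A> \<subseteq> cube (\<Union>(proj ` \<A>))"
        by (rule subset_cube) (auto simp: proj_def)
      ultimately have "H x ` \<Union>\<A> \<in> sigma_C0 k" by (rule sigma_C0_subset)
      moreover have "homeomorphism UNIV UNIV (inv (H x)) (H x)"
        using H(1) by (intro homeomorphism_inv) simp
      ultimately have "inv (H x) ` H x ` \<Union>\<A> \<in> sigma_C0 k" by (rule sigma_C0_image)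
      moreover have "inv (H x) ` H x ` \<Union>\<A> = \<Union>\<A>"
        unfolding image_image using homeo_inv_f_f[of "H x"] H(1) by simp
      ultimately show False using A(2) by simp
    qed
    ultimately show ?thesis by (intro exI[of _ "proj ` \<A>"] conjI card_of_image)
  qed
  then show "\<exists>B\<in>{\<A>. \<A> \<subseteq> M1 \<and> \<Union>\<A> \<notin> M1}. |B| \<le>o |\<A>|" by auto
qed

lemma add_sigma_le_add_sigma_Mn: "add_ideal (sigma_C0 k) \<le>o add_ideals (sigma_C0 k) Mn"
  unfolding add_ideal_def add_ideals_def
proof (rule min_card_le)
  show "{\<A>. \<A> \<subseteq> sigma_C0 k \<and> \<Union>\<A> \<notin> Mn} \<noteq> {}"
    by (rule ex_in_conv[THEN iffD1, OF exI[of _ "sigma_C0 k"]]) (simp add: UNIV_not_meager Union_sigma_C0)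
  fix \<A> assume A: "\<A> \<in> {\<A>. \<A> \<subseteq> sigma_C0 k \<and> \<Union>\<A> \<notin> Mn}"
  then have "\<Union>\<A> \<notin> sigma_C0 k" using sigma_C0_meager by auto
  then show "\<exists>B\<in>{\<A>. \<A> \<subseteq> sigma_C0 k \<and> \<Union>\<A> \<notin> sigma_C0 k}. |B| \<le>o |\<A>|"
    using A by (intro bexI[of _ \<A>]) (simp_all add: card_of_mono1)
qed

lemma add_Mn_le_add_sigma_Mn: "add_ideal Mn \<le>o add_ideals (sigma_C0 k) Mn"
  unfolding add_ideal_def add_ideals_def
proof (rule min_card_le)
  show "{\<A>. \<A> \<subseteq> sigma_C0 k \<and> \<Union>\<A> \<notin> Mn} \<noteq> {}"
    by (rule ex_in_conv[THEN iffD1, OF exI[of _ "sigma_C0 k"]]) (simp add: UNIV_not_meager Union_sigma_C0)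
  fix \<A> assume A: "\<A> \<in> {\<A>. \<A> \<subseteq> sigma_C0 k \<and> \<Union>\<A> \<notin> Mn}"
  then have "\<A> \<subseteq> Mn" using sigma_C0_meager by auto
  then show "\<exists>B\<in>{\<A>. \<A> \<subseteq> Mn \<and> \<Union>\<A> \<notin> Mn}. |B| \<le>o |\<A>|"
    using A by (intro bexI[of _ \<A>]) (simp_all add: card_of_mono1)
qed

lemma add_sigma_Mn_le_add_M1: "add_ideals (sigma_C0 k) Mn \<le>o add_ideal M1"
  unfolding add_ideal_def add_ideals_def
proof (rule min_card_le)
  show "{\<A>. \<A> \<subseteq> M1 \<and> \<Union>\<A> \<notin> M1} \<noteq> {}"
    by (rule ex_in_conv[THEN iffD1, OF exI[of _ "M1"]]) (simp add: UNIV_not_meager Union_meager)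
  fix \<A> assume "\<A> \<in> {\<A>. \<A> \<subseteq> M1 \<and> \<Union>\<A> \<notin> M1}"
  then have A: "\<A> \<subseteq> M1" "\<Union>\<A> \<notin> M1" by auto
  then obtain \<Q> where Q: "\<Q> \<subseteq> sigma_C0 k" "|\<Q>| \<le>o |\<A>|" "cube (\<Union>\<A>) \<subseteq> \<Union>\<Q>"
    using cubes_of_family[OF infinite_if_Union_not_meager] by metis
  have "cube (\<Union>\<A>) \<notin> Mn" unfolding cube_def using A(2) by (rule cube_not_meager)
  then have "\<Union>\<Q> \<notin> Mn" using Q(3) meager_subset by metis
  then show "\<exists>B\<in>{\<A>. \<A> \<subseteq> sigma_C0 k \<and> \<Union>\<A> \<notin> Mn}. |B| \<le>o |\<A>|"
    using Q by (intro bexI[of _ \<Q>]) simp_all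
qed

section \<open>Cofinality\<close>

lemma cof_sigma_Mn_le_cof_sigma: "cof_ideals (sigma_C0 k) Mn \<le>o cof_ideal (sigma_C0 k)"
  unfolding cof_ideal_def cof_ideals_def
proof (rule min_card_le)
  show "{\<A>. \<A> \<subseteq> sigma_C0 k \<and> (\<forall>B\<in>sigma_C0 k. \<exists>A\<in>\<A>. B \<subseteq> A)} \<noteq> {}" by auto
  fix \<A> assume A: "\<A> \<in> {\<A>. \<A> \<subseteq> sigma_C0 k \<and> (\<forall>B\<in>sigma_C0 k. \<exists>A\<in>\<A>. B \<subseteq> A)}"
  then have "\<A> \<subseteq> Mn" using sigma_C0_meager by auto
  then show "\<exists>B\<in>{\<A>. \<A> \<subseteq> Mn \<and> (\<forall>B\<in>sigma_C0 k. \<exists>A\<in>\<A>. B \<subseteq> A)}. |B| \<le>o |\<A>|"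
    using A by (intro bexI[of _ \<A>]) (simp_all add: card_of_mono1)
qed

lemma cof_sigma_Mn_le_cof_Mn: "cof_ideals (sigma_C0 k) Mn \<le>o cof_ideal Mn"
  unfolding cof_ideal_def cof_ideals_def
proof (rule min_card_le)
  show "{\<A>. \<A> \<subseteq> Mn \<and> (\<forall>B\<in>Mn. \<exists>A\<in>\<A>. B \<subseteq> A)} \<noteq> {}" by auto
  fix \<A> assume A: "\<A> \<in> {\<A>. \<A> \<subseteq> Mn \<and> (\<forall>B\<in>Mn. \<exists>A\<in>\<A>. B \<subseteq> A)}"
  have "\<forall>B\<in>sigma_C0 k. \<exists>A\<in>\<A>. B \<subseteq> A"
  proof
    fix B assume "B \<in> sigma_C0 k"
    then have "B \<in> Mn" using sigma_C0_meager by auto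
    then show "\<exists>A\<in>\<A>. B \<subseteq> A" using A by simp
  qed
  then show "\<exists>B\<in>{\<A>. \<A> \<subseteq> Mn \<and> (\<forall>B\<in>sigma_C0 k. \<exists>A\<in>\<A>. B \<subseteq> A)}. |B| \<le>o |\<A>|"
    using A by (intro bexI[of _ \<A>]) (simp_all add: card_of_mono1)
qed

text \<open>The parameters must come from \<open>\<B>\<close> and not from the sets to be covered,
  so each \<open>B\<close> receives a point \<open>x B\<close> outside it; this point is good for
  every \<open>A\<close> whose bad parameters lie in \<open>B\<close>. A second member
  \<open>B'\<close> covers the projections of \<open>A\<close>, and pairs are no more numerous than
  members because \<open>\<B>\<close> is infinite.\<close>

lemma cof_sigma_le_cof_M1: "cof_ideal (sigma_C0 k) \<le>o cof_ideal M1"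
  unfolding cof_ideal_def
proof (rule min_card_le)
  show "{\<A>. \<A> \<subseteq> M1 \<and> (\<forall>B\<in>M1. \<exists>A\<in>\<A>. B \<subseteq> A)} \<noteq> {}" by auto
  fix \<B> assume "\<B> \<in> {\<A>. \<A> \<subseteq> M1 \<and> (\<forall>B\<in>M1. \<exists>A\<in>\<A>. B \<subseteq> A)}"
  then have B: "\<B> \<subseteq> M1" "\<And>X. X \<in> M1 \<Longrightarrow> \<exists>A\<in>\<B>. X \<subseteq> A" by auto
  obtain H :: "real \<Rightarrow> real ^ 'n \<Rightarrow> real ^ 'n" where H: "\<forall>x. homeo (H x)"
    "\<forall>A \<in> sigma_C0 k. {x. \<exists>i. (\<lambda>v. v $ i) ` H x ` A \<notin> meager_ideal} \<in> meager_ideal"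
    using generic_homeomorphisms[of k] by (elim exE conjE)
  have "\<Union>M1 \<subseteq> \<Union>\<B>" using B(2) by fastforce
  then have "\<Union>\<B> \<notin> M1" using UNIV_not_meager Union_meager by (metis top.extremum_uniqueI)
  then have inf: "infinite \<B>" using infinite_if_Union_not_meager B(1) by metis
  have "\<forall>B\<in>\<B>. \<exists>x. x \<notin> B" using B(1) UNIV_not_meager by (metis UNIV_eq_I subsetD)
  from bchoice[OF this] obtain x where x: "\<forall>B\<in>\<B>. x B \<notin> B" by (rule exE)
  define \<Q> where "\<Q> = (\<lambda>(B, B'). inv (H (x B)) ` cube B') ` (\<B> \<times> \<B>)"
  have "|\<Q>| \<le>o |\<B> \<times> \<B>|" unfolding \<Q>_def by (rule card_of_image)
  also have "|\<B> \<times> \<B>| \<le>o |\<B>|" using card_of_Times_same_infinite[OF inf] by (rule ordIso_imp_ordLeq)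
  finally have "|\<Q>| \<le>o |\<B>|" .
  moreover have "\<Q> \<subseteq> sigma_C0 k"
  proof -
    have "inv (H y) ` cube B \<in> sigma_C0 k" if "B \<in> \<B>" for B y
    proof (rule sigma_C0_image)
      show "cube B \<in> sigma_C0 k" unfolding cube_def using that B(1) by (intro cube_in_sigma_C0) auto
      show "homeomorphism UNIV UNIV (inv (H y)) (H y)"
        using H(1) by (intro homeomorphism_inv) simp
    qed
    then show ?thesis unfolding \<Q>_def by auto
  qed
  moreover have "\<exists>Q\<in>\<Q>. A \<subseteq> Q" if A: "A \<in> sigma_C0 k" for A
  proof -
    have "{x. \<exists>i. (\<lambda>v. v $ i) ` H x ` A \<notin> M1} \<in> M1" using H(2) A by (rule bspec)
    from B(2)[OF this] obtain B
      where B1: "B \<in> \<B>" "{x. \<exists>i. (\<lambda>v. v $ i) ` H x ` A \<notin> M1} \<subseteq> B" by (rule bexE)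
    then have "(\<lambda>v. v $ i) ` H (x B) ` A \<in> M1" for i using x by auto
    then have "\<Union>(range (\<lambda>i. (\<lambda>v. v $ i) ` H (x B) ` A)) \<in> M1"
      by (intro meager_UN) (auto simp: countable_finite)
    then obtain B' where B': "B' \<in> \<B>" "\<Union>(range (\<lambda>i. (\<lambda>v. v $ i) ` H (x B) ` A)) \<subseteq> B'"
      using B(2) by metis
    have "inv (H (x B)) ` H (x B) ` A \<subseteq> inv (H (x B)) ` cube B'"
      by (intro image_mono subset_cube B'(2))
    moreover have "inv (H (x B)) ` H (x B) ` A = A"
      unfolding image_image using homeo_inv_f_f[of "H (x B)"] H(1) by simp
    moreover have "inv (H (x B)) ` cube B' \<in> \<Q>"
      unfolding \<Q>_def using B1(1) B'(1) by (intro image_eqI[of _ _ "(B, B')"]) auto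
    ultimately show ?thesis by (intro bexI[of _ "inv (H (x B)) ` cube B'"]) simp_all
  qed
  ultimately show "\<exists>A\<in>{\<A>. \<A> \<subseteq> sigma_C0 k \<and> (\<forall>B\<in>sigma_C0 k. \<exists>A\<in>\<A>. B \<subseteq> A)}. |A| \<le>o |\<B>|"
    by (intro bexI[of _ \<Q>]) simp_all
qed

lemma cof_M1_le_cof_sigma_Mn: "cof_ideal M1 \<le>o cof_ideals (sigma_C0 k) Mn"
  unfolding cof_ideal_def cof_ideals_def
proof (rule min_card_le)
  show "{\<A>. \<A> \<subseteq> Mn \<and> (\<forall>B\<in>sigma_C0 k. \<exists>A\<in>\<A>. B \<subseteq> A)} \<noteq> {}"
    using sigma_C0_meager[of k] by auto
  fix \<B> assume B: "\<B> \<in> {\<A>. \<A> \<subseteq> Mn \<and> (\<forall>B\<in>sigma_C0 k. \<exists>A\<in>\<A>. B \<subseteq> A)}"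
  have "\<exists>B\<in>\<B>. {v. \<forall>i. v $ i \<in> A} \<subseteq> B" if "A \<in> M1" for A
    using B cube_in_sigma_C0[OF that, of k] by simp
  then have "\<exists>D :: (real ^ 'n) set \<Rightarrow> real set. D ` \<B> \<subseteq> M1 \<and> (\<forall>A\<in>M1. \<exists>B\<in>\<B>. A \<subseteq> D B)"
    using B by (intro cofinal_section) simp_all
  then obtain D :: "(real ^ 'n) set \<Rightarrow> real set"
    where "D ` \<B> \<subseteq> M1" "\<forall>A\<in>M1. \<exists>B\<in>\<B>. A \<subseteq> D B" by (elim exE conjE)
  then show "\<exists>A\<in>{\<A>. \<A> \<subseteq> M1 \<and> (\<forall>B\<in>M1. \<exists>A\<in>\<A>. B \<subseteq> A)}. |A| \<le>o |\<B>|"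
    by (intro bexI[of _ "D ` \<B>"] card_of_image) simp_all
qed

end

theorem theorem2p4:
  fixes k :: "'n::finite"
  shows "cov_ideal (sigma_C0 k) =o cov_ideal (meager_ideal :: (real ^ 'n) set set) \<and>
         non_ideal (sigma_C0 k) =o non_ideal (meager_ideal :: (real ^ 'n) set set) \<and>
         (add_ideal (sigma_C0 k) =o add_ideals (sigma_C0 k) meager_ideal \<and>
          add_ideals (sigma_C0 k) meager_ideal =o add_ideal (meager_ideal :: (real ^ 'n) set set)) \<and>
         (cof_ideal (sigma_C0 k) =o cof_ideals (sigma_C0 k) meager_ideal \<and>
          cof_ideals (sigma_C0 k) meager_ideal =o cof_ideal (meager_ideal :: (real ^ 'n) set set))"
  unfolding ordIso_iff_ordLeq
  \<comment> \<open>Each block is a cycle of inequalities: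
    \<open>add(S) \<le> add(S, Mn) \<le> add(M1) \<le> add(S)\<close>, which \<open>add(Mn)\<close>
    joins through \<open>add(M1) \<le> add(Mn) \<le> add(S, Mn)\<close>. Cofinality is dual, and
    \<open>cov\<close> and \<open>non\<close> run through the same ideals.\<close>
  by (intro conjI
      ordLeq_transitive[OF cov_sigma_le_cov_M1 cov_M1_le_cov_Mn] cov_Mn_le_cov_sigma
      non_sigma_le_non_Mn ordLeq_transitive[OF non_Mn_le_non_M1 non_M1_le_non_sigma]
      add_sigma_le_add_sigma_Mn ordLeq_transitive[OF add_sigma_Mn_le_add_M1 add_M1_le_add_sigma]
      ordLeq_transitive[OF add_sigma_Mn_le_add_M1 add_M1_le_add_Mn] add_Mn_le_add_sigma_Mn
      ordLeq_transitive[OF cof_sigma_le_cof_M1 cof_M1_le_cof_sigma_Mn] cof_sigma_Mn_le_cof_sigma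
      cof_sigma_Mn_le_cof_Mn ordLeq_transitive[OF cof_Mn_le_cof_M1 cof_M1_le_cof_sigma_Mn])

end
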